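(* Fix $\delta\in(-\infty,d-1)$, $c\in(0,\infty)$, let $p=(c+o_n(1))n^{-d+1+\delta}$ and let $\mathcal{H}$ be the random $d$-uniform hypergraph on $[n]$ with each $d$-subset a hyperedge independently with probability $p$. Suppose $3\le d\le 5$. If $\delta<\frac{2d-4}{2d-1}$ then the probability of exact recovery is $1-o_n(1)$; if $\delta>\frac{2d-4}{2d-1}$ then the probability of exact recovery is $o_n(1)$. Suppose $d\ge 5$. If $\delta<\frac{d-1}{d+1}$ then the probability of exact recovery is $1-o_n(1)$; if $\delta>\frac{d-1}{d+1}$ then the probability of exact recovery is $o_n(1)$.
   Context: $\mathrm{Proj}(H)$ is the graph on $[n]$ with $\{i,j\}$ an edge iff some hyperedge of $H$ contains $\{i,j\}$. The probability of exact recovery is $\Pr[\mathcal{A}^*(\mathrm{Proj}(\mathcal{H}))=\mathcal{H}]$, where $\mathcal{A}^*$ is the MAP estimator, i.e. the maximum over all functions $\mathcal{A}$ from projected graphs to $d$-uniform hypergraphs on $[n]$ of $\Pr[\mathcal{A}(\mathrm{Proj}(\mathcal{H}))=\mathcal{H}]$ (for $p<1/2$, $\mathcal{A}^*(G)$ is a preimage of $G$ with the minimum number of hyperedges). Asymptotics are as $n\to\infty$. *)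

theory Defs
  imports "HOL-Probability.Probability"
begin

text \<open>
  The vertex set is \<open>{1..n}\<close>. A \<open>d\<close>-uniform hypergraph on it is represented by its set of
  hyperedges, i.e. a subset of \<open>d_subsets n d\<close>, and a simple graph on it by its set of
  two-element edges.
\<close>

definition d_subsets :: "nat \<Rightarrow> nat \<Rightarrow> nat set set" where
  "d_subsets n d = {h. h \<subseteq> {1..n} \<and> card h = d}"

definition hypergraphs :: "nat \<Rightarrow> nat \<Rightarrow> nat set set set" where
  "hypergraphs n d = Pow (d_subsets n d)"

definition Proj :: "nat \<Rightarrow> nat set set \<Rightarrow> nat set set" where
  "Proj n H = {{i, j} |i j. i \<in> {1..n} \<and> j \<in> {1..n} \<and> i \<noteq> j \<and> (\<exists>h\<in>H. {i, j} \<subseteq> h)}"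

text \<open>
  The parameter of \<^const>\<open>bernoulli_pmf\<close> is truncated to \<open>[0, 1]\<close>, so the following is total
  in \<open>p\<close>.
\<close>

definition random_hypergraph :: "nat \<Rightarrow> nat \<Rightarrow> real \<Rightarrow> nat set set pmf" where
  "random_hypergraph n d p =
     map_pmf (\<lambda>X. {h \<in> d_subsets n d. X h})
       (Pi_pmf (d_subsets n d) False (\<lambda>_. bernoulli_pmf p))"

text \<open>
  Functions from projected graphs to hypergraphs. They are extensional, so there are only
  finitely many and the maximum below is attained.
\<close>

definition estimators :: "nat \<Rightarrow> nat \<Rightarrow> (nat set set \<Rightarrow> nat set set) set" where
  "estimators n d = Proj n ` hypergraphs n d \<rightarrow>\<^sub>E hypergraphs n d"

definition recovery_prob :: "nat \<Rightarrow> nat \<Rightarrow> real \<Rightarrow> (nat set set \<Rightarrow> nat set set) \<Rightarrow> real" where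
  "recovery_prob n d p A = measure_pmf.prob (random_hypergraph n d p) {H. A (Proj n H) = H}"

definition exact_recovery_prob :: "nat \<Rightarrow> nat \<Rightarrow> real \<Rightarrow> real" where
  "exact_recovery_prob n d p = (MAX A \<in> estimators n d. recovery_prob n d p A)"

lemma finite_hypergraphs: "finite (hypergraphs n d)"
  by (simp add: hypergraphs_def d_subsets_def)

lemma finite_estimators: "finite (estimators n d)"
  unfolding estimators_def by (intro finite_PiE finite_imageI finite_hypergraphs)

lemma estimators_nonempty: "estimators n d \<noteq> {}"
  by (auto simp: estimators_def PiE_eq_empty_iff hypergraphs_def)

lemma exact_recovery_prob_attained:
  "\<exists>A\<in>estimators n d. exact_recovery_prob n d p = recovery_prob n d p A"
proof -
  have "exact_recovery_prob n d p \<in> recovery_prob n d p ` estimators n d"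
    unfolding exact_recovery_prob_def
    by (rule Max_in) (simp_all add: finite_estimators estimators_nonempty)
  then show ?thesis by blast
qed

lemma recovery_prob_le_exact_recovery_prob:
  "A \<in> estimators n d \<Longrightarrow> recovery_prob n d p A \<le> exact_recovery_prob n d p"
  unfolding exact_recovery_prob_def by (simp add: finite_estimators)

end

theory Submission
  imports Defs "HOL-Real_Asymp.Real_Asymp"
begin

text \<open>
  Below the thresholds, a first moment bound shows that with high probability every bounded
  subhypergraph \<open>K\<close> of \<open>H\<close> spans more than \<open>\<theta> * card K\<close> vertices, where \<open>\<theta> = d - 1 - \<delta>\<^sub>0\<close> and \<open>\<delta>\<^sub>0\<close> is the
  threshold. This alone makes \<open>H\<close> its own unique smallest preimage. Suppose \<open>H'\<close> were another one, and let
  \<open>R = H - H'\<close> and \<open>F = H' - H\<close>. Every edge covered by exactly one of \<open>R\<close> and \<open>F\<close> is covered by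
  \<open>H \<inter> H'\<close>, and a discharging argument shows that \<open>R\<close> together with these covering hyperedges is too dense.
  That it may be taken bounded holds because closing a subhypergraph under overlapping fake cliques never
  increases the number of vertices minus \<open>\<theta>\<close> times the number of hyperedges.

  Above \<open>(d - 1) / (d + 1)\<close> there are fewer graphs with at most \<open>(d choose 2) * m\<close> edges than the inverse
  probability of a typical hypergraph with \<open>m\<close> hyperedges, so no estimator, which picks one hypergraph per
  graph, can succeed. Above \<open>(2d - 4) / (2d - 1)\<close> the second moment method finds arbitrarily many disjoint
  places where a hyperedge \<open>S \<union> {x}\<close> can be exchanged for \<open>S \<union> {y}\<close>, because all pairs \<open>{x, s}\<close> and
  \<open>{y, s}\<close> with \<open>s \<in> S\<close> are covered by further hyperedges.
\<close>

section \<open>Sparse hypergraphs\<close>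

text \<open>Both thresholds are balance points. Put a = d - 1 - \<delta>, so p is about n^(-a). A
  pattern with v vertices and k hyperedges has about n^(v - a * k) copies; the exchange pattern has
  v = d + 1 + 2(d-1)(d-2) and k = 2d - 1, and v = a * k gives (2d-4)/(2d-1). In the counting
  argument m hyperedges cost a * m * ln n in log-probability, while (d choose 2) * m pairs of
  density n^(\<delta> - 1) offer (d choose 2) * (1 - \<delta>) * m * ln n of choice; equality gives
  (d-1)/(d+1). The first moment bounds only hyperedges of H, so R and Q have to pay for everything.
  A q sharing exactly one pair with the exchanged sets lowers the potential by \<omega> = \<theta> -
  d + 2; a q lying inside their vertices lowers it by \<theta>, which is \<rho> per pair. At the
  counting threshold \<omega> = \<rho>. For d = 3, 4 it is \<omega> > \<rho>, and an edge can be
  rated \<omega> only where not all pairs of q need covering, which holds at vertices of degree one.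
  Such a vertex lacks 1 - \<gamma> - (d-1) * \<omega> / 2; for d = 3, 4 this is exactly \<kappa>,
  and at d = 5 it vanishes.\<close>

definition edges :: "'a set set \<Rightarrow> 'a set set" where
  "edges K = {e. card e = 2 \<and> (\<exists>h\<in>K. e \<subseteq> h)}"

lemma edges_mono: "K \<subseteq> K' \<Longrightarrow> edges K \<subseteq> edges K'"
  by (auto simp: edges_def)

lemma edges_Un: "edges (A \<union> B) = edges A \<union> edges B"
  by (auto simp: edges_def)

lemma card_edges_singleton:
  assumes "finite A"
  shows "card (edges {A}) = card A choose 2"
proof -
  have "edges {A} = {B. B \<subseteq> A \<and> card B = 2}" by (auto simp: edges_def)
  then show ?thesis using n_subsets[OF assms] by simp
qed

lemma finite_edges:
  assumes "finite K" "\<And>h. h \<in> K \<Longrightarrow> finite h"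
  shows "finite (edges K)"
  by (rule finite_subset[of _ "Pow (\<Union>K)"]) (use assms in \<open>auto simp: edges_def\<close>)

lemma card_Un_Union_le:
  assumes "finite B" "finite T" "\<And>k. k \<in> T \<Longrightarrow> finite k"
  shows "card (B \<union> \<Union>T) \<le> card B + (\<Sum>k\<in>T. card (k - B))"
  using assms(2,3)
proof (induction T)
  case empty
  then show ?case by simp
next
  case (insert k T)
  have "B \<union> \<Union>(insert k T) = (B \<union> \<Union>T) \<union> (k - B)" by auto
  then have "card (B \<union> \<Union>(insert k T)) \<le> card (B \<union> \<Union>T) + card (k - B)"
    using card_Un_le by metis
  then show ?case using insert by simp
qed

lemma real_choose_two: "real (n choose 2) = real n * (real n - 1) / 2"
proof -
  have "even (n * (n - 1))" by (cases n) auto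
  then have "real (n choose 2) = real (n * (n - 1)) / 2"
    by (simp add: choose_two real_of_nat_div)
  then show ?thesis by (cases n) (auto simp: algebra_simps)
qed

text \<open>A hyperedge with t vertices in a given set brings d - t new ones and changes the
  potential by d - t - \<theta>. This drop pays \<theta> / (d choose 2) for each pair of the
  overlap: as d(d-1) - t(t-1) = (d-t)(d+t-1), the critical case is t = 2, where it is the assumed
  lower bound on \<theta>.\<close>

lemma overlap_cost:
  fixes \<theta> :: real
  assumes "3 \<le> d" "real d * (real d - 1) / (real d + 1) \<le> \<theta>" "2 \<le> t" "t \<le> d"
  shows "\<theta> / real (d choose 2) * real (t choose 2) \<le> real t - real d + \<theta>"
    and "2 / (real d + 1) \<le> \<theta> / real (d choose 2)"
proof -
  have pos: "real d * (real d - 1) > 0" using assms by simp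
  have k: "1 / (real d + 1) \<le> \<theta> / (real d * (real d - 1))"
    using assms pos by (simp add: field_simps)
  have "2 / (real d + 1) = 2 * (1 / (real d + 1))" by simp
  also have "\<dots> \<le> 2 * (\<theta> / (real d * (real d - 1)))" using k by (rule mult_left_mono) simp
  also have "\<dots> = \<theta> / real (d choose 2)" by (simp add: real_choose_two)
  finally show "2 / (real d + 1) \<le> \<theta> / real (d choose 2)" .
  have "(real d + real t - 1) * (1 / (real d + 1)) \<le> (real d + real t - 1) * (\<theta> / (real d * (real d - 1)))"
    by (rule mult_left_mono[OF k]) (use assms in simp)
  moreover have "1 \<le> (real d + real t - 1) * (1 / (real d + 1))"
    using assms by (simp add: field_simps)
  ultimately have "1 \<le> (real d + real t - 1) * (\<theta> / (real d * (real d - 1)))" by linarith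
  then have "(real d - real t) * 1 \<le> (real d - real t) * ((real d + real t - 1) * (\<theta> / (real d * (real d - 1))))"
    by (rule mult_left_mono) (use assms in simp)
  also have "\<dots> = \<theta> * (real d * (real d - 1) - real t * (real t - 1)) / (real d * (real d - 1))"
    by (simp add: algebra_simps)
  also have "\<dots> = \<theta> - \<theta> / real (d choose 2) * real (t choose 2)"
  proof -
    have "\<theta> * (a - b) / a = \<theta> - \<theta> / (a / 2) * (b / 2)" if "a > 0" for a b :: real
      using that by (simp add: field_simps)
    from this[OF pos] show ?thesis by (simp add: real_choose_two)
  qed
  finally show "\<theta> / real (d choose 2) * real (t choose 2) \<le> real t - real d + \<theta>" by simp
qed

text \<open>
  The potential is \<open>card (\<Union>K) - \<theta> * card K\<close>. By \<open>overlap_cost\<close>, adding to \<open>K\<close> the hyperedges that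
  cover the missing pairs of a \<open>d\<close>-clique \<open>g\<close> sharing a pair with \<open>K\<close> does not increase it, while
  sparsity makes it at least \<open>\<eta> * card K\<close>. So the process of adding such covers stops at bounded size.
\<close>

lemma closed_subhypergraph_exists:
  fixes \<theta> \<eta> :: real and H :: "'a set set"
  assumes d: "3 \<le> d" and \<theta>: "real d * (real d - 1) / (real d + 1) \<le> \<theta>" "\<theta> \<le> real d" and \<eta>: "0 < \<eta>"
    and fin: "finite H" and cardH: "\<And>h. h \<in> H \<Longrightarrow> card h = d"
    and L: "(real d - \<theta>) / \<eta> + real d * real d \<le> real L"
    and sparse: "\<And>K. K \<subseteq> H \<Longrightarrow> card K \<le> L \<Longrightarrow> (\<theta> + \<eta>) * real (card K) \<le> real (card (\<Union>K))"
    and r: "r \<in> H"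
  obtains K where "K \<subseteq> H" "r \<in> K" "card K \<le> L"
    "\<And>k. k \<in> H \<Longrightarrow> 2 \<le> card (k \<inter> \<Union>K) \<Longrightarrow> k \<in> K"
    "\<And>g. card g = d \<Longrightarrow> edges {g} \<subseteq> edges H \<Longrightarrow> 2 \<le> card (g \<inter> \<Union>K) \<Longrightarrow> edges {g} \<subseteq> edges K"
proof -
  have fin1: "finite h" if "h \<in> H" for h using cardH[OF that] d by (intro card_ge_0_finite) simp
  \<comment> \<open>The potential bound is that of \<open>{r}\<close>. Taking a member with the most
    hyperedges replaces iterating the covering steps.\<close>
  define C where "C = {K. K \<subseteq> H \<and> r \<in> K \<and> card K \<le> L \<and> real (card (\<Union>K)) - \<theta> * real (card K) \<le> real d - \<theta>}"
  have "finite C" by (rule finite_subset[of _ "Pow H"]) (use fin in \<open>auto simp: C_def\<close>)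
  have dd: "real d * real d \<ge> 1" using d by (simp add: mult_ge1_I)
  have L1: "real L \<ge> 1" using L dd \<theta> \<eta> by (smt (verit) divide_nonneg_pos)
  have "{r} \<in> C" using r L1 cardH[OF r] by (auto simp: C_def)
  then obtain K where K: "K \<in> C" and max: "\<And>K'. K' \<in> C \<Longrightarrow> card K' \<le> card K"
    using obtains_MAX[OF \<open>finite C\<close>, of card] \<open>finite C\<close> by (metis Max_ge empty_iff finite_imageI imageI)
  have KH: "K \<subseteq> H" and finK: "finite K" using K fin finite_subset by (auto simp: C_def)
  have finU: "finite (\<Union>K)" using finK KH fin1 by auto
  have "(\<theta> + \<eta>) * real (card K) \<le> real (card (\<Union>K))" using sparse[of K] K by (auto simp: C_def)
  then have "\<eta> * real (card K) \<le> real d - \<theta>" using K by (auto simp: C_def algebra_simps)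
  then have Kbound: "real (card K) \<le> (real d - \<theta>) / \<eta>" using \<eta> by (simp add: field_simps)
  \<comment> \<open>Otherwise \<open>K \<union> T\<close> would be a larger member of
    \<open>C\<close>. The summand \<open>real d * real d\<close> in the bound on \<open>L\<close>
    leaves room for the at most (d choose 2) new hyperedges.\<close>
  have ext: "T = {}" if T: "T \<subseteq> H - K" "card T \<le> d choose 2"
    "real (card (\<Union>(K \<union> T))) - \<theta> * (real (card K) + real (card T)) \<le> real (card (\<Union>K)) - \<theta> * real (card K)" for T
  proof (rule ccontr)
    assume ne: "T \<noteq> {}"
    have finT: "finite T" using T fin finite_subset by auto
    have cT: "card (K \<union> T) = card K + card T" using T finK finT by (intro card_Un_disjoint) auto
    have "real (d choose 2) \<le> real d * real d" using d by (simp add: real_choose_two algebra_simps)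
    then have "real (card (K \<union> T)) \<le> real L" using cT Kbound L T(2)
      by (smt (verit) of_nat_add of_nat_mono)
    then have "K \<union> T \<in> C" using K T cT KH by (auto simp: C_def)
    then have "card (K \<union> T) \<le> card K" by (rule max)
    then show False using cT ne finT by (simp)
  qed
  have c1: "k \<in> K" if k: "k \<in> H" "2 \<le> card (k \<inter> \<Union>K)" for k
  proof (rule ccontr)
    assume "k \<notin> K"
    have fk: "finite k" using fin1 k by auto
    have t: "card (k \<inter> \<Union>K) \<le> d" using cardH[OF k(1)] card_mono[OF fk, of "k \<inter> \<Union>K"] by auto
    have "card (\<Union>K \<union> \<Union>{k}) \<le> card (\<Union>K) + (\<Sum>k\<in>{k}. card (k - \<Union>K))"
      by (rule card_Un_Union_le) (use finU fk in auto)
    moreover have "card (k - \<Union>K) = d - card (k \<inter> \<Union>K)"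
      using cardH[OF k(1)] fk by (simp add: card_Diff_subset_Int)
    moreover have "\<theta> / real (d choose 2) * real (card (k \<inter> \<Union>K) choose 2) \<ge> 0"
      using overlap_cost(2)[OF d \<theta>(1) k(2) t]
      by (intro mult_nonneg_nonneg) (auto intro: order_trans[rotated])
    ultimately have "{k} = {}"
      using overlap_cost(1)[OF d \<theta>(1) k(2) t] t k(1) \<open>k \<notin> K\<close> d
      by (intro ext) (auto simp: algebra_simps Suc_le_eq Un_commute)
    then show False by simp
  qed
  have c2: "edges {g} \<subseteq> edges K" if g: "card g = d" "edges {g} \<subseteq> edges H" "2 \<le> card (g \<inter> \<Union>K)" for g
  proof -
    have fg: "finite g" using g d by (intro card_ge_0_finite) simp
    define N where "N = edges {g} - edges K"
    have finN: "finite N" using fg finite_edges[of "{g}"] by (auto simp: N_def)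
    have "\<forall>e\<in>N. \<exists>k\<in>H. e \<subseteq> k" using g(2) by (auto simp: N_def edges_def)
    then obtain k where k: "\<And>e. e \<in> N \<Longrightarrow> k e \<in> H \<and> e \<subseteq> k e" by metis
    define T where "T = k ` N"
    have TK: "T \<subseteq> H - K"
    proof
      fix t assume "t \<in> T"
      then obtain e where e: "e \<in> N" "t = k e" by (auto simp: T_def)
      then have "e \<subseteq> k e" "k e \<in> H" "card e = 2" "e \<notin> edges K" using k by (auto simp: N_def edges_def)
      then show "t \<in> H - K" using e(2) by (auto simp: edges_def)
    qed
    have finT: "finite T" using finN by (simp add: T_def)
    have fT: "finite t" "card t = d" if "t \<in> T" for t using that TK fin1 cardH by auto
    have cardT: "card T \<le> d choose 2"
    proof -
      have "card T \<le> card N" unfolding T_def by (rule card_image_le[OF finN])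
      also have "\<dots> \<le> card (edges {g})" unfolding N_def
        by (rule card_mono) (use fg finite_edges[of "{g}"] in auto)
      finally show ?thesis using card_edges_singleton[OF fg] g(1) by simp
    qed
    let ?s = "card (g \<inter> \<Union>K)"
    have sd: "?s \<le> d" using g(1) card_mono[OF fg, of "g \<inter> \<Union>K"] by auto
    have tk: "2 \<le> card (t \<inter> g)" "card (t \<inter> g) \<le> d" if t: "t \<in> T" for t
    proof -
      obtain e where "e \<in> N" "t = k e" using t by (auto simp: T_def)
      then have "e \<subseteq> t \<inter> g" "card e = 2" using k by (auto simp: N_def edges_def)
      then show "2 \<le> card (t \<inter> g)" using card_mono[of "t \<inter> g" e] fg by auto
      show "card (t \<inter> g) \<le> d" using g(1) card_mono[OF fg, of "t \<inter> g"] by auto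
    qed
    have "card N \<le> card (\<Union>t\<in>T. edges {t \<inter> g})"
    proof (rule card_mono)
      show "finite (\<Union>t\<in>T. edges {t \<inter> g})" using finT fg by (auto intro!: finite_edges)
      show "N \<subseteq> (\<Union>t\<in>T. edges {t \<inter> g})"
      proof
        fix e assume e: "e \<in> N"
        then have "e \<subseteq> k e \<inter> g" "card e = 2" using k[OF e] by (auto simp: N_def edges_def)
        then show "e \<in> (\<Union>t\<in>T. edges {t \<inter> g})" using e by (auto simp: T_def edges_def)
      qed
    qed
    also have "\<dots> \<le> (\<Sum>t\<in>T. card (edges {t \<inter> g}))" by (rule card_UN_le[OF finT])
    also have "\<dots> = (\<Sum>t\<in>T. card (t \<inter> g) choose 2)"
      using fg by (intro sum.cong refl card_edges_singleton) auto
    finally have N1: "card N \<le> (\<Sum>t\<in>T. card (t \<inter> g) choose 2)" .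
    have "edges {g} - edges {g \<inter> \<Union>K} \<subseteq> N" by (auto simp: N_def edges_def)
    then have "card (edges {g} - edges {g \<inter> \<Union>K}) \<le> card N" by (rule card_mono[OF finN])
    moreover have "card (edges {g} - edges {g \<inter> \<Union>K}) = (d choose 2) - (?s choose 2)"
    proof -
      have "edges {g \<inter> \<Union>K} \<subseteq> edges {g}" by (auto simp: edges_def)
      moreover have "finite (edges {g \<inter> \<Union>K})" by (rule finite_edges) (use fg in auto)
      ultimately show ?thesis using fg g(1) by (simp add: card_Diff_subset card_edges_singleton)
    qed
    ultimately have N2: "real (d choose 2) - real (?s choose 2) \<le> real (card N)" by linarith
    let ?\<rho> = "\<theta> / real (d choose 2)"
    have \<rho>: "2 / (real d + 1) \<le> ?\<rho>" using overlap_cost(2)[OF d \<theta>(1), of 2] d by simp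
    have dpos: "real d + 1 > 0" by simp
    \<comment> \<open>With s the overlap of \<open>g\<close> and \<Union>K, the d - s new vertices
      of \<open>g\<close> cost at most 2 / (d + 1) per missing pair, because s >= 2. Each missing
      pair lies in some \<open>t \<inter> g\<close>, so the covers pay for it by
      \<open>overlap_cost\<close>.\<close>
    have base: "real d - real ?s \<le> 2 / (real d + 1) * (real (d choose 2) - real (?s choose 2))"
    proof -
      have "(real d - real ?s) * (real ?s - 2) \<ge> 0" using sd g(3) by simp
      then have "(real d - real ?s) * (real d + 1) \<le> real d * (real d - 1) - real ?s * (real ?s - 1)"
        by (simp add: algebra_simps)
      then show ?thesis using dpos by (simp add: real_choose_two field_simps)
    qed
    also have "\<dots> \<le> ?\<rho> * (real (d choose 2) - real (?s choose 2))"
      by (rule mult_right_mono[OF \<rho>]) (use sd in \<open>auto intro!: binomial_right_mono\<close>)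
    also have "\<dots> \<le> ?\<rho> * (\<Sum>t\<in>T. real (card (t \<inter> g) choose 2))"
    proof (rule mult_left_mono)
      show "real (d choose 2) - real (?s choose 2) \<le> (\<Sum>t\<in>T. real (card (t \<inter> g) choose 2))"
        using N1 N2 by (simp flip: of_nat_sum)
      show "0 \<le> ?\<rho>" using \<rho> dpos by (smt (verit) divide_nonneg_nonneg)
    qed
    also have "\<dots> = (\<Sum>t\<in>T. ?\<rho> * real (card (t \<inter> g) choose 2))" by (simp add: sum_distrib_left)
    also have "\<dots> \<le> (\<Sum>t\<in>T. real (card (t \<inter> g)) - real d + \<theta>)"
      by (intro sum_mono overlap_cost(1)[OF d \<theta>(1)] tk)
    finally have cost: "real d - real ?s \<le> (\<Sum>t\<in>T. real (card (t \<inter> g)) - real d + \<theta>)" .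
    \<comment> \<open>With \<open>g\<close> counted in full, each cover t adds at most d - |t
      \<inter> g| further vertices, whatever else it meets.\<close>
    have "card (\<Union>(K \<union> T)) \<le> card ((\<Union>K \<union> g) \<union> \<Union>T)"
      by (rule card_mono) (use finU fg finT fT in auto)
    also have "\<dots> \<le> card (\<Union>K \<union> g) + (\<Sum>t\<in>T. card (t - (\<Union>K \<union> g)))"
      by (rule card_Un_Union_le) (use finU fg finT fT in auto)
    also have "\<dots> \<le> (card (\<Union>K) + (d - ?s)) + (\<Sum>t\<in>T. d - card (t \<inter> g))"
    proof (intro add_mono sum_mono)
      have "\<Union>K \<union> g = \<Union>K \<union> (g - \<Union>K)" by auto
      then have "card (\<Union>K \<union> g) \<le> card (\<Union>K) + card (g - \<Union>K)" by (metis card_Un_le)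
      then show "card (\<Union>K \<union> g) \<le> card (\<Union>K) + (d - ?s)" using g(1) fg by (simp add: card_Diff_subset_Int)
      fix t assume t: "t \<in> T"
      have "card (t - (\<Union>K \<union> g)) \<le> card (t - g)" by (rule card_mono) (use fT t in auto)
      then show "card (t - (\<Union>K \<union> g)) \<le> d - card (t \<inter> g)" using fT[OF t] by (simp add: card_Diff_subset_Int)
    qed
    finally have "real (card (\<Union>(K \<union> T))) \<le> real ((card (\<Union>K) + (d - ?s)) + (\<Sum>t\<in>T. d - card (t \<inter> g)))"
      unfolding of_nat_le_iff by (simp add: Un_assoc)
    also have "\<dots> = real (card (\<Union>K)) + (real d - real ?s) + (\<Sum>t\<in>T. real d - real (card (t \<inter> g)))"
      using sd tk by (simp add: of_nat_diff)
    also have "\<dots> \<le> real (card (\<Union>K)) + (\<Sum>t\<in>T. real (card (t \<inter> g)) - real d + \<theta>) + (\<Sum>t\<in>T. real d - real (card (t \<inter> g)))"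
      using cost by simp
    also have "\<dots> = real (card (\<Union>K)) + \<theta> * real (card T)"
      by (simp add: sum.distrib[symmetric] add.assoc)
    finally have "T = {}" using TK cardT by (intro ext) (auto simp: algebra_simps)
    then show ?thesis by (auto simp: T_def N_def)
  qed
  show ?thesis by (rule that[of K]) (use K c1 c2 in \<open>auto simp: C_def\<close>)
qed

section \<open>Discharging\<close>

text \<open>
  Discharging. An edge covered by exactly one of \<open>R\<close> and \<open>F\<close> is worth \<open>\<omega>\<close> if it has an endpoint of degree
  one and \<open>\<rho>\<close> otherwise; its endpoints get half each. A vertex also gets \<open>\<gamma>\<close> for each of its sets. A
  vertex of degree one lacks \<open>\<kappa>\<close>, which it collects in equal parts from the vertices of higher degree in its set.
  The last assumptions say that then every vertex ends up with at least 1.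
\<close>

locale discharge_weights =
  fixes d :: nat and \<theta> \<kappa> \<omega> \<rho> \<gamma> :: real
  assumes \<omega>: "\<omega> = \<theta> - real d + 2" and \<rho>: "\<rho> = \<theta> / real (d choose 2)" and \<gamma>: "\<gamma> = \<theta> / (2 * real d)"
    and d3: "3 \<le> d"
    and \<theta>_lower: "real d * (real d - 1) / (real d + 1) \<le> \<theta>"
    and \<theta>_upper: "\<theta> \<le> real d" "real d \<le> 2 * \<theta>"
    and \<kappa>: "0 \<le> \<kappa>" "\<kappa> \<le> \<omega>"
    and partial_overlap: "\<And>t. 2 \<le> t \<Longrightarrow> t < d \<Longrightarrow> \<omega> * real (t choose 2) \<le> real t - real d + \<theta>"
    and full_overlap: "\<omega> * (real (d choose 2) - 1) \<le> \<theta>"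
    and degree_one: "1 \<le> \<gamma> + (real d - 1) * \<omega> / 2 + \<kappa>"
    and degree_two: "1 \<le> 2 * \<gamma> + \<rho>" "1 \<le> 2 * \<gamma> + \<omega> - 2 * (\<kappa> / (real d - 1))"
    and degree_two': "1 \<le> 2 * \<gamma> + 3 * \<rho> / 2" "1 \<le> 2 * \<gamma> + 3 * (\<omega> - \<kappa>) / 2"
    and degree_three: "1 \<le> 3 * \<gamma> + \<rho> / 2" "1 \<le> 3 * \<gamma> + (\<omega> - \<kappa>) / 2"
    and degree_four: "1 \<le> 4 * \<gamma>"
begin

lemma \<rho>_pos: "0 < \<rho>"
proof -
  have "0 < 2 / (real d + 1)" by simp
  also have "\<dots> \<le> \<rho>" unfolding \<rho> by (rule overlap_cost(2)[OF d3 \<theta>_lower, of 2]) (use d3 in auto)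
  finally show ?thesis .
qed

lemma \<rho>_overlap: "2 \<le> t \<Longrightarrow> t \<le> d \<Longrightarrow> \<rho> * real (t choose 2) \<le> real t - real d + \<theta>"
  unfolding \<rho> by (rule overlap_cost(1)[OF d3 \<theta>_lower])

lemma \<rho>_le_\<omega>: "\<rho> \<le> \<omega>"
  using \<rho>_overlap[of 2] d3 by (simp add: \<omega>)

lemma \<gamma>_pos: "0 < \<gamma>"
  using degree_four by simp

end

lemma Un_eq_doubleton:
  assumes "A \<union> B = {a, b}" "A \<inter> B = {}" "a \<noteq> b"
  shows "A = {a, b} \<and> B = {} \<or> B = {a, b} \<and> A = {} \<or> A = {a} \<and> B = {b} \<or> A = {b} \<and> B = {a}"
proof -
  have "A \<in> Pow {a, b}" using assms(1) by blast
  then have "A = {} \<or> A = {a} \<or> A = {b} \<or> A = {a, b}" by (auto simp: Pow_insert)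
  moreover have "B = {a, b} - A" using assms(1,2) by blast
  ultimately show ?thesis using assms(3) by (auto simp: insert_Diff_if)
qed

text \<open>\<open>R\<close> is exchanged for \<open>F\<close>, and \<open>Q\<close> are the common hyperedges that make up for the difference.\<close>

locale exchange = discharge_weights +
  fixes R F Q :: "'a set set"
  assumes fin: "finite R" "finite F" "finite Q"
    and unif: "\<And>h. h \<in> R \<Longrightarrow> card h = d" "\<And>h. h \<in> F \<Longrightarrow> card h = d" "\<And>h. h \<in> Q \<Longrightarrow> card h = d"
    and disj: "R \<inter> F = {}" "Q \<inter> (R \<union> F) = {}"
    and covered: "\<And>e. e \<in> sym_diff (edges R) (edges F) \<Longrightarrow> \<exists>q\<in>Q. e \<subseteq> q"
    and covering: "\<And>q. q \<in> Q \<Longrightarrow> \<exists>e\<in>sym_diff (edges R) (edges F). e \<subseteq> q"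
    and smaller: "card F \<le> card R"
    and shared: "\<And>h. h \<in> R \<union> F \<Longrightarrow> \<exists>h'\<in>R \<union> F. h' \<noteq> h \<and> 2 \<le> card (h \<inter> h')"
begin

definition sets_at :: "'a \<Rightarrow> 'a set set" where "sets_at u = {h \<in> R \<union> F. u \<in> h}"
definition pend :: "'a \<Rightarrow> bool" where "pend u \<longleftrightarrow> card (sets_at u) = 1"
definition D :: "'a set set" where "D = sym_diff (edges R) (edges F)"
definition U :: "'a set" where "U = \<Union>(R \<union> F)"
definition worth :: "'a set \<Rightarrow> real" where "worth e = (if \<exists>x\<in>e. pend x then \<omega> else \<rho>)"
definition donors :: "'a \<Rightarrow> 'a set" where "donors x = {v \<in> U. \<not> pend v \<and> (\<exists>h\<in>R \<union> F. x \<in> h \<and> v \<in> h)}"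
definition nb :: "'a \<Rightarrow> 'a set" where "nb u = {v. {u, v} \<in> D}"
text \<open>Antisymmetric in u and v, so that moving charge keeps the total. It is summed over v in
  \<open>nb u\<close>; for u of degree one these are all other vertices of its set, so every donor
  is reached.\<close>

definition transfer :: "'a \<Rightarrow> 'a \<Rightarrow> real" where
  "transfer u v = (if pend u \<and> \<not> pend v then \<kappa> / real (card (donors u)) else 0)
    - (if pend v \<and> \<not> pend u then \<kappa> / real (card (donors v)) else 0)"
definition share :: "'a \<Rightarrow> 'a \<Rightarrow> real" where "share u v = worth {u, v} / 2 + transfer u v"

lemma finite_sets: "h \<in> R \<union> F \<union> Q \<Longrightarrow> finite h"
  using unif d3 by (intro card_ge_0_finite) auto

lemma card_sets: "h \<in> R \<union> F \<union> Q \<Longrightarrow> card h = d"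
  using unif by auto

lemma finite_U: "finite U"
  unfolding U_def using fin finite_sets by auto

lemma finite_sets_at: "finite (sets_at u)"
  unfolding sets_at_def using fin by simp

lemma finite_D: "finite D"
proof -
  have "finite (edges R)" "finite (edges F)" using fin finite_sets by (auto intro!: finite_edges)
  then show ?thesis by (auto simp: D_def)
qed

lemma D_subset: "e \<in> D \<Longrightarrow> e \<subseteq> U \<and> card e = 2"
  by (auto simp: D_def edges_def U_def)

lemma nb_subset: "nb u \<subseteq> U" "u \<notin> nb u" "v \<in> nb u \<longleftrightarrow> u \<in> nb v"
proof -
  have "{u} \<notin> D" using D_subset[of "{u}"] by force
  then show "u \<notin> nb u" by (simp add: nb_def)
  show "nb u \<subseteq> U" "v \<in> nb u \<longleftrightarrow> u \<in> nb v" using D_subset by (auto simp: nb_def insert_commute)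
qed

lemma finite_nb: "finite (nb u)"
  using nb_subset finite_U finite_subset by blast

lemma nb_common: "v \<in> nb u \<Longrightarrow> \<exists>h\<in>sets_at u. v \<in> h"
  by (auto simp: nb_def D_def edges_def sets_at_def)

definition star :: "'a set set \<Rightarrow> 'a \<Rightarrow> 'a set" where "star A u = \<Union>{h \<in> A. u \<in> h} - {u}"

lemma nb_eq: "nb u = sym_diff (star R u) (star F u)"
proof -
  have "{u, v} \<in> edges A \<longleftrightarrow> v \<in> star A u" for v A
    by (auto simp: edges_def star_def card_2_iff doubleton_eq_iff)
  then show ?thesis by (auto simp: nb_def D_def)
qed

lemma worth_pos: "0 < worth e"
  using \<rho>_pos \<rho>_le_\<omega> by (auto simp: worth_def)

text \<open>Each edge of \<open>D\<close> is seen from both endpoints, which take half of its worth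
  each. Adding the sum to its image under swapping u and v cancels the transfers.\<close>

lemma sum_share: "(\<Sum>u\<in>U. \<Sum>v\<in>nb u. share u v) = (\<Sum>e\<in>D. worth e)"
proof -
  define P where "P = (SIGMA u:U. nb u)"
  have finP: "finite P" unfolding P_def using finite_U finite_nb by (auto intro!: finite_SigmaI)
  have swap: "(\<Sum>(u, v)\<in>P. share u v) = (\<Sum>(u, v)\<in>P. share v u)"
    by (rule sum.reindex_bij_witness[of _ "\<lambda>(u, v). (v, u)" "\<lambda>(u, v). (v, u)"])
      (use nb_subset in \<open>auto simp: P_def\<close>)
  have fib: "{p \<in> P. (case p of (u, v) \<Rightarrow> {u, v}) = e} = {(a, b), (b, a)}" if "e = {a, b}" "e \<in> D" for a b e
  proof -
    have "a \<in> U" "b \<in> U" "{b, a} \<in> D" using that D_subset[of e] by (auto simp: insert_commute)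
    then have "{(a, b), (b, a)} \<subseteq> {p \<in> P. (case p of (u, v) \<Rightarrow> {u, v}) = e}"
      using that by (simp add: P_def nb_def insert_commute)
    moreover have "{p \<in> P. (case p of (u, v) \<Rightarrow> {u, v}) = e} \<subseteq> {(a, b), (b, a)}"
    proof
      fix p assume p: "p \<in> {p \<in> P. (case p of (u, v) \<Rightarrow> {u, v}) = e}"
      obtain u v where uv: "p = (u, v)" by (cases p) auto
      then have "{u, v} = {a, b}" using p that(1) by simp
      then show "p \<in> {(a, b), (b, a)}" unfolding uv doubleton_eq_iff by blast
    qed
    ultimately show ?thesis by (rule antisym[rotated])
  qed
  have "2 * (\<Sum>(u, v)\<in>P. share u v) = (\<Sum>(u, v)\<in>P. share u v + share v u)"
    using swap by (simp add: case_prod_beta sum.distrib)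
  also have "\<dots> = (\<Sum>p\<in>P. worth (case p of (u, v) \<Rightarrow> {u, v}))"
    by (intro sum.cong refl) (auto simp: share_def transfer_def insert_commute)
  also have "\<dots> = (\<Sum>e\<in>D. \<Sum>p\<in>{p \<in> P. (case p of (u, v) \<Rightarrow> {u, v}) = e}. worth (case p of (u, v) \<Rightarrow> {u, v}))"
    by (rule sum.group[symmetric]) (use finP finite_D in \<open>auto simp: P_def nb_def\<close>)
  also have "\<dots> = (\<Sum>e\<in>D. 2 * worth e)"
  proof (intro sum.cong refl)
    fix e assume e: "e \<in> D"
    then obtain a b where ab: "e = {a, b}" "a \<noteq> b" using D_subset by (metis card_2_iff)
    show "(\<Sum>p\<in>{p \<in> P. (case p of (u, v) \<Rightarrow> {u, v}) = e}. worth (case p of (u, v) \<Rightarrow> {u, v})) = 2 * worth e"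
      unfolding fib[OF ab(1) e] using ab by (simp add: insert_commute)
  qed
  also have "\<dots> = 2 * (\<Sum>e\<in>D. worth e)" by (simp add: sum_distrib_left)
  finally show ?thesis using finite_U finite_nb by (simp add: P_def sum.Sigma)
qed

lemma pend_unique: "pend x \<Longrightarrow> h \<in> sets_at x \<Longrightarrow> h' \<in> sets_at x \<Longrightarrow> h = h'"
  by (auto simp: pend_def card_1_singleton_iff)

text \<open>With a single set at x one of the two stars is empty, so nothing cancels in
  \<open>nb_eq\<close>.\<close>

lemma pend_nb:
  assumes "pend x" "h \<in> sets_at x"
  shows "nb x = h - {x}"
proof -
  have eq: "sets_at x = {h}" using assms pend_unique by blast
  then have "{h' \<in> R. x \<in> h'} \<union> {h' \<in> F. x \<in> h'} = {h}" by (auto simp: sets_at_def)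
  moreover have "{h' \<in> R. x \<in> h'} \<inter> {h' \<in> F. x \<in> h'} = {}" using disj by auto
  ultimately have "{h' \<in> R. x \<in> h'} = {h} \<and> {h' \<in> F. x \<in> h'} = {} \<or> {h' \<in> F. x \<in> h'} = {h} \<and> {h' \<in> R. x \<in> h'} = {}"
    by (auto simp: Un_singleton_iff)
  then show ?thesis by (auto simp: nb_eq star_def)
qed

text \<open>The right-hand side is the potential drop caused by q. If no edge of \<open>D\<close> in
  q meets a vertex of degree one, the rate is \<rho> and \<open>\<rho>_overlap\<close> applies.
  Otherwise the rate is at most \<omega>, affordable for a partial overlap; for a full one at least
  one pair of q has to be missing from \<open>D\<close>.\<close>

lemma overlap_worth:
  assumes q: "q \<in> Q"
  shows "(\<Sum>e\<in>{e \<in> D. e \<subseteq> q}. worth e) \<le> real (card (q \<inter> U)) - real d + \<theta>"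
proof -
  let ?E = "{e \<in> D. e \<subseteq> q}" and ?t = "card (q \<inter> U)"
  have fq: "finite q" and cq: "card q = d" using finite_sets unif q by auto
  obtain e0 where e0: "e0 \<in> ?E" using covering[OF q] by (auto simp: D_def)
  have "card e0 \<le> ?t" using e0 D_subset fq by (intro card_mono) auto
  then have t2: "2 \<le> ?t" using e0 D_subset by auto
  have td: "?t \<le> d" using cq fq by (metis card_mono inf_le1)
  have finE: "finite (edges {q \<inter> U})" using fq by (intro finite_edges) auto
  have sub: "?E \<subseteq> edges {q \<inter> U}" using D_subset by (auto simp: edges_def)
  have cE: "card (edges {q \<inter> U}) = ?t choose 2" using fq by (intro card_edges_singleton) auto
  show ?thesis
  proof (cases "\<exists>e\<in>?E. \<exists>x\<in>e. pend x")
    case False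
    then have "(\<Sum>e\<in>?E. worth e) = (\<Sum>e\<in>?E. \<rho>)" by (intro sum.cong) (auto simp: worth_def)
    also have "\<dots> \<le> \<rho> * real (?t choose 2)"
      using card_mono[OF finE sub] cE \<rho>_pos by (simp add: mult.commute)
    also have "\<dots> \<le> real ?t - real d + \<theta>" by (rule \<rho>_overlap[OF t2 td])
    finally show ?thesis .
  next
    case True
    then obtain e x where ex: "e \<in> ?E" "x \<in> e" "pend x" by auto
    have "(\<Sum>e\<in>?E. worth e) \<le> (\<Sum>e\<in>?E. \<omega>)" using \<rho>_le_\<omega> by (intro sum_mono) (auto simp: worth_def)
    also have "\<dots> = \<omega> * real (card ?E)" by simp
    also have "\<dots> \<le> real ?t - real d + \<theta>"
    proof (cases "?t = d")
      case False
      have "\<omega> * real (card ?E) \<le> \<omega> * real (?t choose 2)"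
        using card_mono[OF finE sub] cE \<rho>_pos \<rho>_le_\<omega> by (intro mult_left_mono) auto
      also have "\<dots> \<le> real ?t - real d + \<theta>" using partial_overlap[OF t2] td False by simp
      finally show ?thesis .
    next
      case True
      \<comment> \<open>If every pair of q were in \<open>D\<close>, then the pairs at x, which has
        degree one, would all lie in its only set h. So q = h, although q is not exchanged.\<close>
      have "?E \<noteq> edges {q \<inter> U}"
      proof
        assume eq: "?E = edges {q \<inter> U}"
        have "q \<inter> U = q" using True cq fq by (simp add: card_subset_eq)
        then have qU: "q \<subseteq> U" by auto
        have xq: "x \<in> q" using ex by auto
        obtain h where h: "h \<in> sets_at x" using xq qU by (auto simp: sets_at_def U_def)
        have "q \<subseteq> h"
        proof
          fix y assume y: "y \<in> q"
          show "y \<in> h"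
          proof (cases "y = x")
            case True then show ?thesis using h by (auto simp: sets_at_def)
          next
            case False
            then have "{x, y} \<in> edges {q \<inter> U}" using y xq qU by (auto simp: edges_def)
            then have "y \<in> nb x" using eq by (auto simp: nb_def)
            then show ?thesis using pend_nb[OF ex(3) h] by auto
          qed
        qed
        moreover have "card h = d" "finite h" using h card_sets finite_sets by (auto simp: sets_at_def)
        ultimately have "q = h" using cq by (metis card_subset_eq)
        then show False using h q disj by (auto simp: sets_at_def)
      qed
      then have "card ?E < card (edges {q \<inter> U})" using sub finE by (simp add: psubset_card_mono psubsetI)
      then have "real (card ?E) \<le> real (d choose 2) - 1" using cE True by simp
      then have "\<omega> * real (card ?E) \<le> \<omega> * (real (d choose 2) - 1)"
        using \<rho>_pos \<rho>_le_\<omega> by (intro mult_left_mono) auto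
      also have "\<dots> \<le> \<theta>" by (rule full_overlap)
      finally show ?thesis using True by simp
    qed
    finally show ?thesis .
  qed
qed

text \<open>Every edge of \<open>D\<close> lies in some q and worths are positive, so counting an
  edge once per covering q only increases the sum.\<close>

lemma sum_worth_le: "(\<Sum>e\<in>D. worth e) \<le> (\<Sum>q\<in>Q. real (card (q \<inter> U)) - real d + \<theta>)"
proof -
  have "(\<Sum>e\<in>D. worth e) \<le> (\<Sum>e\<in>D. \<Sum>q\<in>{q \<in> Q. e \<subseteq> q}. worth e)"
  proof (rule sum_mono)
    fix e assume "e \<in> D"
    then obtain q where "q \<in> Q" "e \<subseteq> q" using covered by (auto simp: D_def)
    then have "{q \<in> Q. e \<subseteq> q} \<noteq> {}" by auto
    then have "1 \<le> card {q \<in> Q. e \<subseteq> q}" using fin by (simp add: Suc_le_eq card_gt_0_iff)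
    then have "1 * worth e \<le> real (card {q \<in> Q. e \<subseteq> q}) * worth e"
      using worth_pos[of e] by (intro mult_right_mono) auto
    then show "worth e \<le> (\<Sum>q\<in>{q \<in> Q. e \<subseteq> q}. worth e)" by simp
  qed
  also have "\<dots> = (\<Sum>q\<in>Q. \<Sum>e\<in>{e \<in> D. e \<subseteq> q}. worth e)"
    by (rule sum.swap_restrict[OF finite_D fin(3)])
  also have "\<dots> \<le> (\<Sum>q\<in>Q. real (card (q \<inter> U)) - real d + \<theta>)" by (intro sum_mono overlap_worth)
  finally show ?thesis .
qed

section \<open>Donors and the final charge of a vertex\<close>

lemma shared_not_pend:
  assumes "h \<in> R \<union> F" "h' \<in> R \<union> F" "h \<noteq> h'" "v \<in> h \<inter> h'"
  shows "\<not> pend v"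
  using assms pend_unique[of v h h'] by (auto simp: sets_at_def)

lemma donors_eq:
  assumes "pend x" "h \<in> sets_at x"
  shows "donors x = {v \<in> h. \<not> pend v}"
proof -
  have eq: "sets_at x = {h}" using assms pend_unique by blast
  have "donors x = {v \<in> U. \<not> pend v \<and> (\<exists>h'\<in>sets_at x. v \<in> h')}" by (auto simp: donors_def sets_at_def)
  also have "\<dots> = {v \<in> h. \<not> pend v}" unfolding eq using assms(2) by (auto simp: U_def sets_at_def)
  finally show ?thesis .
qed

lemma card_donors_ge:
  assumes "pend x" "h \<in> sets_at x" "h' \<in> R \<union> F" "h \<noteq> h'"
  shows "card (h \<inter> h') \<le> card (donors x)"
proof (rule card_mono)
  have h: "h \<in> R \<union> F" using assms by (auto simp: sets_at_def)
  show "finite (donors x)" unfolding donors_eq[OF assms(1,2)] using finite_sets h by auto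
  show "h \<inter> h' \<subseteq> donors x" unfolding donors_eq[OF assms(1,2)] using shared_not_pend[OF h assms(3,4)] by auto
qed

text \<open>Vertices common to two sets have degree at least two, so the pair provided by
  \<open>shared\<close> can donate. Hence no donor ever gives more than \<kappa> / 2 to one
  vertex.\<close>

lemma card_donors_ge_2:
  assumes "pend x" "h \<in> sets_at x"
  shows "2 \<le> card (donors x)"
proof -
  have "h \<in> R \<union> F" using assms by (auto simp: sets_at_def)
  then obtain h' where "h' \<in> R \<union> F" "h' \<noteq> h" "2 \<le> card (h \<inter> h')" using shared by blast
  then show ?thesis using card_donors_ge[OF assms, of h'] by auto
qed

text \<open>A neighbour of degree one makes the edge worth \<omega> but draws on u; any other
  neighbour leaves u with \<rho> / 2. The minimum allows for either.\<close>

lemma share_lower: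
  assumes "\<not> pend u" "v \<in> nb u" "2 \<le> m" "pend v \<Longrightarrow> m \<le> card (donors v)"
  shows "min (\<rho> / 2) (\<omega> / 2 - \<kappa> / real m) \<le> share u v"
proof (cases "pend v")
  case True
  then have "\<kappa> / real (card (donors v)) \<le> \<kappa> / real m"
    using assms \<kappa> by (intro divide_left_mono) auto
  then show ?thesis using True assms by (auto simp: share_def transfer_def worth_def min_def)
next
  case False
  then have "share u v = \<rho> / 2" using assms by (auto simp: share_def transfer_def worth_def)
  then show ?thesis by simp
qed

lemma share_pend:
  assumes "pend u" "v \<in> nb u"
  shows "share u v = \<omega> / 2 + (if pend v then 0 else \<kappa> / real (card (donors u)))"
  using assms by (auto simp: share_def transfer_def worth_def)

text \<open>A vertex of degree one keeps all d - 1 pairs and collects \<kappa>. For degrees two,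
  three and four the part paid by \<gamma> grows while the guaranteed number of neighbours falls to
  two, one and none, because the stars of R and F can cancel. From degree four on \<gamma> suffices
  and the shares only have to be nonnegative.\<close>

lemma vertex_charge:
  assumes u: "u \<in> U"
  shows "1 \<le> \<gamma> * real (card (sets_at u)) + (\<Sum>v\<in>nb u. share u v)"
proof -
  have ne: "sets_at u \<noteq> {}" using u by (auto simp: sets_at_def U_def)
  then have "card (sets_at u) \<noteq> 0" using finite_sets_at by simp
  then consider "card (sets_at u) = 1" | "card (sets_at u) = 2" | "card (sets_at u) = 3" | "4 \<le> card (sets_at u)"
    by linarith
  then show ?thesis
  proof cases
    case 1
    then have p: "pend u" by (simp add: pend_def)
    obtain h where h: "h \<in> sets_at u" using ne by auto
    have hRF: "h \<in> R \<union> F" "u \<in> h" using h by (auto simp: sets_at_def)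
    have fh: "finite h" "card h = d" using hRF finite_sets card_sets by auto
    have nbu: "nb u = h - {u}" by (rule pend_nb[OF p h])
    have cn: "card (nb u) = d - 1" using nbu fh hRF by simp
    have dn: "{v \<in> nb u. \<not> pend v} = donors u" using donors_eq[OF p h] nbu p by auto
    have j: "card (donors u) > 0" using card_donors_ge_2[OF p h] by simp
    have "(\<Sum>v\<in>nb u. share u v) = (\<Sum>v\<in>nb u. \<omega> / 2) + (\<Sum>v\<in>nb u. if pend v then 0 else \<kappa> / real (card (donors u)))"
      unfolding sum.distrib[symmetric] by (intro sum.cong refl share_pend[OF p])
    also have "(\<Sum>v\<in>nb u. if pend v then 0 else \<kappa> / real (card (donors u))) = (\<Sum>v\<in>donors u. \<kappa> / real (card (donors u)))"
      unfolding dn[symmetric] using finite_nb by (subst sum.inter_filter) (auto intro!: sum.cong)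
    also have "\<dots> = \<kappa>" using j by simp
    finally show ?thesis using degree_one 1 cn d3 by (simp add: of_nat_diff)
  next
    case 2
    then have np: "\<not> pend u" by (simp add: pend_def)
    obtain h1 h2 where h12: "sets_at u = {h1, h2}" "h1 \<noteq> h2" using 2 by (auto simp: card_2_iff)
    have h: "h1 \<in> R \<union> F" "h2 \<in> R \<union> F" "u \<in> h1" "u \<in> h2" using h12 by (auto simp: sets_at_def)
    have f: "finite h1" "card h1 = d" "finite h2" "card h2 = d" using h finite_sets card_sets by auto
    have ge2: "\<exists>h\<in>sets_at v. True" if "v \<in> nb u" for v using that nb_common nb_subset(3) by blast
    have dv: "2 \<le> card (donors v)" if "pend v" "v \<in> nb u" for v using card_donors_ge_2 ge2 that by blast
    have eq2: "{h \<in> R. u \<in> h} \<union> {h \<in> F. u \<in> h} = {h1, h2}" using h12(1) by (auto simp: sets_at_def)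
    have inter_u: "u \<in> h1 \<inter> h2" using h by auto
    have i1: "card (h1 - h2) = d - card (h1 \<inter> h2)" "card (h2 - h1) = d - card (h1 \<inter> h2)"
      using f by (simp_all add: card_Diff_subset_Int Int_commute)
    have "card (h1 \<inter> h2) \<noteq> d"
      using f h12(2) by (metis card_subset_eq inf_le1 inf_le2)
    then have il: "card (h1 \<inter> h2) < d" using f by (metis card_mono inf_le1 le_neq_implies_less)
    \<comment> \<open>Two sets on the same side of the exchange join their stars; on opposite sides
      they cancel on the intersection.\<close>
    consider "nb u = (h1 \<union> h2) - {u}" | "nb u = (h1 - h2) \<union> (h2 - h1)"
    proof -
      have "{h \<in> R. u \<in> h} = {h1, h2} \<and> {h \<in> F. u \<in> h} = {} \<or> {h \<in> F. u \<in> h} = {h1, h2} \<and> {h \<in> R. u \<in> h} = {}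
        \<or> {h \<in> R. u \<in> h} = {h1} \<and> {h \<in> F. u \<in> h} = {h2} \<or> {h \<in> R. u \<in> h} = {h2} \<and> {h \<in> F. u \<in> h} = {h1}"
        by (rule Un_eq_doubleton[OF eq2 _ h12(2)]) (use disj in auto)
      then show thesis using that inter_u by (elim disjE) (auto simp: nb_eq star_def)
    qed
    \<comment> \<open>Fewer than three neighbours occur only for sets on opposite sides that differ
      in one vertex each. Their d - 1 common vertices all donate, so a neighbour of degree one draws
      at most \<kappa> / (d - 1) from u.\<close>
    then consider "3 \<le> card (nb u)" | "card (nb u) = 2" "card (h1 \<inter> h2) = d - 1"
    proof cases
      case 1
      have "card (h1 \<union> h2) = card h1 + card (h2 - h1)"
        using f by (metis Diff_disjoint Un_Diff_cancel card_Un_disjoint finite_Diff)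
      then have "card (nb u) = (d + card (h2 - h1)) - 1" using 1 h f by simp
      then show ?thesis using that d3 i1 il by auto
    next
      case 2
      have "card (nb u) = card (h1 - h2) + card (h2 - h1)"
        unfolding 2 using f by (intro card_Un_disjoint) auto
      then have "card (nb u) = 2 * (d - card (h1 \<inter> h2))" using i1 by simp
      then show ?thesis using that il by (cases "card (h1 \<inter> h2) = d - 1") auto
    qed
    then show ?thesis
    proof cases
      case 1
      let ?b = "min (\<rho> / 2) (\<omega> / 2 - \<kappa> / 2)"
      have "3 * ?b \<le> real (card (nb u)) * ?b"
        using 1 \<rho>_pos \<kappa> by (intro mult_right_mono) auto
      also have "\<dots> = (\<Sum>v\<in>nb u. ?b)" by simp
      also have "\<dots> \<le> (\<Sum>v\<in>nb u. share u v)"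
        using share_lower[OF np, of _ 2] dv by (intro sum_mono) auto
      finally show ?thesis using degree_two' 2 by (auto simp: min_def field_simps split: if_splits)
    next
      case c: 2
      let ?b = "min (\<rho> / 2) (\<omega> / 2 - \<kappa> / real (d - 1))"
      have dd: "d - 1 \<le> card (donors v)" if v: "v \<in> nb u" "pend v" for v
      proof -
        obtain h where hh: "h \<in> sets_at u" "v \<in> h" using nb_common[OF v(1)] by auto
        then have hv: "h \<in> sets_at v" by (auto simp: sets_at_def)
        have "h = h1 \<or> h = h2" using hh h12 by auto
        then show ?thesis using card_donors_ge[OF v(2) hv] h h12(2) c(2) by (metis Int_commute)
      qed
      have "2 * ?b = (\<Sum>v\<in>nb u. ?b)" using c by simp
      also have "\<dots> \<le> (\<Sum>v\<in>nb u. share u v)"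
        using share_lower[OF np, of _ "d - 1"] dd d3 by (intro sum_mono) auto
      finally have "2 * min (\<rho> / 2) (\<omega> / 2 - \<kappa> / (real d - 1)) \<le> (\<Sum>v\<in>nb u. share u v)"
        using d3 by (simp add: of_nat_diff)
      moreover have "2 * min x y = min (2 * x) (2 * y)" for x y :: real by (simp add: min_def)
      ultimately have "min \<rho> (\<omega> - 2 * (\<kappa> / (real d - 1))) \<le> (\<Sum>v\<in>nb u. share u v)"
        by (simp add: right_diff_distrib)
      then show ?thesis using degree_two by (simp add: 2 min_def split: if_splits)
    qed
  next
    case 3
    then have np: "\<not> pend u" by (simp add: pend_def)
    have dv: "2 \<le> card (donors v)" if "pend v" "v \<in> nb u" for v 
      using that card_donors_ge_2 nb_common nb_subset(3) by blast
    \<comment> \<open>Three sets are split unevenly between R and F. Two distinct ones through u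
      reach at least d other vertices, a single one only d - 1, so the stars differ.\<close>
    have "nb u \<noteq> {}"
    proof
      assume "nb u = {}"
      then have eq: "star R u = star F u" by (auto simp: nb_eq)
      let ?A = "{h \<in> R. u \<in> h}" and ?B = "{h \<in> F. u \<in> h}"
      have big: "d \<le> card (star A u)" if A: "A = R \<or> A = F" and two: "2 \<le> card {h \<in> A. u \<in> h}" for A
      proof -
        obtain h1 h2 where h: "h1 \<in> {h \<in> A. u \<in> h}" "h2 \<in> {h \<in> A. u \<in> h}" "h1 \<noteq> h2"
        proof -
          obtain T where "T \<subseteq> {h \<in> A. u \<in> h}" "card T = 2" using obtain_subset_with_card_n[OF two] by blast
          then show thesis using that by (auto simp: card_2_iff)
        qed
        have hh: "h1 \<in> R \<union> F" "h2 \<in> R \<union> F" "u \<in> h1" "u \<in> h2" using A h by auto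
        have f: "finite h1" "card h1 = d" "finite h2" "card h2 = d" using hh finite_sets card_sets by auto
        have "h1 \<subset> h1 \<union> h2" using f h(3) by (metis Un_upper1 Un_upper2 card_subset_eq psubsetI)
        then have "d < card (h1 \<union> h2)" using f by (metis finite_UnI psubset_card_mono)
        moreover have "card (h1 \<union> h2 - {u}) \<le> card (star A u)"
        proof (rule card_mono)
          have "\<Union>A \<subseteq> U" using A by (auto simp: U_def)
          then show "finite (star A u)" using finite_U by (auto simp: star_def intro: finite_subset)
          show "h1 \<union> h2 - {u} \<subseteq> star A u" using h by (auto simp: star_def)
        qed
        ultimately show ?thesis using hh by simp
      qed
      have small: "card (star A u) \<le> d - 1" if A: "A = R \<or> A = F" and one: "card {h \<in> A. u \<in> h} \<le> 1" for A
      proof -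
        have fA: "finite {h \<in> A. u \<in> h}" using A fin by auto
        show ?thesis
        proof (cases "{h \<in> A. u \<in> h} = {}")
          case True
          then have "star A u = {}" by (auto simp: star_def)
          then show ?thesis by simp
        next
          case False
          then have "card {h \<in> A. u \<in> h} = 1" using one fA by (simp add: le_less_Suc_eq Suc_le_eq card_gt_0_iff le_antisym)
          then obtain h where h: "{h \<in> A. u \<in> h} = {h}" by (auto simp: card_1_singleton_iff)
          then have "h \<in> R \<union> F" "u \<in> h" using A by auto
          then have "card (h - {u}) = d - 1" using finite_sets[of h] card_sets[of h] by auto
          then show ?thesis using h by (simp add: star_def)
        qed
      qed
      have "sets_at u = ?A \<union> ?B" by (auto simp: sets_at_def)
      then have "card ?A + card ?B = 3"
        using 3 card_Un_disjoint[of ?A ?B] fin disj by auto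
      then consider "2 \<le> card ?A" "card ?B \<le> 1" | "2 \<le> card ?B" "card ?A \<le> 1" by linarith
      then show False using big[of R] big[of F] small[of R] small[of F] eq d3 by cases auto
    qed
    then have "1 \<le> card (nb u)" using finite_nb by (simp add: Suc_le_eq card_gt_0_iff)
    let ?b = "min (\<rho> / 2) (\<omega> / 2 - \<kappa> / 2)"
    have "1 * ?b \<le> real (card (nb u)) * ?b"
      using \<open>1 \<le> card (nb u)\<close> \<rho>_pos \<kappa> by (intro mult_right_mono) auto
    also have "\<dots> = (\<Sum>v\<in>nb u. ?b)" by simp
    also have "\<dots> \<le> (\<Sum>v\<in>nb u. share u v)"
      using share_lower[OF np, of _ 2] dv by (intro sum_mono) auto
    finally show ?thesis using degree_three 3 by (auto simp: min_def field_simps split: if_splits)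
  next
    case 4
    then have np: "\<not> pend u" by (simp add: pend_def)
    have dv: "2 \<le> card (donors v)" if "pend v" "v \<in> nb u" for v 
      using that card_donors_ge_2 nb_common nb_subset(3) by blast
    have "0 \<le> (\<Sum>v\<in>nb u. share u v)"
    proof (rule sum_nonneg)
      fix v assume "v \<in> nb u"
      then have "min (\<rho> / 2) (\<omega> / 2 - \<kappa> / real 2) \<le> share u v" using share_lower[OF np, of v 2] dv by auto
      then show "0 \<le> share u v" using \<rho>_pos \<kappa> by (auto simp: min_def split: if_splits)
    qed
    moreover have "\<gamma> * 4 \<le> \<gamma> * real (card (sets_at u))" using 4 \<gamma>_pos by (intro mult_left_mono) auto
    ultimately show ?thesis using degree_four by linarith
  qed
qed

text \<open>In the sum of \<open>vertex_charge\<close> over \<open>U\<close>, the degrees add up to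
  d * (card R + card F), which is at most 2d * card R by \<open>smaller\<close>. This is the origin
  of \<gamma> = \<theta> / (2d): the degree part is then at most \<theta> per set of R.\<close>

theorem vertices_le:
  "real (card U) \<le> \<theta> * real (card R) + (\<Sum>q\<in>Q. real (card (q \<inter> U)) - real d + \<theta>)"
proof -
  have "(\<Sum>u\<in>U. card (sets_at u)) = (\<Sum>u\<in>U. \<Sum>h\<in>{h \<in> R \<union> F. u \<in> h}. 1)" by (simp add: sets_at_def)
  also have "\<dots> = (\<Sum>h\<in>R \<union> F. \<Sum>u\<in>{u \<in> U. u \<in> h}. 1)"
    by (rule sum.swap_restrict) (use finite_U fin in auto)
  also have "\<dots> = (\<Sum>h\<in>R \<union> F. d)"
  proof (intro sum.cong refl)
    fix h assume h: "h \<in> R \<union> F"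
    then have "{u \<in> U. u \<in> h} = h" by (auto simp: U_def)
    then show "(\<Sum>u\<in>{u \<in> U. u \<in> h}. 1) = d" using h card_sets[of h] by auto
  qed
  also have "\<dots> = (card R + card F) * d" using fin disj by (simp add: card_Un_disjoint)
  finally have deg: "(\<Sum>u\<in>U. card (sets_at u)) = (card R + card F) * d" .
  have "real (card U) = (\<Sum>u\<in>U. 1)" by simp
  also have "\<dots> \<le> (\<Sum>u\<in>U. \<gamma> * real (card (sets_at u)) + (\<Sum>v\<in>nb u. share u v))"
    by (intro sum_mono vertex_charge)
  also have "\<dots> = \<gamma> * real (\<Sum>u\<in>U. card (sets_at u)) + (\<Sum>e\<in>D. worth e)"
    by (simp add: sum.distrib sum_distrib_left sum_share)
  also have "\<dots> \<le> \<gamma> * (2 * real (card R) * real d) + (\<Sum>e\<in>D. worth e)"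
    unfolding deg using smaller \<gamma>_pos by (intro add_mono mult_left_mono) (auto intro!: mult_right_mono)
  also have "\<gamma> * (2 * real (card R) * real d) = \<theta> * real (card R)"
    using d3 by (simp add: \<gamma> field_simps)
  finally show ?thesis using sum_worth_le by linarith
qed

end

text \<open>
  In each case \<open>\<theta> = d - 1 - \<delta>\<close> for the threshold value of \<open>\<delta>\<close>. For \<open>d \<ge> 5\<close> no transfers are needed.
\<close>

lemma discharge_weights_3:
  "discharge_weights 3 (8/5) (4/30) (3/5) (8/15) (8/30)"
proof
  show "3/5 * real (t choose 2) \<le> real t - real 3 + 8/5" if "2 \<le> t" "t < 3" for t :: nat
  proof -
    have "t = 2" using that by simp
    then show ?thesis by simp
  qed
qed (simp_all add: real_choose_two)

lemma discharge_weights_4: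
  "discharge_weights 4 (17/7) (9/168) (3/7) (17/42) (17/56)"
proof
  show "3/7 * real (t choose 2) \<le> real t - real 4 + 17/7" if "2 \<le> t" "t < 4" for t :: nat
  proof -
    have "t = 2 \<or> t = 3" using that by auto
    then show ?thesis by (auto simp: real_choose_two)
  qed
qed (simp_all add: real_choose_two)

lemma discharge_weights_ge_5:
  assumes "5 \<le> d"
  shows "discharge_weights d (real d * (real d - 1) / (real d + 1)) 0 (2 / (real d + 1)) (2 / (real d + 1))
    ((real d - 1) / (2 * (real d + 1)))"
proof
  have d1: "real d + 1 > 0" "real d - 1 > 0" using assms by auto
  show eq: "2 / (real d + 1) = real d * (real d - 1) / (real d + 1) / real (d choose 2)"
  proof -
    have "x / y / (x / 2) = 2 / y" if "x > 0" for x y :: real using that by simp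
    from this[of "real d * (real d - 1)"] show ?thesis using d1 assms by (simp add: real_choose_two)
  qed
  show "2 / (real d + 1) * real (t choose 2) \<le> real t - real d + real d * (real d - 1) / (real d + 1)"
    if "2 \<le> t" "t < d" for t :: nat
    unfolding eq by (rule overlap_cost(1)) (use assms that in auto)
  define y where "y = real d + 1"
  have d_eq: "real d = y - 1" by (simp add: y_def)
  have y: "y \<ge> 6" using assms by (simp add: y_def)
  have "6 * y \<le> y * y" using y by (intro mult_right_mono) auto
  \<comment> \<open>For y = d + 1 this is d <= 2 * \<theta> with the denominator cleared.\<close>
  then have y5: "y * 5 \<le> y * y + 4" using y by linarith
  show "2 / (real d + 1) * (real (d choose 2) - 1) \<le> real d * (real d - 1) / (real d + 1)"
    using y by (simp add: real_choose_two d_eq field_simps)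
  show "(real d - 1) / (2 * (real d + 1)) = real d * (real d - 1) / (real d + 1) / (2 * real d)"
  proof -
    have "z / (2 * u) = x * z / u / (2 * x)" if "x \<noteq> 0" for x z u :: real using that by simp
    from this[of "real d"] show ?thesis using assms by simp
  qed
  show "2 / (real d + 1) = real d * (real d - 1) / (real d + 1) - real d + 2"
    using y by (simp add: d_eq field_simps)
  show "real d * (real d - 1) / (real d + 1) \<le> real d" "real d \<le> 2 * (real d * (real d - 1) / (real d + 1))"
    using y y5 by (simp_all add: d_eq field_simps)
  \<comment> \<open>With \<kappa> = 0 the condition for degree one reads 3 * (d - 1) >= 2 * (d + 1),
    that is d >= 5.\<close>
  show "1 \<le> (real d - 1) / (2 * (real d + 1)) + (real d - 1) * (2 / (real d + 1)) / 2 + 0"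
    "1 \<le> 2 * ((real d - 1) / (2 * (real d + 1))) + 2 / (real d + 1)"
    "1 \<le> 2 * ((real d - 1) / (2 * (real d + 1))) + 2 / (real d + 1) - 2 * (0 / (real d - 1))"
    "1 \<le> 2 * ((real d - 1) / (2 * (real d + 1))) + 3 * (2 / (real d + 1)) / 2"
    "1 \<le> 2 * ((real d - 1) / (2 * (real d + 1))) + 3 * (2 / (real d + 1) - 0) / 2"
    "1 \<le> 3 * ((real d - 1) / (2 * (real d + 1))) + 2 / (real d + 1) / 2"
    "1 \<le> 3 * ((real d - 1) / (2 * (real d + 1))) + (2 / (real d + 1) - 0) / 2"
    "1 \<le> 4 * ((real d - 1) / (2 * (real d + 1)))"
    using y by (simp_all add: d_eq field_simps)
qed (use assms in simp_all)

section \<open>Uniqueness of the smallest preimage\<close>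

text \<open>Sparsity is available for H alone. So the contradiction has to come from the removed
  hyperedges and the common ones, both of which lie in H; H' enters through its pairs and through
  comparing sizes.\<close>

locale exchange_pair = discharge_weights +
  fixes H H' :: "'a set set" and \<eta> :: real and L :: nat
  assumes \<eta>: "0 < \<eta>"
    and L: "(real d - \<theta>) / \<eta> + real d * real d \<le> real L"
    and fin: "finite H" "finite H'"
    and unif: "\<And>h. h \<in> H \<Longrightarrow> card h = d" "\<And>h. h \<in> H' \<Longrightarrow> card h = d"
    and sparse: "\<And>K. K \<subseteq> H \<Longrightarrow> card K \<le> L \<Longrightarrow> (\<theta> + \<eta>) * real (card K) \<le> real (card (\<Union>K))"
    and same_edges: "edges H = edges H'"
begin

text \<open>Keeps of the full difference \<open>H - H'\<close>, \<open>H' - H\<close> what can be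
  passed on to a part of it, so that a smallest pair can be chosen.\<close>

definition valid :: "'a set set \<Rightarrow> 'a set set \<Rightarrow> bool" where
  "valid R F \<longleftrightarrow> R \<subseteq> H - H' \<and> F \<subseteq> H' - H \<and> card F \<le> card R \<and> R \<noteq> {}
     \<and> (\<forall>e\<in>sym_diff (edges R) (edges F). \<exists>q\<in>H \<inter> H'. e \<subseteq> q)"

lemma finite_sets: "h \<in> H \<union> H' \<Longrightarrow> finite h"
  using unif d3 by (intro card_ge_0_finite) auto

text \<open>As the parts share no pair, an edge covered by exactly one side of a part is covered by
  exactly one side of the whole, hence by a common hyperedge. Sizes add up, so if F1 outnumbers R1,
  then R2 outnumbers F2, and one of the parts is valid.\<close>

lemma valid_split:
  assumes v: "valid R F"
    and split: "R1 \<union> R2 = R" "R1 \<inter> R2 = {}" "F1 \<union> F2 = F" "F1 \<inter> F2 = {}"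
    and sep: "edges (R1 \<union> F1) \<inter> edges (R2 \<union> F2) = {}"
    and ne: "R1 \<union> F1 \<noteq> {}" "R2 \<union> F2 \<noteq> {}"
  shows "\<exists>R' F'. valid R' F' \<and> card R' + card F' < card R + card F"
proof -
  have finRF: "finite R" "finite F" using v fin by (auto simp: valid_def intro: finite_subset)
  then have f: "finite R1" "finite R2" "finite F1" "finite F2" using split by auto
  have c: "card R = card R1 + card R2" "card F = card F1 + card F2"
    using card_Un_disjoint[of R1 R2] card_Un_disjoint[of F1 F2] f split by auto
  have e: "edges R = edges R1 \<union> edges R2" "edges F = edges F1 \<union> edges F2" "edges (R1 \<union> F1) = edges R1 \<union> edges F1"
    "edges (R2 \<union> F2) = edges R2 \<union> edges F2"
    unfolding split(1,3)[symmetric] edges_Un by auto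
  have cov: "sym_diff (edges R1) (edges F1) \<subseteq> sym_diff (edges R) (edges F)"
    "sym_diff (edges R2) (edges F2) \<subseteq> sym_diff (edges R) (edges F)"
    using sep unfolding e by blast+
  have sub: "R1 \<subseteq> R" "R2 \<subseteq> R" "F1 \<subseteq> F" "F2 \<subseteq> F" using split by auto
  have v1: "valid R1 F1" if "card F1 \<le> card R1" "R1 \<noteq> {}"
    using v that subsetD[OF cov(1)] sub unfolding valid_def by (meson order_trans)
  have v2: "valid R2 F2" if "card F2 \<le> card R2" "R2 \<noteq> {}"
    using v that subsetD[OF cov(2)] sub unfolding valid_def by (meson order_trans)
  have n1: "card R1 + card F1 > 0" and n2: "card R2 + card F2 > 0"
    using ne f by (auto simp: card_gt_0_iff)
  show ?thesis
  proof (cases "card F1 \<le> card R1")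
    case True
    then have "R1 \<noteq> {}" using n1 by auto
    then have "valid R1 F1" using v1 True by blast
    then show ?thesis using c n2 by (intro exI[of _ R1] exI[of _ F1]) auto
  next
    case False
    then have "card F2 < card R2" using c v by (auto simp: valid_def)
    then have "valid R2 F2" using v2 by fastforce
    then show ?thesis using c n1 by (intro exI[of _ R2] exI[of _ F2]) auto
  qed
qed

lemma edge_in_closed:
  assumes "e \<subseteq> h" "card e = 2" "e \<subseteq> V" "finite h"
  shows "2 \<le> card (h \<inter> V)"
  using card_mono[of "h \<inter> V" e] assms by auto

text \<open>
  A minimal valid pair cannot be split along its shared edges. So it lies inside one bounded closed
  subhypergraph, and unless it is a single redundant hyperedge, each of its sets shares an edge with
  another one. Both are what the discharging bound needs to contradict sparsity.
\<close>

lemma no_valid: "\<not> valid R F"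
proof
  assume "valid R F"
  then obtain R F where v: "valid R F" and min: "\<And>R' F'. valid R' F' \<Longrightarrow> card R + card F \<le> card R' + card F'"
    using ex_has_least_nat[of "\<lambda>(R, F). valid R F" "(R, F)" "\<lambda>(R, F). card R + card F"] by auto
  have RF: "R \<subseteq> H - H'" "F \<subseteq> H' - H" "card F \<le> card R" "R \<noteq> {}"
    and cov: "\<And>e. e \<in> sym_diff (edges R) (edges F) \<Longrightarrow> \<exists>q\<in>H \<inter> H'. e \<subseteq> q"
    using v unfolding valid_def by blast+
  have fRF: "finite R" "finite F" using RF fin by (auto intro: finite_subset)
  have unsplit: "False" if "R1 \<union> R2 = R" "R1 \<inter> R2 = {}" "F1 \<union> F2 = F" "F1 \<inter> F2 = {}"
    "edges (R1 \<union> F1) \<inter> edges (R2 \<union> F2) = {}" "R1 \<union> F1 \<noteq> {}" "R2 \<union> F2 \<noteq> {}" for R1 R2 F1 F2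
    using valid_split[OF v that] min by (meson leD)
  obtain r where r: "r \<in> R" using RF by auto
  obtain K where K: "K \<subseteq> H" "r \<in> K" "card K \<le> L"
    and K1: "\<And>k. k \<in> H \<Longrightarrow> 2 \<le> card (k \<inter> \<Union>K) \<Longrightarrow> k \<in> K"
    and K2: "\<And>g. card g = d \<Longrightarrow> edges {g} \<subseteq> edges H \<Longrightarrow> 2 \<le> card (g \<inter> \<Union>K) \<Longrightarrow> edges {g} \<subseteq> edges K"
    using closed_subhypergraph_exists[OF d3 \<theta>_lower \<theta>_upper(1) \<eta> fin(1) unif(1) L sparse, of r] r RF by blast
  have finK: "finite K" using K fin finite_subset by blast
  have finh: "finite h" if "h \<in> R \<union> F" for h using that RF finite_sets[of h] by auto
  \<comment> \<open>By closedness of \<open>K\<close> these are exactly the sets of F that meet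
    \<Union>K in at least a pair.\<close>
  define F1 where "F1 = {g \<in> F. edges {g} \<subseteq> edges K}"
  have memF1: "g \<in> F1" if g: "g \<in> F" "e \<subseteq> g" "card e = 2" "e \<subseteq> \<Union>K" for g e
  proof -
    have "g \<in> H'" using g RF by auto
    then have "edges {g} \<subseteq> edges H" using same_edges edges_mono[of "{g}" H'] by auto
    moreover have "2 \<le> card (g \<inter> \<Union>K)" using g finh by (intro edge_in_closed[of e]) auto
    ultimately show ?thesis using K2 unif(2) \<open>g \<in> H'\<close> g(1) by (auto simp: F1_def)
  qed
  have memR1: "h \<in> K" if h: "h \<in> H" "e \<subseteq> h" "card e = 2" "e \<subseteq> \<Union>K" for h e
    using h by (intro K1 edge_in_closed[of e]) (auto intro: finite_sets)
  have "R - K = {} \<and> F - F1 = {}"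
  proof (rule ccontr)
    assume "\<not> (R - K = {} \<and> F - F1 = {})"
    \<comment> \<open>A pair on both sides would lie in \<Union>K, and closedness would pull the set
      on the far side into \<open>K\<close> or \<open>F1\<close>.\<close>
    moreover have "edges ((R \<inter> K) \<union> F1) \<inter> edges ((R - K) \<union> (F - F1)) = {}"
    proof (rule ccontr)
      assume "edges ((R \<inter> K) \<union> F1) \<inter> edges ((R - K) \<union> (F - F1)) \<noteq> {}"
      then obtain e where e: "e \<in> edges ((R \<inter> K) \<union> F1)" "e \<in> edges ((R - K) \<union> (F - F1))" by auto
      have c2: "card e = 2" using e by (auto simp: edges_def)
      have "e \<in> edges K" using e(1) by (auto simp: F1_def edges_def)
      then have eU: "e \<subseteq> \<Union>K" by (auto simp: edges_def)
      obtain h where h: "h \<in> (R - K) \<union> (F - F1)" "e \<subseteq> h" using e(2) by (auto simp: edges_def)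
      then show False using memF1[of h e] memR1[of h e] c2 eU RF by auto
    qed
    ultimately show False using unsplit[of "R \<inter> K" "R - K" F1 "F - F1"] r K(2) by (auto simp: F1_def)
  qed
  then have RK: "R \<subseteq> K" and FK: "\<And>g. g \<in> F \<Longrightarrow> edges {g} \<subseteq> edges K" by (auto simp: F1_def)
  define Q where "Q = {q \<in> H \<inter> H'. \<exists>e\<in>sym_diff (edges R) (edges F). e \<subseteq> q}"
  have QK: "Q \<subseteq> K"
  proof
    fix q assume "q \<in> Q"
    then obtain e where e: "e \<in> sym_diff (edges R) (edges F)" "e \<subseteq> q" "q \<in> H" by (auto simp: Q_def)
    have "edges F \<subseteq> edges K"
    proof
      fix e assume "e \<in> edges F"
      then obtain g where "g \<in> F" "e \<in> edges {g}" by (auto simp: edges_def)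
      then show "e \<in> edges K" using FK by blast
    qed
    then have "e \<in> edges K" using e(1) edges_mono[OF RK] by blast
    then show "q \<in> K" using memR1[OF e(3,2)] by (auto simp: edges_def)
  qed
  have finQ: "finite Q" using QK finK finite_subset by auto
  define U where "U = \<Union>(R \<union> F)"
  have finU: "finite U" using fRF finh by (auto simp: U_def)
  have disj: "R \<inter> F = {}" "Q \<inter> (R \<union> F) = {}" "R \<inter> Q = {}" using RF by (auto simp: Q_def)
  have main: "real (card U) \<le> \<theta> * real (card R) + (\<Sum>q\<in>Q. real (card (q \<inter> U)) - real d + \<theta>)"
  proof (cases "\<forall>h\<in>R \<union> F. \<exists>h'\<in>R \<union> F. h' \<noteq> h \<and> 2 \<le> card (h \<inter> h')")
    case True
    interpret exchange d \<theta> \<kappa> \<omega> \<rho> \<gamma> R F Q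
    proof
      show "card h = d" if "h \<in> R" for h using that RF unif by auto
      show "card h = d" if "h \<in> F" for h using that RF unif by auto
      show "card h = d" if "h \<in> Q" for h using that unif by (auto simp: Q_def)
      show "\<exists>q\<in>Q. e \<subseteq> q" if "e \<in> sym_diff (edges R) (edges F)" for e
        using cov[OF that] that unfolding Q_def by blast
      show "\<exists>e\<in>sym_diff (edges R) (edges F). e \<subseteq> q" if "q \<in> Q" for q using that unfolding Q_def by blast
      show "\<exists>h'\<in>R \<union> F. h' \<noteq> h \<and> 2 \<le> card (h \<inter> h')" if "h \<in> R \<union> F" for h using True that by blast
    qed (use fRF finQ disj RF in auto)
    show ?thesis using vertices_le unfolding U_def \<open>U = \<Union>(R \<union> F)\<close> .
  next
    case False
    then obtain h where h: "h \<in> R \<union> F" and iso: "\<And>h'. h' \<in> R \<union> F \<Longrightarrow> h' \<noteq> h \<Longrightarrow> card (h \<inter> h') < 2"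
      by (meson not_le)
    have sep: "edges {h} \<inter> edges (R \<union> F - {h}) = {}"
    proof (rule ccontr)
      assume "edges {h} \<inter> edges (R \<union> F - {h}) \<noteq> {}"
      then obtain e h' where "h' \<in> R \<union> F" "h' \<noteq> h" "e \<subseteq> h" "e \<subseteq> h'" "card e = 2" by (auto simp: edges_def)
      then show False using iso[of h'] edge_in_closed[of e h h'] finh[OF h] by auto
    qed
    \<comment> \<open>An isolated h could be split off, so by minimality it is the whole pair. As R
      is nonempty, what remains is one hyperedge r of H all of whose pairs are covered by common
      hyperedges.\<close>
    have rest: "R \<union> F - {h} = {}"
    proof (rule ccontr)
      assume ne: "R \<union> F - {h} \<noteq> {}"
      have eq: "(R \<inter> {h}) \<union> (F \<inter> {h}) = {h}" "(R - {h}) \<union> (F - {h}) = R \<union> F - {h}" using h by auto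
      show False by (rule unsplit[of "R \<inter> {h}" "R - {h}" "F \<inter> {h}" "F - {h}"]) (use sep ne in \<open>auto simp: eq\<close>)
    qed
    have "R \<subseteq> {r}" "F \<subseteq> {r}" using rest r by auto
    then have F0: "F = {}" and R1: "R = {r}" using r disj(1) by auto
    have rH: "r \<in> H" "finite r" "card r = d" using r RF unif finh by auto
    have Ur: "U = r" by (simp add: U_def F0 R1)
    have "edges {r} \<subseteq> (\<Union>q\<in>Q. edges {q \<inter> r})"
    proof
      fix e assume e: "e \<in> edges {r}"
      then have "e \<in> sym_diff (edges R) (edges F)" by (simp add: F0 R1 edges_def)
      then obtain q where "q \<in> H \<inter> H'" "e \<subseteq> q" using cov by blast
      then have "q \<in> Q" "e \<subseteq> q \<inter> r" using e \<open>e \<in> sym_diff _ _\<close> unfolding Q_def by (blast, auto simp: edges_def)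
      then show "e \<in> (\<Union>q\<in>Q. edges {q \<inter> r})" using e by (auto simp: edges_def)
    qed
    then have "card (edges {r}) \<le> card (\<Union>q\<in>Q. edges {q \<inter> r})"
      using finQ rH by (intro card_mono) (auto intro!: finite_edges)
    also have "\<dots> \<le> (\<Sum>q\<in>Q. card (edges {q \<inter> r}))" by (rule card_UN_le[OF finQ])
    also have "\<dots> = (\<Sum>q\<in>Q. card (q \<inter> r) choose 2)"
      using rH by (intro sum.cong refl card_edges_singleton) auto
    finally have "real (d choose 2) \<le> (\<Sum>q\<in>Q. real (card (q \<inter> r) choose 2))"
      using card_edges_singleton[OF rH(2)] rH(3) by (simp flip: of_nat_sum)
    then have "\<rho> * real (d choose 2) \<le> \<rho> * (\<Sum>q\<in>Q. real (card (q \<inter> r) choose 2))"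
      using \<rho>_pos by (intro mult_left_mono) auto
    also have "\<dots> = (\<Sum>q\<in>Q. \<rho> * real (card (q \<inter> r) choose 2))" by (simp add: sum_distrib_left)
    also have "\<dots> \<le> (\<Sum>q\<in>Q. real (card (q \<inter> U)) - real d + \<theta>)"
    proof (rule sum_mono)
      fix q assume q: "q \<in> Q"
      then obtain e where "e \<in> edges {r}" "e \<subseteq> q" by (auto simp: Q_def F0 R1 edges_def)
      then have "2 \<le> card (q \<inter> r)" using edge_in_closed[of e q r] q finite_sets[of q] by (auto simp: edges_def Q_def)
      moreover have "card (q \<inter> r) \<le> d" using rH card_mono[of r "q \<inter> r"] by auto
      ultimately show "\<rho> * real (card (q \<inter> r) choose 2) \<le> real (card (q \<inter> U)) - real d + \<theta>"
        unfolding Ur by (rule \<rho>_overlap)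
    qed
    finally have "\<rho> * real (d choose 2) \<le> (\<Sum>q\<in>Q. real (card (q \<inter> U)) - real d + \<theta>)" .
    \<comment> \<open>The overlaps with \<open>Q\<close> are thus worth at least \<theta>, and r
      itself counts another \<theta>. Together they pay for the d vertices of r because d <= 2 *
      \<theta>.\<close>
    moreover have "\<rho> * real (d choose 2) = \<theta>" using d3 by (simp add: \<rho> real_choose_two)
    ultimately show ?thesis using \<theta>_upper(2) rH by (simp add: Ur R1)
  qed
  \<comment> \<open>Each q adds at most d - |q \<inter> U| vertices outside \<open>U\<close>. This
    cancels against its term in \<open>main\<close> and leaves \<theta> per hyperedge of R and
    \<open>Q\<close>.\<close>
  have "card (\<Union>(R \<union> Q)) \<le> card (U \<union> \<Union>Q)"
    by (rule card_mono) (use finU finQ finite_sets in \<open>auto simp: U_def Q_def\<close>)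
  also have "\<dots> \<le> card U + (\<Sum>q\<in>Q. card (q - U))"
    by (rule card_Un_Union_le) (use finU finQ finite_sets in \<open>auto simp: Q_def\<close>)
  finally have "real (card (\<Union>(R \<union> Q))) \<le> real (card U) + (\<Sum>q\<in>Q. real (card (q - U)))"
    by (simp flip: of_nat_sum of_nat_add)
  also have "(\<Sum>q\<in>Q. real (card (q - U))) = (\<Sum>q\<in>Q. real d - real (card (q \<inter> U)))"
  proof (intro sum.cong refl)
    fix q assume "q \<in> Q"
    then have q: "finite q" "card q = d" using finite_sets unif by (auto simp: Q_def)
    have "card (q \<inter> U) \<le> d" using q card_mono[of q "q \<inter> U"] by auto
    then show "real (card (q - U)) = real d - real (card (q \<inter> U))"
      using q by (simp add: card_Diff_subset_Int of_nat_diff)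
  qed
  also have "real (card U) + (\<Sum>q\<in>Q. real d - real (card (q \<inter> U)))
     \<le> \<theta> * real (card R) + ((\<Sum>q\<in>Q. real (card (q \<inter> U)) - real d + \<theta>) + (\<Sum>q\<in>Q. real d - real (card (q \<inter> U))))"
    using main by simp
  also have "\<dots> = \<theta> * real (card R) + \<theta> * real (card Q)"
    unfolding sum.distrib[symmetric] by simp
  also have "\<dots> = \<theta> * real (card (R \<union> Q))"
    using fRF finQ disj by (simp add: card_Un_disjoint distrib_left)
  finally have up: "real (card (\<Union>(R \<union> Q))) \<le> \<theta> * real (card (R \<union> Q))" .
  have "R \<union> Q \<subseteq> K" using RK QK by auto
  then have "card (R \<union> Q) \<le> L" using card_mono[OF finK, of "R \<union> Q"] K(3) by linarith
  then have "(\<theta> + \<eta>) * real (card (R \<union> Q)) \<le> real (card (\<Union>(R \<union> Q)))"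
    using sparse[of "R \<union> Q"] \<open>R \<union> Q \<subseteq> K\<close> K(1) by blast
  then have "\<eta> * real (card (R \<union> Q)) \<le> 0" using up by (simp add: distrib_right)
  moreover have "card (R \<union> Q) > 0" using RF(4) fRF finQ by (simp add: card_gt_0_iff)
  ultimately show False using \<eta> by (simp add: mult_le_0_iff)
qed

text \<open>The full difference is a valid pair: an edge covered by exactly one of its sides belongs
  to both projections, and in the hypergraph whose own side misses it, the covering hyperedge has to
  be a common one.\<close>

theorem unique_smallest_preimage:
  assumes "card H' \<le> card H"
  shows "H' = H"
proof (rule ccontr)
  assume ne: "H' \<noteq> H"
  have c: "card (H' - H) \<le> card (H - H')"
    using assms fin by (simp add: card_Diff_subset_Int Int_commute)
  have "H - H' \<noteq> {}"
  proof
    assume "H - H' = {}"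
    then have "card (H' - H) = 0" using c by (metis card.empty le_zero_eq)
    then have "H' - H = {}" using fin by simp
    then show False using ne \<open>H - H' = {}\<close> by auto
  qed
  moreover have "\<exists>q\<in>H \<inter> H'. e \<subseteq> q" if e: "e \<in> sym_diff (edges (H - H')) (edges (H' - H))" for e
  proof -
    have "card e = 2" using e by (auto simp: edges_def)
    have "e \<in> edges H \<union> edges H'" using e by (auto simp: edges_def)
    then have "e \<in> edges H" "e \<in> edges H'" using same_edges by auto
    then obtain h h' where "h \<in> H" "e \<subseteq> h" "h' \<in> H'" "e \<subseteq> h'" by (auto simp: edges_def)
    then show ?thesis using e \<open>card e = 2\<close> by (auto simp: edges_def)
  qed
  ultimately have "valid (H - H') (H' - H)" using c by (simp add: valid_def)
  then show False using no_valid by blast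
qed

end

section \<open>The random hypergraph\<close>

lemma finite_d_subsets: "finite (d_subsets n d)"
  by (simp add: d_subsets_def)

lemma card_d_subsets: "card (d_subsets n d) = n choose d"
  using n_subsets[of "{1..n}" d] by (simp add: d_subsets_def)

text \<open>Connects to the deterministic part, which works over any vertex type and has no ambient
  set \<open>{1..n}\<close>.\<close>

lemma Proj_eq_edges:
  assumes "H \<subseteq> d_subsets n d"
  shows "Proj n H = edges H"
proof
  show "Proj n H \<subseteq> edges H" by (auto simp: Proj_def edges_def)
  show "edges H \<subseteq> Proj n H"
  proof
    fix e assume "e \<in> edges H"
    then obtain i j h where e: "e = {i, j}" "i \<noteq> j" "h \<in> H" "{i, j} \<subseteq> h" by (auto simp: edges_def card_2_iff)
    have "h \<subseteq> {1..n}" using e(3) assms by (auto simp: d_subsets_def)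
    then have "i \<in> {1..n}" "j \<in> {1..n}" using e(4) by auto
    then show "e \<in> Proj n H" using e unfolding Proj_def by (intro CollectI exI[of _ i] exI[of _ j]) auto
  qed
qed

lemma set_pmf_random_hypergraph: "set_pmf (random_hypergraph n d p) \<subseteq> hypergraphs n d"
  by (auto simp: random_hypergraph_def hypergraphs_def)

lemma finite_set_pmf_random_hypergraph: "finite (set_pmf (random_hypergraph n d p))"
  using set_pmf_random_hypergraph finite_hypergraphs by (rule finite_subset)

text \<open>By independence the event is a product in which A and B fix coordinates and the others
  are free. \<open>B = {}\<close> serves for moments of counts, and B as the complement of A for
  point masses.\<close>

lemma prob_between:
  assumes p: "0 \<le> p" "p \<le> 1" and sub: "A \<subseteq> d_subsets n d" "B \<subseteq> d_subsets n d" "A \<inter> B = {}"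
  shows "measure_pmf.prob (random_hypergraph n d p) {H. A \<subseteq> H \<and> H \<inter> B = {}} = p ^ card A * (1 - p) ^ card B"
proof -
  let ?D = "d_subsets n d"
  define S where "S h = (if h \<in> A then {True} else if h \<in> B then {False} else UNIV)" for h
  have "measure_pmf.prob (random_hypergraph n d p) {H. A \<subseteq> H \<and> H \<inter> B = {}}
    = measure_pmf.prob (Pi_pmf ?D False (\<lambda>_. bernoulli_pmf p)) {X. A \<subseteq> {h \<in> ?D. X h} \<and> {h \<in> ?D. X h} \<inter> B = {}}"
    by (simp add: random_hypergraph_def vimage_def)
  also have "{X. A \<subseteq> {h \<in> ?D. X h} \<and> {h \<in> ?D. X h} \<inter> B = {}} = Pi ?D S"
  proof (intro set_eqI iffI)
    fix X assume X: "X \<in> {X. A \<subseteq> {h \<in> ?D. X h} \<and> {h \<in> ?D. X h} \<inter> B = {}}"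
    show "X \<in> Pi ?D S"
    proof
      fix h assume "h \<in> ?D"
      then show "X h \<in> S h" using X by (auto simp: S_def)
    qed
  next
    fix X assume X: "X \<in> Pi ?D S"
    have "X h" if "h \<in> A" for h
      using Pi_mem[OF X, of h] that subsetD[OF sub(1)] by (simp add: S_def)
    moreover have "\<not> X h" if "h \<in> B" for h
    proof -
      have "h \<notin> A" "h \<in> ?D" using that sub by blast+
      then show ?thesis using Pi_mem[OF X, of h] that by (simp add: S_def)
    qed
    ultimately show "X \<in> {X. A \<subseteq> {h \<in> ?D. X h} \<and> {h \<in> ?D. X h} \<inter> B = {}}" using sub by auto
  qed
  also have "measure_pmf.prob (Pi_pmf ?D False (\<lambda>_. bernoulli_pmf p)) (Pi ?D S)
     = (\<Prod>h\<in>?D. measure_pmf.prob (bernoulli_pmf p) (S h))"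
    by (rule measure_Pi_pmf_Pi[OF finite_d_subsets])
  also have "\<dots> = (\<Prod>h\<in>?D. (if h \<in> A then p else 1) * (if h \<in> B then 1 - p else 1))"
    using p sub by (intro prod.cong refl) (auto simp: S_def measure_pmf_single)
  also have "\<dots> = (\<Prod>h\<in>?D \<inter> A. p) * (\<Prod>h\<in>?D \<inter> B. 1 - p)"
    unfolding prod.distrib prod.inter_restrict[OF finite_d_subsets] ..
  also have "\<dots> = p ^ card A * (1 - p) ^ card B" using sub by (simp add: Int_absorb1)
  finally show ?thesis .
qed

lemma prob_superset:
  assumes "0 \<le> p" "p \<le> 1" "A \<subseteq> d_subsets n d"
  shows "measure_pmf.prob (random_hypergraph n d p) {H. A \<subseteq> H} = p ^ card A"
  using prob_between[OF assms, of "{}"] by simp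

lemma pmf_random_hypergraph:
  assumes p: "0 \<le> p" "p \<le> 1" and H: "H \<in> hypergraphs n d"
  shows "pmf (random_hypergraph n d p) H = p ^ card H * (1 - p) ^ ((n choose d) - card H)"
proof -
  have sub: "H \<subseteq> d_subsets n d" using H by (simp add: hypergraphs_def)
  have "pmf (random_hypergraph n d p) H = measure_pmf.prob (random_hypergraph n d p) {H}"
    by (simp add: measure_pmf_single)
  \<comment> \<open>The events differ only by families with members outside
    \<open>d_subsets n d\<close>, which have probability 0.\<close>
  also have "\<dots> = measure_pmf.prob (random_hypergraph n d p) {H'. H \<subseteq> H' \<and> H' \<inter> (d_subsets n d - H) = {}}"
  proof (rule measure_prob_cong_0)
    fix H' assume H': "H' \<in> {H'. H \<subseteq> H' \<and> H' \<inter> (d_subsets n d - H) = {}} - {H}"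
    have "H' \<notin> hypergraphs n d"
    proof
      assume "H' \<in> hypergraphs n d"
      then have "H' \<subseteq> d_subsets n d" by (simp add: hypergraphs_def)
      then show False using H' by blast
    qed
    then show "pmf (random_hypergraph n d p) H' = 0"
      using set_pmf_random_hypergraph[of n d p] by (auto simp: set_pmf_iff)
  qed auto
  also have "\<dots> = p ^ card H * (1 - p) ^ card (d_subsets n d - H)"
    by (rule prob_between[OF p sub]) auto
  also have "card (d_subsets n d - H) = (n choose d) - card H"
    using sub finite_d_subsets[of n d] by (simp add: card_Diff_subset finite_subset card_d_subsets)
  finally show ?thesis .
qed

text \<open>Chebyshev's inequality with an explicit second moment: \<open>A i\<close> and
  \<open>A j\<close> are both present with probability p to the power of the size of their union. It
  serves both for counting hyperedges and for counting placed patterns.\<close>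

lemma prob_count_deviation:
  fixes A :: "'i \<Rightarrow> nat set set"
  assumes p: "0 \<le> p" "p \<le> 1" and I: "finite I" "\<And>i. i \<in> I \<Longrightarrow> A i \<subseteq> d_subsets n d" and t: "0 < t"
  defines "m \<equiv> \<Sum>i\<in>I. p ^ card (A i)"
  shows "measure_pmf.prob (random_hypergraph n d p) {H. t \<le> \<bar>real (card {i \<in> I. A i \<subseteq> H}) - m\<bar>}
     \<le> ((\<Sum>i\<in>I. \<Sum>j\<in>I. p ^ card (A i \<union> A j)) - m\<^sup>2) / t\<^sup>2"
proof -
  let ?M = "random_hypergraph n d p"
  define X where "X H = real (card {i \<in> I. A i \<subseteq> H})" for H
  have int: "integrable ?M f" for f :: "nat set set \<Rightarrow> real"
    using finite_set_pmf_random_hypergraph by (rule integrable_measure_pmf_finite)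
  have X_eq: "X H = (\<Sum>i\<in>I. indicator {H. A i \<subseteq> H} H)" for H
    using I(1) by (simp add: X_def indicator_def sum.If_cases Int_def)
  have EX: "measure_pmf.expectation ?M X = m"
    unfolding X_eq m_def using prob_superset[OF p I(2)] by (subst Bochner_Integration.integral_sum) (auto intro!: int sum.cong)
  have "X H ^ 2 = (\<Sum>i\<in>I. \<Sum>j\<in>I. indicator {H. A i \<union> A j \<subseteq> H} H)" for H
    unfolding X_eq power2_eq_square sum_product by (intro sum.cong refl) (auto simp: indicator_def)
  then have EX2: "measure_pmf.expectation ?M (\<lambda>H. X H ^ 2) = (\<Sum>i\<in>I. \<Sum>j\<in>I. p ^ card (A i \<union> A j))"
    using prob_superset[OF p, of "A _ \<union> A _"] I(2)
    by (simp only: ) (simp add: Bochner_Integration.integral_sum int del: Un_subset_iff)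
  have "measure_pmf.prob ?M {H \<in> space ?M. t \<le> \<bar>X H - measure_pmf.expectation ?M X\<bar>} \<le> measure_pmf.variance ?M X / t\<^sup>2"
    by (rule measure_pmf.Chebyshev_inequality) (use int t in auto)
  also have "measure_pmf.variance ?M X = measure_pmf.expectation ?M (\<lambda>H. X H ^ 2) - (measure_pmf.expectation ?M X)\<^sup>2"
    by (rule measure_pmf.variance_eq) (rule int)+
  finally show ?thesis unfolding EX EX2 unfolding X_def by simp
qed

section \<open>Exact recovery below the threshold\<close>

text \<open>Union bound over the vertex set of K, of size v, and over K itself. There are at most
  n^v vertex sets, each carrying boundedly many K. With k hyperedges the term is of order n^(v - a *
  k), below n^((s - a) * k) as v < s * k. This also forces k >= 1, so s <= a bounds every term by
  n^(s - a).\<close>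

lemma prob_dense_subhypergraph_le:
  fixes s a C p :: real and n d L :: nat
  assumes p: "0 \<le> p" "p \<le> 1" "p \<le> C * real n powr (- a)" and C: "1 \<le> C" and s: "s \<le> a" and n: "1 \<le> n"
  shows "measure_pmf.prob (random_hypergraph n d p) {H. \<exists>K\<subseteq>H. card K \<le> L \<and> real (card (\<Union>K)) < s * real (card K)}
    \<le> real (d * L + 1) * 2 ^ 2 ^ (d * L) * C ^ L * real n powr (s - a)"
proof -
  let ?M = "random_hypergraph n d p"
  define S where "S v = {U. U \<subseteq> {1..n} \<and> card U = v}" for v
  define G where "G U = {K. K \<subseteq> Pow U \<and> K \<subseteq> d_subsets n d \<and> card K \<le> L \<and> real (card U) < s * real (card K)}" for U
  have finS: "finite (S v)" for v by (simp add: S_def)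
  have finG: "finite (G U)" for U by (rule finite_subset[of _ "Pow (d_subsets n d)"]) (auto simp: G_def finite_d_subsets)
  have cS: "card (S v) = n choose v" for v using n_subsets[of "{1..n}" v] by (simp add: S_def)
  have "measure_pmf.prob ?M {H. \<exists>K\<subseteq>H. card K \<le> L \<and> real (card (\<Union>K)) < s * real (card K)}
    \<le> measure_pmf.prob ?M (\<Union>v\<in>{..d * L}. \<Union>U\<in>S v. \<Union>K\<in>G U. {H. K \<subseteq> H})"
  proof (rule measure_pmf.finite_measure_mono_AE)
    show "AE H in measure_pmf ?M. H \<in> {H. \<exists>K\<subseteq>H. card K \<le> L \<and> real (card (\<Union>K)) < s * real (card K)} \<longrightarrow>
       H \<in> (\<Union>v\<in>{..d * L}. \<Union>U\<in>S v. \<Union>K\<in>G U. {H. K \<subseteq> H})"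
    proof (rule AE_pmfI, intro impI)
      fix H assume "H \<in> set_pmf ?M" and "H \<in> {H. \<exists>K\<subseteq>H. card K \<le> L \<and> real (card (\<Union>K)) < s * real (card K)}"
      then obtain K where K: "K \<subseteq> H" "card K \<le> L" "real (card (\<Union>K)) < s * real (card K)" and H: "H \<subseteq> d_subsets n d"
        using set_pmf_random_hypergraph[of n d p] by (auto simp: hypergraphs_def)
      have KD: "h \<subseteq> {1..n}" "card h = d" if "h \<in> K" for h using that K H by (auto simp: d_subsets_def)
      have "card (\<Union>K) \<le> (\<Sum>h\<in>K. card h)" by (rule card_Union_le_sum_card)
      also have "\<dots> = card K * d" using KD by simp
      also have "\<dots> \<le> d * L" using K by (simp add: mult.commute)
      finally have "card (\<Union>K) \<in> {..d * L}" by simp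
      moreover have "\<Union>K \<in> S (card (\<Union>K))" using KD by (auto simp: S_def)
      moreover have "K \<in> G (\<Union>K)" using K H by (auto simp: G_def)
      ultimately show "H \<in> (\<Union>v\<in>{..d * L}. \<Union>U\<in>S v. \<Union>K\<in>G U. {H. K \<subseteq> H})" using K(1) by blast
    qed
  qed auto
  also have "\<dots> \<le> (\<Sum>v\<in>{..d * L}. measure_pmf.prob ?M (\<Union>U\<in>S v. \<Union>K\<in>G U. {H. K \<subseteq> H}))"
    by (rule measure_UNION_le) auto
  also have "\<dots> \<le> (\<Sum>v\<in>{..d * L}. \<Sum>U\<in>S v. measure_pmf.prob ?M (\<Union>K\<in>G U. {H. K \<subseteq> H}))"
    by (intro sum_mono measure_UNION_le finS) auto
  also have "\<dots> \<le> (\<Sum>v\<in>{..d * L}. \<Sum>U\<in>S v. \<Sum>K\<in>G U. measure_pmf.prob ?M {H. K \<subseteq> H})"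
    by (intro sum_mono measure_UNION_le finG) auto
  also have "\<dots> \<le> (\<Sum>v\<in>{..d * L}. \<Sum>U\<in>S v. \<Sum>K\<in>G U. C ^ L * real n powr (s - a - real v))"
  proof (intro sum_mono)
    fix v U K assume v: "v \<in> {..d * L}" and U: "U \<in> S v" and K: "K \<in> G U"
    let ?k = "card K"
    have k: "real v < s * real ?k" "?k \<le> L" using K U by (auto simp: G_def S_def)
    have k1: "1 \<le> ?k" using k(1) by (cases "?k") auto
    have "measure_pmf.prob ?M {H. K \<subseteq> H} = p ^ ?k" by (rule prob_superset) (use p K in \<open>auto simp: G_def\<close>)
    also have "\<dots> \<le> (C * real n powr (- a)) ^ ?k" using p by (intro power_mono) auto
    also have "\<dots> = C ^ ?k * real n powr (- a * real ?k)"
      using n by (simp add: power_mult_distrib powr_power mult.commute)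
    also have "\<dots> \<le> C ^ L * real n powr (s - a - real v)"
    proof (intro mult_mono powr_mono power_increasing)
      have "(s - a) * real ?k \<le> (s - a) * 1" by (rule mult_left_mono_neg) (use k1 s in auto)
      then show "- a * real ?k \<le> s - a - real v" using k(1) by (simp add: left_diff_distrib)
    qed (use k C n in auto)
    finally show "measure_pmf.prob ?M {H. K \<subseteq> H} \<le> C ^ L * real n powr (s - a - real v)" .
  qed
  also have "\<dots> \<le> (\<Sum>v\<in>{..d * L}. real n powr real v * (2 ^ 2 ^ (d * L) * (C ^ L * real n powr (s - a - real v))))"
  proof (rule sum_mono)
    fix v assume v: "v \<in> {..d * L}"
    have cG: "card (G U) \<le> 2 ^ 2 ^ (d * L)" if U: "U \<in> S v" for U
    proof -
      have fU: "finite U" "card U = v" using U finite_subset by (auto simp: S_def)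
      have "card (G U) \<le> card (Pow (Pow U))" using fU by (intro card_mono) (auto simp: G_def)
      also have "\<dots> = 2 ^ 2 ^ v" using fU by (simp add: card_Pow)
      also have "\<dots> \<le> 2 ^ 2 ^ (d * L)" using v by (intro power_increasing) auto
      finally show ?thesis .
    qed
    have "(\<Sum>U\<in>S v. \<Sum>K\<in>G U. C ^ L * real n powr (s - a - real v))
      \<le> (\<Sum>U\<in>S v. 2 ^ 2 ^ (d * L) * (C ^ L * real n powr (s - a - real v)))"
    proof (rule sum_mono)
      fix U assume "U \<in> S v"
      then have "real (card (G U)) \<le> real (2 ^ 2 ^ (d * L))" using cG by (intro of_nat_mono) auto
      then have "real (card (G U)) * (C ^ L * real n powr (s - a - real v)) \<le> 2 ^ 2 ^ (d * L) * (C ^ L * real n powr (s - a - real v))"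
        using C by (intro mult_right_mono) auto
      then show "(\<Sum>K\<in>G U. C ^ L * real n powr (s - a - real v)) \<le> 2 ^ 2 ^ (d * L) * (C ^ L * real n powr (s - a - real v))"
        by simp
    qed
    also have "\<dots> = real (n choose v) * (2 ^ 2 ^ (d * L) * (C ^ L * real n powr (s - a - real v)))"
      by (simp add: cS)
    also have "\<dots> \<le> real n powr real v * (2 ^ 2 ^ (d * L) * (C ^ L * real n powr (s - a - real v)))"
    proof (intro mult_right_mono)
      have "real (n choose v) \<le> real (n ^ v)"
      proof (cases "v \<le> n")
        case True then show ?thesis using binomial_le_pow[OF True] by (intro of_nat_mono)
      qed (simp add: binomial_eq_0)
      then show "real (n choose v) \<le> real n powr real v" using n by (simp add: powr_realpow)
    qed (use C in auto)
    finally show "(\<Sum>U\<in>S v. \<Sum>K\<in>G U. C ^ L * real n powr (s - a - real v))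
      \<le> real n powr real v * (2 ^ 2 ^ (d * L) * (C ^ L * real n powr (s - a - real v)))" .
  qed
  also have "\<dots> = (\<Sum>v\<in>{..d * L}. 2 ^ 2 ^ (d * L) * C ^ L * real n powr (s - a))"
  proof (intro sum.cong refl)
    fix v
    have "real n powr real v * real n powr (s - a - real v) = real n powr (s - a)"
      by (simp add: powr_add[symmetric])
    then show "real n powr real v * (2 ^ 2 ^ (d * L) * (C ^ L * real n powr (s - a - real v))) = 2 ^ 2 ^ (d * L) * C ^ L * real n powr (s - a)"
      by (simp add: mult_ac)
  qed
  also have "\<dots> = real (d * L + 1) * 2 ^ 2 ^ (d * L) * C ^ L * real n powr (s - a)" by simp
  finally show ?thesis .
qed

lemma exact_recovery_prob_le_1: "exact_recovery_prob n d p \<le> 1"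
  using exact_recovery_prob_attained[of n d p] by (auto simp: recovery_prob_def)

text \<open>The estimator that returns some smallest preimage is right on every good H.\<close>

lemma prob_unique_smallest_le_exact_recovery:
  assumes "\<And>H H'. H \<in> good \<Longrightarrow> H \<in> hypergraphs n d \<Longrightarrow> H' \<in> hypergraphs n d \<Longrightarrow> Proj n H' = Proj n H \<Longrightarrow> card H' \<le> card H \<Longrightarrow> H' = H"
  shows "measure_pmf.prob (random_hypergraph n d p) good \<le> exact_recovery_prob n d p"
proof -
  define pre where "pre G H \<longleftrightarrow> H \<in> hypergraphs n d \<and> Proj n H = G" for G H
  define A where "A = (\<lambda>G\<in>Proj n ` hypergraphs n d. arg_min card (pre G))"
  have pre: "pre G (arg_min card (pre G))" "pre G H \<Longrightarrow> card (arg_min card (pre G)) \<le> card H"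
    if "G \<in> Proj n ` hypergraphs n d" for G H
  proof -
    have "\<exists>H0. pre G H0" using that by (auto simp: pre_def)
    then obtain H0 where "pre G H0" ..
    then show "pre G (arg_min card (pre G))" by (rule arg_min_natI)
    show "pre G H \<Longrightarrow> card (arg_min card (pre G)) \<le> card H" by (rule arg_min_nat_le)
  qed
  have "A \<in> estimators n d" using pre(1) by (auto simp: A_def estimators_def pre_def)
  have "measure_pmf.prob (random_hypergraph n d p) good \<le> recovery_prob n d p A"
    unfolding recovery_prob_def
  proof (rule measure_pmf.finite_measure_mono_AE)
    show "AE H in random_hypergraph n d p. H \<in> good \<longrightarrow> H \<in> {H. A (Proj n H) = H}"
    proof (rule AE_pmfI, intro impI)
      fix H assume "H \<in> set_pmf (random_hypergraph n d p)" "H \<in> good"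
      then have H: "H \<in> hypergraphs n d" "H \<in> good" using set_pmf_random_hypergraph by auto
      then have "Proj n H \<in> Proj n ` hypergraphs n d" by simp
      from pre(1)[OF this] pre(2)[OF this, of H] have "A (Proj n H) = H"
        using H assms[OF H(2,1)] by (auto simp: A_def pre_def)
      then show "H \<in> {H. A (Proj n H) = H}" by simp
    qed
  qed auto
  also have "\<dots> \<le> exact_recovery_prob n d p" by (rule recovery_prob_le_exact_recovery_prob) fact
  finally show ?thesis .
qed

text \<open>Halving the gap a - \<theta> serves both sides: the slack \<eta> > 0 makes the
  deterministic argument bounded, and \<theta> + \<eta> < a makes the probability of a dense bounded
  subhypergraph vanish.\<close>

theorem exact_recovery_possible:
  fixes p :: "nat \<Rightarrow> real"
  assumes weights: "discharge_weights d \<theta> \<kappa> \<omega> \<rho> \<gamma>" and a: "\<theta> < a"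
    and p: "\<forall>\<^sub>F n in sequentially. 0 \<le> p n \<and> p n \<le> 1 \<and> p n \<le> C * real n powr (- a)"
  shows "(\<lambda>n. exact_recovery_prob n d (p n)) \<longlonglongrightarrow> 1"
proof -
  interpret discharge_weights d \<theta> \<kappa> \<omega> \<rho> \<gamma> by (rule weights)
  define \<eta> where "\<eta> = (a - \<theta>) / 2"
  have \<eta>: "0 < \<eta>" "\<theta> + \<eta> < a" using a by (auto simp: \<eta>_def field_simps)
  obtain L :: nat where L: "(real d - \<theta>) / \<eta> + real d * real d \<le> real L" using real_arch_simple by blast
  define B where "B = real (d * L + 1) * 2 ^ 2 ^ (d * L) * max 1 C ^ L"
  define bad where "bad = {H :: nat set set. \<exists>K\<subseteq>H. card K \<le> L \<and> real (card (\<Union>K)) < (\<theta> + \<eta>) * real (card K)}"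
  have lower: "\<forall>\<^sub>F n in sequentially. 1 - B * real n powr (\<theta> + \<eta> - a) \<le> exact_recovery_prob n d (p n)"
    using p eventually_ge_at_top[of 1]
  proof eventually_elim
    case (elim n)
    have "C * real n powr (- a) \<le> max 1 C * real n powr (- a)" by (intro mult_right_mono) auto
    then have "p n \<le> max 1 C * real n powr (- a)" using elim by linarith
    then have "measure_pmf.prob (random_hypergraph n d (p n)) bad \<le> B * real n powr (\<theta> + \<eta> - a)"
      unfolding bad_def B_def using elim \<eta> by (intro prob_dense_subhypergraph_le) auto
    moreover have "measure_pmf.prob (random_hypergraph n d (p n)) (- bad) = 1 - measure_pmf.prob (random_hypergraph n d (p n)) bad"
      using measure_pmf.prob_compl[of bad "random_hypergraph n d (p n)"] by (simp add: Compl_eq_Diff_UNIV)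
    moreover have "measure_pmf.prob (random_hypergraph n d (p n)) (- bad) \<le> exact_recovery_prob n d (p n)"
    proof (rule prob_unique_smallest_le_exact_recovery)
      fix H H' assume H: "H \<in> - bad" "H \<in> hypergraphs n d" "H' \<in> hypergraphs n d" "Proj n H' = Proj n H" "card H' \<le> card H"
      have sub: "H \<subseteq> d_subsets n d" "H' \<subseteq> d_subsets n d" using H by (auto simp: hypergraphs_def)
      interpret exchange_pair d \<theta> \<kappa> \<omega> \<rho> \<gamma> H H' \<eta> L
      proof
        show "finite H" "finite H'" using sub finite_d_subsets finite_subset by blast+
        show "card h = d" if "h \<in> H" for h using that sub by (auto simp: d_subsets_def)
        show "card h = d" if "h \<in> H'" for h using that sub by (auto simp: d_subsets_def)
        show "(\<theta> + \<eta>) * real (card K) \<le> real (card (\<Union>K))" if "K \<subseteq> H" "card K \<le> L" for K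
          using H(1) that by (force simp: bad_def not_less)
        show "edges H = edges H'" using H(4) Proj_eq_edges sub by simp
      qed (use \<eta> L in auto)
      show "H' = H" by (rule unique_smallest_preimage) (rule H)
    qed
    ultimately show ?case by linarith
  qed
  have "(\<lambda>n. real n powr (\<theta> + \<eta> - a)) \<longlonglongrightarrow> 0"
    by (rule tendsto_neg_powr) (use \<eta> filterlim_real_sequentially in auto)
  then have "(\<lambda>n. 1 - B * real n powr (\<theta> + \<eta> - a)) \<longlonglongrightarrow> 1 - B * 0"
    by (intro tendsto_intros)
  then have "(\<lambda>n. 1 - B * real n powr (\<theta> + \<eta> - a)) \<longlonglongrightarrow> 1" by simp
  then show ?thesis
    using tendsto_sandwich[OF lower always_eventually _ tendsto_const] exact_recovery_prob_le_1 by blast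
qed

section \<open>Counting projections\<close>

text \<open>Exponential weights: each counted G satisfies x^M <= x^|G|, and the sum of x^|G| over
  all subsets of E is (1 + x)^|E|. The parameter x will be the edge density of the projection up to
  constants.\<close>

lemma card_small_subsets_le:
  fixes x M :: real
  assumes "finite E" "0 < x" "x \<le> 1"
  shows "real (card {G. G \<subseteq> E \<and> real (card G) \<le> M}) \<le> exp (x * real (card E)) * x powr (- M)"
proof -
  have "real (card {G. G \<subseteq> E \<and> real (card G) \<le> M}) * x powr M = (\<Sum>G\<in>{G. G \<subseteq> E \<and> real (card G) \<le> M}. x powr M)"
    by simp
  also have "\<dots> \<le> (\<Sum>G\<in>{G. G \<subseteq> E \<and> real (card G) \<le> M}. x ^ card G)"
  proof (rule sum_mono)
    fix G assume "G \<in> {G. G \<subseteq> E \<and> real (card G) \<le> M}"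
    then have "x powr M \<le> x powr real (card G)" using assms by (intro powr_mono') auto
    then show "x powr M \<le> x ^ card G" using assms by (simp add: powr_realpow)
  qed
  also have "\<dots> \<le> (\<Sum>G\<in>Pow E. x ^ card G)"
    using assms by (intro sum_mono2) auto
  also have "\<dots> = (\<Sum>G\<in>Pow E. (\<Prod>e\<in>G. x) * (\<Prod>e\<in>E - G. 1))" by simp
  also have "\<dots> = (\<Prod>e\<in>E. x + 1)" by (rule prod_add[OF assms(1), symmetric])
  also have "\<dots> = (1 + x) ^ card E" by (simp add: add.commute)
  also have "\<dots> \<le> exp x ^ card E" using assms by (intro power_mono exp_ge_add_one_self) auto
  also have "\<dots> = exp (x * real (card E))" by (simp add: exp_of_nat_mult[symmetric] mult.commute)
  finally show ?thesis using assms by (simp add: powr_minus field_simps)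
qed

text \<open>The case of singletons \<open>{h}\<close>: the off-diagonal terms of the second moment
  are at most the squared mean, so the variance is at most the mean.\<close>

lemma prob_card_deviation:
  assumes p: "0 \<le> p" "p \<le> 1" and t: "0 < t"
  shows "measure_pmf.prob (random_hypergraph n d p) {H. t \<le> \<bar>real (card H) - real (n choose d) * p\<bar>}
    \<le> real (n choose d) * p / t\<^sup>2"
proof -
  let ?D = "d_subsets n d" and ?N = "real (n choose d)"
  have "measure_pmf.prob (random_hypergraph n d p) {H. t \<le> \<bar>real (card H) - ?N * p\<bar>}
     = measure_pmf.prob (random_hypergraph n d p) {H. t \<le> \<bar>real (card {h \<in> ?D. {h} \<subseteq> H}) - (\<Sum>h\<in>?D. p ^ card {h})\<bar>}"
  proof (rule measure_pmf.finite_measure_eq_AE)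
    show "AE H in random_hypergraph n d p. (H \<in> {H. t \<le> \<bar>real (card H) - ?N * p\<bar>}) =
      (H \<in> {H. t \<le> \<bar>real (card {h \<in> ?D. {h} \<subseteq> H}) - (\<Sum>h\<in>?D. p ^ card {h})\<bar>})"
    proof (rule AE_pmfI)
      fix H assume "H \<in> set_pmf (random_hypergraph n d p)"
      then have "H \<in> hypergraphs n d" using set_pmf_random_hypergraph[of n d p] by auto
      then have "H \<subseteq> ?D" by (simp add: hypergraphs_def)
      then have "{h \<in> ?D. {h} \<subseteq> H} = H" by auto
      then show "(H \<in> {H. t \<le> \<bar>real (card H) - ?N * p\<bar>}) =
        (H \<in> {H. t \<le> \<bar>real (card {h \<in> ?D. {h} \<subseteq> H}) - (\<Sum>h\<in>?D. p ^ card {h})\<bar>})"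
        by (simp add: card_d_subsets)
    qed
  qed auto
  also have "\<dots> \<le> ((\<Sum>h\<in>?D. \<Sum>h'\<in>?D. p ^ card ({h} \<union> {h'})) - (\<Sum>h\<in>?D. p ^ card {h})\<^sup>2) / t\<^sup>2"
    by (rule prob_count_deviation[OF p finite_d_subsets _ t]) auto
  also have "\<dots> \<le> ?N * p / t\<^sup>2"
  proof (rule divide_right_mono)
    have "(\<Sum>h\<in>?D. \<Sum>h'\<in>?D. p ^ card ({h} \<union> {h'})) \<le> (\<Sum>h\<in>?D. p + ?N * p\<^sup>2)"
    proof (rule sum_mono)
      fix h assume h: "h \<in> ?D"
      have "(\<Sum>h'\<in>?D. p ^ card ({h} \<union> {h'})) = p + (\<Sum>h'\<in>?D - {h}. p ^ card ({h} \<union> {h'}))"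
        using h by (subst sum.remove[OF finite_d_subsets h]) simp
      also have "(\<Sum>h'\<in>?D - {h}. p ^ card ({h} \<union> {h'})) = (\<Sum>h'\<in>?D - {h}. p\<^sup>2)"
        by (intro sum.cong refl) (auto simp: power2_eq_square)
      also have "\<dots> \<le> (\<Sum>h'\<in>?D. p\<^sup>2)" by (intro sum_mono2 finite_d_subsets) auto
      also have "\<dots> = ?N * p\<^sup>2" by (simp add: card_d_subsets)
      finally show "(\<Sum>h'\<in>?D. p ^ card ({h} \<union> {h'})) \<le> p + ?N * p\<^sup>2" by simp
    qed
    also have "\<dots> = ?N * p + (?N * p)\<^sup>2" by (simp add: card_d_subsets power2_eq_square algebra_simps)
    finally show "(\<Sum>h\<in>?D. \<Sum>h'\<in>?D. p ^ card ({h} \<union> {h'})) - (\<Sum>h\<in>?D. p ^ card {h})\<^sup>2 \<le> ?N * p"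
      by (simp add: card_d_subsets)
  qed auto
  finally show ?thesis .
qed

lemma card_edges_le:
  assumes "finite H" "\<And>h. h \<in> H \<Longrightarrow> card h = d" "0 < d"
  shows "card (edges H) \<le> card H * (d choose 2)"
proof -
  have f: "finite h" if "h \<in> H" for h using assms(2)[OF that] assms(3) by (intro card_ge_0_finite) simp
  have "edges H = (\<Union>h\<in>H. edges {h})" by (auto simp: edges_def)
  then have "card (edges H) \<le> (\<Sum>h\<in>H. card (edges {h}))" using card_UN_le[OF assms(1)] by metis
  also have "\<dots> = (\<Sum>h\<in>H. d choose 2)"
    using f assms(2) by (intro sum.cong refl) (simp add: card_edges_singleton)
  finally show ?thesis by simp
qed

text \<open>On the hypergraphs that A recovers, \<open>Proj n\<close> is injective because A inverts
  it. Those of typical size have projections with few edges, which limits their number, and each has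
  probability at most p powr (\<mu> - t).\<close>

lemma recovery_prob_counting:
  fixes n d :: nat and p x t :: real
  assumes p: "0 < p" "p \<le> 1" and x: "0 < x" "x \<le> 1" and t: "0 < t" and d: "0 < d"
  defines "\<mu> \<equiv> real (n choose d) * p"
  shows "recovery_prob n d p A \<le> \<mu> / t\<^sup>2
     + exp (x * real (n choose 2)) * x powr (- (real (d choose 2) * (\<mu> + t))) * p powr (\<mu> - t)"
proof -
  let ?M = "random_hypergraph n d p" and ?E = "d_subsets n 2"
  define T where "T = {H \<in> hypergraphs n d. A (Proj n H) = H \<and> \<bar>real (card H) - \<mu>\<bar> < t}"
  have finT: "finite T" unfolding T_def using finite_hypergraphs by simp
  have "recovery_prob n d p A \<le> measure_pmf.prob ?M ({H. t \<le> \<bar>real (card H) - \<mu>\<bar>} \<union> T)"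
    unfolding recovery_prob_def
  proof (rule measure_pmf.finite_measure_mono_AE)
    show "AE H in ?M. H \<in> {H. A (Proj n H) = H} \<longrightarrow> H \<in> {H. t \<le> \<bar>real (card H) - \<mu>\<bar>} \<union> T"
      using set_pmf_random_hypergraph[of n d p] by (intro AE_pmfI) (auto simp: T_def)
  qed auto
  also have "\<dots> \<le> measure_pmf.prob ?M {H. t \<le> \<bar>real (card H) - \<mu>\<bar>} + measure_pmf.prob ?M T"
    by (rule measure_Un_le) auto
  also have "measure_pmf.prob ?M {H. t \<le> \<bar>real (card H) - \<mu>\<bar>} \<le> \<mu> / t\<^sup>2"
    unfolding \<mu>_def by (rule prob_card_deviation) (use p t in auto)
  also have "measure_pmf.prob ?M T = (\<Sum>H\<in>T. pmf ?M H)"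
    by (rule measure_measure_pmf_finite[OF finT])
  also have "\<dots> \<le> (\<Sum>H\<in>T. p powr (\<mu> - t))"
  proof (rule sum_mono)
    fix H assume H: "H \<in> T"
    then have "pmf ?M H = p ^ card H * (1 - p) ^ ((n choose d) - card H)"
      using p by (intro pmf_random_hypergraph) (auto simp: T_def)
    also have "\<dots> \<le> p ^ card H * 1" using p by (intro mult_left_mono power_le_one) auto
    also have "\<dots> = p powr real (card H)" using p by (simp add: powr_realpow)
    also have "\<dots> \<le> p powr (\<mu> - t)" using H p by (intro powr_mono') (auto simp: T_def)
    finally show "pmf ?M H \<le> p powr (\<mu> - t)" .
  qed
  also have "\<dots> = real (card T) * p powr (\<mu> - t)" by simp
  also have "\<dots> \<le> exp (x * real (n choose 2)) * x powr (- (real (d choose 2) * (\<mu> + t))) * p powr (\<mu> - t)"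
  proof (rule mult_right_mono)
    have "inj_on (Proj n) T" by (rule inj_on_inverseI[of _ A]) (simp add: T_def)
    then have "card T = card (Proj n ` T)" by (simp add: card_image)
    also have "\<dots> \<le> card {G. G \<subseteq> ?E \<and> real (card G) \<le> real (d choose 2) * (\<mu> + t)}"
    proof (rule card_mono)
      show "finite {G. G \<subseteq> ?E \<and> real (card G) \<le> real (d choose 2) * (\<mu> + t)}" using finite_d_subsets by simp
      show "Proj n ` T \<subseteq> {G. G \<subseteq> ?E \<and> real (card G) \<le> real (d choose 2) * (\<mu> + t)}"
      proof
        fix G assume "G \<in> Proj n ` T"
        then obtain H where H: "H \<in> T" "G = Proj n H" by auto
        then have sub: "H \<subseteq> d_subsets n d" and c: "real (card H) \<le> \<mu> + t" by (auto simp: T_def hypergraphs_def)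
        have G: "G = edges H" using H(2) Proj_eq_edges[OF sub] by simp
        have finH: "finite H" using sub finite_d_subsets finite_subset by blast
        have "card G \<le> card H * (d choose 2)"
          unfolding G by (rule card_edges_le[OF finH _ d]) (use sub in \<open>auto simp: d_subsets_def\<close>)
        then have "real (card G) \<le> real (card H) * real (d choose 2)" by (metis of_nat_le_iff of_nat_mult)
        also have "\<dots> \<le> (\<mu> + t) * real (d choose 2)" using c by (intro mult_right_mono) auto
        finally have "real (card G) \<le> real (d choose 2) * (\<mu> + t)" by (simp add: mult.commute)
        moreover have "G \<subseteq> ?E" unfolding G using sub by (fastforce simp: edges_def d_subsets_def)
        ultimately show "G \<in> {G. G \<subseteq> ?E \<and> real (card G) \<le> real (d choose 2) * (\<mu> + t)}" by simp
      qed
    qed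
    finally have "real (card T) \<le> real (card {G. G \<subseteq> ?E \<and> real (card G) \<le> real (d choose 2) * (\<mu> + t)})" by simp
    also have "\<dots> \<le> exp (x * real (card ?E)) * x powr (- (real (d choose 2) * (\<mu> + t)))"
      by (rule card_small_subsets_le[OF finite_d_subsets x])
    finally show "real (card T) \<le> exp (x * real (n choose 2)) * x powr (- (real (d choose 2) * (\<mu> + t)))"
      by (simp add: card_d_subsets)
  qed auto
  finally show ?thesis by simp
qed

theorem exact_recovery_impossible_by_counting:
  fixes p :: "nat \<Rightarrow> real"
  assumes d: "3 \<le> d" and \<delta>: "(real d - 1) / (real d + 1) < \<delta>" "\<delta> < real d - 1"
    and c: "0 < c" and C: "1 \<le> C"
    and p: "\<forall>\<^sub>F n in sequentially. c * real n powr (- (real d - 1 - \<delta>)) \<le> p n \<and> p n \<le> C * real n powr (- (real d - 1 - \<delta>)) \<and> p n \<le> 1"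
  shows "(\<lambda>n. exact_recovery_prob n d (p n)) \<longlonglongrightarrow> 0"
proof -
  define a where "a = real d - 1 - \<delta>"
  \<comment> \<open>The projection has order n^(1 + \<delta>) pairs out of order n^2, so n powr (-
    \<alpha>) is its density; from \<delta> = 1 on it is capped at 1.\<close>
  define \<alpha> where "\<alpha> = max 0 (1 - \<delta>)"
  define D where "D = real (d choose 2)"
  have a: "0 < a" using \<delta> by (simp add: a_def)
  have D: "0 < D" using d by (simp add: D_def)
  have \<alpha>: "0 \<le> \<alpha>" "\<alpha> \<ge> 1 - \<delta>" by (simp_all add: \<alpha>_def)
  \<comment> \<open>For \<delta> < 1 this compares the choice per hyperedge with its cost.
    Multiplied out, D * (1 - \<delta>) < d - 1 - \<delta> is the hypothesis on \<delta> times d -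
    2.\<close>
  have Da: "D * \<alpha> < a"
  proof (cases "1 \<le> \<delta>")
    case True then show ?thesis using a by (simp add: \<alpha>_def)
  next
    case False
    have "real d - 1 < \<delta> * (real d + 1)" using \<delta>(1) by (simp add: pos_divide_less_eq)
    then have "(real d - 2) * (real d - 1) < (real d - 2) * (\<delta> * (real d + 1))" using d by (intro mult_strict_left_mono) auto
    then have "real d * (real d - 1) * (1 - \<delta>) < 2 * (real d - 1 - \<delta>)" by (simp add: algebra_simps)
    then have "real d * (real d - 1) * (1 - \<delta>) / 2 < real d - 1 - \<delta>"
      by (subst pos_divide_less_eq) (simp_all add: mult.commute)
    then show ?thesis using False by (simp add: \<alpha>_def a_def D_def real_choose_two)
  qed
  \<comment> \<open>\<eta> is the relative deviation allowed for the number of hyperedges, chosen so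
    that half of the gap a - D * \<alpha>, namely \<beta>, survives it.\<close>
  define \<eta> where "\<eta> = (a - D * \<alpha>) / (2 * (a + D * \<alpha>))"
  define \<beta> where "\<beta> = (a - D * \<alpha>) / 2"
  have aD: "0 < a + D * \<alpha>" using a D \<alpha> by (simp add: add_pos_nonneg)
  have \<eta>: "0 < \<eta>" "\<eta> \<le> 1" using Da aD D \<alpha> by (auto simp: \<eta>_def field_simps)
  have \<beta>: "0 < \<beta>" using Da by (simp add: \<beta>_def)
  have \<beta>_eq: "(1 - \<eta>) * a - D * (1 + \<eta>) * \<alpha> = \<beta>"
  proof -
    have "x / (2 * y) * y = x / 2" if "0 < y" for x y :: real using that by simp
    from this[OF aD] have "\<eta> * (a + D * \<alpha>) = \<beta>" unfolding \<eta>_def \<beta>_def .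
    then show ?thesis by (simp add: \<beta>_def algebra_simps)
  qed
  define \<mu> where "\<mu> n = real (n choose d) * p n" for n
  \<comment> \<open>From the bound (n choose d) >= (n / d)^d.\<close>
  define c0 where "c0 = c / real d ^ d"
  have c0: "0 < c0" using c d by (simp add: c0_def)
  have \<delta>pos: "0 < \<delta>" using \<delta>(1) d by (smt (verit) divide_nonneg_nonneg of_nat_0_le_iff of_nat_1 of_nat_le_iff one_le_numeral order_trans)
  have \<mu>: "\<forall>\<^sub>F n in sequentially. c0 * real n powr (1 + \<delta>) \<le> \<mu> n"
    using p eventually_ge_at_top[of d]
  proof eventually_elim
    case (elim n)
    have n: "0 < real n" using elim d by simp
    have "real n powr (1 + \<delta>) = real n ^ d * real n powr (- (real d - 1 - \<delta>))"
      using n by (simp add: powr_add[symmetric] powr_realpow[symmetric] add.commute)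
    then have "c0 * real n powr (1 + \<delta>) = (real n / real d) ^ d * (c * real n powr (- (real d - 1 - \<delta>)))"
      by (simp add: c0_def power_divide)
    also have "\<dots> \<le> real (n choose d) * p n"
      using elim binomial_ge_n_over_k_pow_k[of d n, where 'a = real] c by (intro mult_mono) auto
    finally show ?case by (simp add: \<mu>_def)
  qed
  have lim: "filterlim (\<lambda>n. c0 * real n powr (1 + \<delta>)) at_top sequentially"
    using c0 \<delta>pos by real_asymp
  have \<mu>_lim: "filterlim \<mu> at_top sequentially" by (rule filterlim_at_top_mono[OF lim \<mu>])
  \<comment> \<open>Eventually \<beta> * ln n absorbs what is only a constant multiple of \<mu>: |ln
    C| from the upper bound on p, 1 / c0 from the factor exp(x * (n choose 2)), and 1 for the final
    decay.\<close>
  have ln_lim: "\<forall>\<^sub>F n in sequentially. (\<bar>ln C\<bar> + 1 / c0 + 1) / \<beta> \<le> ln (real n)"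
    using filterlim_compose[OF ln_at_top filterlim_real_sequentially] by (simp add: filterlim_at_top)
  have bound: "\<forall>\<^sub>F n in sequentially. exact_recovery_prob n d (p n) \<le> 1 / (\<eta>\<^sup>2 * \<mu> n) + exp (- \<mu> n)"
    using p \<mu> ln_lim eventually_ge_at_top[of 1]
  proof eventually_elim
    case (elim n)
    have n: "1 \<le> real n" using elim by simp
    have \<mu>pos: "0 < \<mu> n" using elim(2) c0 n by (smt (verit) mult_pos_pos powr_gt_zero)
    have ppos: "0 < p n" using elim(1) c n by (smt (verit) mult_pos_pos powr_gt_zero)
    let ?x = "real n powr (- \<alpha>)"
    have x: "0 < ?x" "?x \<le> 1" using n \<alpha> powr_mono[of "- \<alpha>" 0 "real n"] by auto
    obtain A where A: "exact_recovery_prob n d (p n) = recovery_prob n d (p n) A"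
      using exact_recovery_prob_attained by blast
    have "recovery_prob n d (p n) A \<le> \<mu> n / (\<eta> * \<mu> n)\<^sup>2 +
      exp (?x * real (n choose 2)) * ?x powr (- (D * (\<mu> n + \<eta> * \<mu> n))) * p n powr (\<mu> n - \<eta> * \<mu> n)"
      unfolding \<mu>_def D_def
      by (rule recovery_prob_counting) (use ppos elim x \<mu>pos \<eta> d in \<open>auto simp: \<mu>_def\<close>)
    also have "\<mu> n / (\<eta> * \<mu> n)\<^sup>2 = 1 / (\<eta>\<^sup>2 * \<mu> n)" using \<mu>pos \<eta> by (simp add: power2_eq_square)
    also have "exp (?x * real (n choose 2)) * ?x powr (- (D * (\<mu> n + \<eta> * \<mu> n))) * p n powr (\<mu> n - \<eta> * \<mu> n)
      = exp (?x * real (n choose 2) + \<alpha> * ln (real n) * (D * (1 + \<eta>) * \<mu> n) + (1 - \<eta>) * \<mu> n * ln (p n))"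
      using ppos n by (simp add: powr_def exp_add[symmetric] ln_powr algebra_simps)
    also have "\<dots> \<le> exp (- \<mu> n)"
    proof -
      have "?x * real (n choose 2) \<le> ?x * real n powr 2"
        using n by (intro mult_left_mono) (auto simp: real_choose_two powr_numeral power2_eq_square algebra_simps)
      also have "\<dots> = real n powr (2 - \<alpha>)" unfolding powr_add[symmetric] by simp
      also have "\<dots> \<le> real n powr (1 + \<delta>)" using n \<alpha> by (intro powr_mono) auto
      also have "\<dots> \<le> \<mu> n / c0" using elim(2) c0 by (simp add: field_simps)
      finally have e1: "?x * real (n choose 2) \<le> 1 / c0 * \<mu> n" by simp
      have "ln (p n) \<le> ln (C * real n powr (- (real d - 1 - \<delta>)))" using elim(1) ppos by (intro ln_mono) auto
      also have "\<dots> = ln C - a * ln (real n)" using C n by (simp add: ln_mult ln_powr a_def algebra_simps)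
      finally have "(1 - \<eta>) * \<mu> n * ln (p n) \<le> (1 - \<eta>) * \<mu> n * (ln C - a * ln (real n))"
        using \<eta> \<mu>pos by (intro mult_left_mono) auto
      also have "\<dots> = (1 - \<eta>) * \<mu> n * ln C - (1 - \<eta>) * \<mu> n * a * ln (real n)" by (simp add: right_diff_distrib)
      also have "(1 - \<eta>) * \<mu> n * ln C \<le> 1 * \<mu> n * \<bar>ln C\<bar>"
        using \<eta> \<mu>pos C by (intro mult_mono) auto
      finally have e2: "(1 - \<eta>) * \<mu> n * ln (p n) \<le> \<mu> n * \<bar>ln C\<bar> - (1 - \<eta>) * \<mu> n * a * ln (real n)" by simp
      have "\<alpha> * ln (real n) * (D * (1 + \<eta>) * \<mu> n) - (1 - \<eta>) * \<mu> n * a * ln (real n)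
        = - (((1 - \<eta>) * a - D * (1 + \<eta>) * \<alpha>) * (\<mu> n * ln (real n)))" by (simp add: algebra_simps)
      also have "\<dots> = - (\<mu> n * (\<beta> * ln (real n)))" unfolding \<beta>_eq by simp
      also have "\<dots> \<le> - (\<mu> n * (\<bar>ln C\<bar> + 1 / c0 + 1))"
      proof -
        have "\<bar>ln C\<bar> + 1 / c0 + 1 \<le> \<beta> * ln (real n)" using elim(3) \<beta> by (simp add: pos_divide_le_eq mult.commute)
        then have "\<mu> n * (\<bar>ln C\<bar> + 1 / c0 + 1) \<le> \<mu> n * (\<beta> * ln (real n))" using \<mu>pos by (intro mult_left_mono) auto
        then show ?thesis by simp
      qed
      finally have e3: "\<alpha> * ln (real n) * (D * (1 + \<eta>) * \<mu> n) - (1 - \<eta>) * \<mu> n * a * ln (real n)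
        \<le> - (\<mu> n * (\<bar>ln C\<bar> + 1 / c0 + 1))" .
      have "- (\<mu> n * (\<bar>ln C\<bar> + 1 / c0 + 1)) = - (\<mu> n * \<bar>ln C\<bar>) - 1 / c0 * \<mu> n - \<mu> n" by (simp add: algebra_simps)
      then show ?thesis using e1 e2 e3 by (subst exp_le_cancel_iff) linarith
    qed
    finally show ?case using A by simp
  qed
  have "(\<lambda>n. 1 / (\<eta>\<^sup>2 * \<mu> n) + exp (- \<mu> n)) \<longlonglongrightarrow> 0"
  proof -
    have "((\<lambda>m. 1 / (\<eta>\<^sup>2 * m) + exp (- m)) \<longlongrightarrow> 0) at_top" using \<eta>(1) by real_asymp
    then show ?thesis by (rule filterlim_compose[OF _ \<mu>_lim])
  qed
  moreover have "0 \<le> exact_recovery_prob n d (p n)" for n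
    using exact_recovery_prob_attained[of n d "p n"] by (auto simp: recovery_prob_def)
  ultimately show ?thesis
    by (intro tendsto_sandwich[OF _ bound tendsto_const]) auto
qed

section \<open>Copies of a fixed pattern\<close>

lemma card_pinned_PiE:
  assumes "finite U" "W \<subseteq> U" "\<phi> \<in> PiE U V" "\<And>u. u \<in> U \<Longrightarrow> card (V u) = m"
  shows "card {\<psi> \<in> PiE U V. \<forall>u\<in>W. \<psi> u = \<phi> u} = m ^ (card U - card W)"
proof -
  have "{\<psi> \<in> PiE U V. \<forall>u\<in>W. \<psi> u = \<phi> u} = PiE U (\<lambda>u. if u \<in> W then {\<phi> u} else V u)"
  proof (intro set_eqI iffI)
    fix \<psi> assume "\<psi> \<in> {\<psi> \<in> PiE U V. \<forall>u\<in>W. \<psi> u = \<phi> u}"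
    then show "\<psi> \<in> PiE U (\<lambda>u. if u \<in> W then {\<phi> u} else V u)" by (auto simp: PiE_iff)
  next
    fix \<psi> assume \<psi>: "\<psi> \<in> PiE U (\<lambda>u. if u \<in> W then {\<phi> u} else V u)"
    have eq: "\<psi> u = \<phi> u" if "u \<in> W" for u using \<psi> that assms(2) by (auto simp: PiE_iff split: if_splits)
    have "\<psi> u \<in> V u" if u: "u \<in> U" for u
    proof (cases "u \<in> W")
      case True then show ?thesis using eq assms(3) u by (auto simp: PiE_iff)
    next
      case False then show ?thesis using \<psi> u by (auto simp: PiE_iff split: if_splits)
    qed
    then show "\<psi> \<in> {\<psi> \<in> PiE U V. \<forall>u\<in>W. \<psi> u = \<phi> u}" using eq \<psi> by (auto simp: PiE_iff)
  qed
  also have "card \<dots> = (\<Prod>u\<in>U. if u \<in> W then 1 else m)"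
    unfolding card_PiE[OF assms(1)] using assms(4) by (intro prod.cong) auto
  also have "\<dots> = (\<Prod>u\<in>U - W. m)"
    using assms(1,2) by (intro prod.mono_neutral_cong_right) auto
  also have "\<dots> = m ^ (card U - card W)"
    using assms(1,2) by (simp add: card_Diff_subset finite_subset)
  finally show ?thesis .
qed

definition has_copy :: "'v set set \<Rightarrow> nat set set \<Rightarrow> bool" where
  "has_copy F H \<longleftrightarrow> (\<exists>\<phi>. inj_on \<phi> (\<Union>F) \<and> (\<forall>h\<in>F. \<phi> ` h \<in> H))"

text \<open>
  The pattern is looked for with its vertices in prescribed disjoint parts of \<open>{1..n}\<close>. Two placements
  then share exactly the images of the sets on which they agree, which makes the second moment explicit.
\<close>

lemma prob_no_copy_le:
  fixes F :: "'v set set"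
  assumes p: "0 < p" "p \<le> 1" and F: "finite F" "\<And>h. h \<in> F \<Longrightarrow> card h = d" and d: "0 < d"
    and m: "m = n div card (\<Union>F)" "0 < m"
  shows "measure_pmf.prob (random_hypergraph n d p) {H. \<not> has_copy F H}
    \<le> (\<Sum>J\<in>Pow F - {{}}. 1 / (real m ^ card (\<Union>J) * p ^ card J))"
proof -
  define U where "U = \<Union>F"
  define f where "f = card F"
  have finh: "finite h" if "h \<in> F" for h using F(2)[OF that] d by (intro card_ge_0_finite) simp
  have finU: "finite U" using finh F by (auto simp: U_def)
  have hU: "h \<subseteq> U" if "h \<in> F" for h using that by (auto simp: U_def)
  obtain e where e: "bij_betw e U {0..<card U}" using ex_bij_betw_finite_nat[OF finU] by blast
  define V where "V u = {e u * m + 1..e u * m + m}" for u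
  have cV: "card (V u) = m" for u by (simp add: V_def)
  have V_n: "V u \<subseteq> {1..n}" if "u \<in> U" for u
  proof -
    have "e u < card U" using e that by (auto simp: bij_betw_def)
    then have "(e u + 1) * m \<le> card U * m" by (intro mult_right_mono) auto
    also have "\<dots> \<le> n" using m by (simp add: U_def)
    finally show ?thesis by (auto simp: V_def)
  qed
  have V_disj: "u = u'" if u: "u \<in> U" "u' \<in> U" "x \<in> V u" "x \<in> V u'" for u u' x
  proof -
    \<comment> \<open>Block number \<open>e w\<close> starts at \<open>e w * m + 1\<close>, so 1 is
      subtracted before dividing.\<close>
    have "e w = (x - 1) div m" if "x \<in> V w" for w
    proof -
      have "x - 1 = e w * m + (x - 1 - e w * m)" "x - 1 - e w * m < m" using that by (auto simp: V_def)
      then show ?thesis by (metis add.commute add.right_neutral div_less div_mult_self1 m(2) mult.commute neq0_conv)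
    qed
    then have "e u = e u'" using u by metis
    then show ?thesis using e u by (auto simp: bij_betw_def inj_on_def)
  qed
  define \<Phi> where "\<Phi> = PiE U V"
  have fin\<Phi>: "finite \<Phi>" unfolding \<Phi>_def by (intro finite_PiE finU) (simp add: V_def)
  have c\<Phi>: "card \<Phi> = m ^ card U" unfolding \<Phi>_def card_PiE[OF finU] by (simp add: cV)
  define A where "A \<phi> = (\<lambda>h. \<phi> ` h) ` F" for \<phi> :: "'v \<Rightarrow> nat"
  have same: "h = h' \<and> (\<forall>u\<in>h. \<phi> u = \<psi> u)"
    if \<phi>: "\<phi> \<in> \<Phi>" "\<psi> \<in> \<Phi>" "h \<in> F" "h' \<in> F" "\<phi> ` h = \<psi> ` h'" for \<phi> \<psi> h h'
  proof -
    have V1: "\<phi> u \<in> V u" "\<psi> u \<in> V u" if "u \<in> U" for u using \<phi> that by (auto simp: \<Phi>_def)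
    have 1: "u \<in> h' \<and> \<phi> u = \<psi> u" if u: "u \<in> h" for u
    proof -
      obtain u' where u': "u' \<in> h'" "\<phi> u = \<psi> u'" using \<phi>(5) u by blast
      then have "u = u'" using V_disj[of u u' "\<phi> u"] V1 hU \<phi> u by (metis subsetD)
      then show ?thesis using u' by simp
    qed
    have 2: "u \<in> h" if u: "u \<in> h'" for u
    proof -
      obtain u' where u': "u' \<in> h" "\<psi> u = \<phi> u'" using \<phi>(5) u by (metis image_iff)
      then have "u = u'" using V_disj[of u u' "\<psi> u"] V1 hU \<phi> u by (metis subsetD)
      then show ?thesis using u' by simp
    qed
    show ?thesis using 1 2 by blast
  qed
  have inj\<phi>: "inj_on \<phi> U" if "\<phi> \<in> \<Phi>" for \<phi>
  proof (rule inj_onI)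
    fix u u' assume u: "u \<in> U" "u' \<in> U" "\<phi> u = \<phi> u'"
    have "\<phi> u \<in> V u" using that u(1) unfolding \<Phi>_def by (rule PiE_mem)
    moreover have "\<phi> u' \<in> V u'" using that u(2) unfolding \<Phi>_def by (rule PiE_mem)
    ultimately show "u = u'" using V_disj[of u u' "\<phi> u"] u by simp
  qed
  have injA: "inj_on (\<lambda>h. \<phi> ` h) F" if "\<phi> \<in> \<Phi>" for \<phi>
    using same[OF that that] by (intro inj_onI) blast
  have cA: "card (A \<phi>) = f" if "\<phi> \<in> \<Phi>" for \<phi>
    unfolding A_def f_def by (rule card_image[OF injA[OF that]])
  have finA: "finite (A \<phi>)" for \<phi> using F by (simp add: A_def)
  have A_sub: "A \<phi> \<subseteq> d_subsets n d" if "\<phi> \<in> \<Phi>" for \<phi>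
  proof
    fix k assume "k \<in> A \<phi>"
    then obtain h where h: "h \<in> F" "k = \<phi> ` h" by (auto simp: A_def)
    have "card k = d" unfolding h(2) using F(2)[OF h(1)] inj_on_subset[OF inj\<phi>[OF that] hU[OF h(1)]] by (simp add: card_image)
    moreover have "k \<subseteq> {1..n}"
    proof
      fix x assume "x \<in> k"
      then obtain u where "u \<in> h" "x = \<phi> u" using h by auto
      then have u: "u \<in> U" using hU[OF h(1)] by blast
      then have "\<phi> u \<in> V u" using that unfolding \<Phi>_def by (rule PiE_mem[rotated])
      then show "x \<in> {1..n}" using V_n[OF u] \<open>x = \<phi> u\<close> by blast
    qed
    ultimately show "k \<in> d_subsets n d" by (simp add: d_subsets_def)
  qed
  define J where "J \<phi> \<psi> = {h \<in> F. \<forall>u\<in>h. \<phi> u = \<psi> u}" for \<phi> \<psi> :: "'v \<Rightarrow> nat"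
  have JF: "J \<phi> \<psi> \<subseteq> F" for \<phi> \<psi> by (auto simp: J_def)
  have cUn: "card (A \<phi> \<union> A \<psi>) = 2 * f - card (J \<phi> \<psi>)" if \<phi>: "\<phi> \<in> \<Phi>" "\<psi> \<in> \<Phi>" for \<phi> \<psi>
  proof -
    have "A \<phi> \<inter> A \<psi> = (\<lambda>h. \<phi> ` h) ` J \<phi> \<psi>"
    proof
      show "A \<phi> \<inter> A \<psi> \<subseteq> (\<lambda>h. \<phi> ` h) ` J \<phi> \<psi>"
      proof
        fix k assume "k \<in> A \<phi> \<inter> A \<psi>"
        then obtain h h' where h: "h \<in> F" "k = \<phi> ` h" "h' \<in> F" "k = \<psi> ` h'" by (auto simp: A_def)
        then have "\<forall>u\<in>h. \<phi> u = \<psi> u" using same[OF \<phi> h(1,3)] by metis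
        then have "h \<in> J \<phi> \<psi>" using h(1) by (simp add: J_def)
        then show "k \<in> (\<lambda>h. \<phi> ` h) ` J \<phi> \<psi>" unfolding h(2) by (rule imageI)
      qed
      show "(\<lambda>h. \<phi> ` h) ` J \<phi> \<psi> \<subseteq> A \<phi> \<inter> A \<psi>"
      proof
        fix k assume "k \<in> (\<lambda>h. \<phi> ` h) ` J \<phi> \<psi>"
        then obtain h where h: "h \<in> F" "\<forall>u\<in>h. \<phi> u = \<psi> u" "k = \<phi> ` h" by (auto simp: J_def)
        then have "k = \<psi> ` h" by auto
        then have "k \<in> A \<psi>" using h(1) by (simp add: A_def)
        moreover have "k \<in> A \<phi>" using h(1,3) by (simp add: A_def)
        ultimately show "k \<in> A \<phi> \<inter> A \<psi>" by simp
      qed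
    qed
    then have "card (A \<phi> \<inter> A \<psi>) = card (J \<phi> \<psi>)"
      using card_image[OF inj_on_subset[OF injA[OF \<phi>(1)] JF]] by simp
    then show ?thesis using card_Un_Int[OF finA finA, of \<phi> \<psi>] cA \<phi> by simp
  qed
  define E where "E = real m ^ card U * p ^ f"
  have E: "0 < E" using m p by (simp add: E_def)
  have EZ: "(\<Sum>\<phi>\<in>\<Phi>. p ^ card (A \<phi>)) = E" using cA by (simp add: E_def c\<Phi>)
  let ?M = "random_hypergraph n d p" and ?R = "\<Sum>J\<in>Pow F - {{}}. 1 / (real m ^ card (\<Union>J) * p ^ card J)"
  \<comment> \<open>Instead of the exact agreement family \<open>J \<phi> \<psi>\<close>, the bound
    adds a term for every nonempty J' on which the placements agree. With J' fixed, the placements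
    \<psi> can then be counted by \<open>card_pinned_PiE\<close>.\<close>
  have pair: "p ^ card (A \<phi> \<union> A \<psi>) \<le> p ^ (2 * f)
      + (\<Sum>J'\<in>Pow F - {{}}. if \<forall>u\<in>\<Union>J'. \<psi> u = \<phi> u then p ^ (2 * f - card J') else 0)"
    if \<phi>: "\<phi> \<in> \<Phi>" "\<psi> \<in> \<Phi>" for \<phi> \<psi>
  proof (cases "J \<phi> \<psi> = {}")
    case True
    have "0 \<le> (\<Sum>J'\<in>Pow F - {{}}. if \<forall>u\<in>\<Union>J'. \<psi> u = \<phi> u then p ^ (2 * f - card J') else 0)"
      by (rule sum_nonneg) (use p in simp)
    then show ?thesis using cUn[OF \<phi>] True by simp
  next
    case False
    have "(if \<forall>u\<in>\<Union>(J \<phi> \<psi>). \<psi> u = \<phi> u then p ^ (2 * f - card (J \<phi> \<psi>)) else 0)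
      \<le> (\<Sum>J'\<in>Pow F - {{}}. if \<forall>u\<in>\<Union>J'. \<psi> u = \<phi> u then p ^ (2 * f - card J') else 0)"
      using F False JF p by (intro member_le_sum) auto
    moreover have "\<forall>u\<in>\<Union>(J \<phi> \<psi>). \<psi> u = \<phi> u" by (auto simp: J_def)
    moreover have "0 \<le> p ^ (2 * f)" using p by simp
    ultimately show ?thesis unfolding cUn[OF \<phi>] by (smt (verit))
  qed
  have "(\<Sum>\<phi>\<in>\<Phi>. \<Sum>\<psi>\<in>\<Phi>. p ^ card (A \<phi> \<union> A \<psi>))
    \<le> (\<Sum>\<phi>\<in>\<Phi>. \<Sum>\<psi>\<in>\<Phi>. p ^ (2 * f)
      + (\<Sum>J'\<in>Pow F - {{}}. if \<forall>u\<in>\<Union>J'. \<psi> u = \<phi> u then p ^ (2 * f - card J') else 0))"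
    by (intro sum_mono pair)
  also have "\<dots> = E\<^sup>2 + (\<Sum>\<phi>\<in>\<Phi>. \<Sum>J'\<in>Pow F - {{}}. \<Sum>\<psi>\<in>\<Phi>. if \<forall>u\<in>\<Union>J'. \<psi> u = \<phi> u then p ^ (2 * f - card J') else 0)"
    unfolding sum.distrib
    by (intro arg_cong2[where f = "(+)"] sum.cong refl sum.swap)
      (simp add: c\<Phi> E_def power2_eq_square power_add mult_2)
  also have "(\<Sum>\<phi>\<in>\<Phi>. \<Sum>J'\<in>Pow F - {{}}. \<Sum>\<psi>\<in>\<Phi>. if \<forall>u\<in>\<Union>J'. \<psi> u = \<phi> u then p ^ (2 * f - card J') else 0)
     = (\<Sum>\<phi>\<in>\<Phi>. \<Sum>J'\<in>Pow F - {{}}. real m ^ (card U - card (\<Union>J')) * p ^ (2 * f - card J'))"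
  proof (intro sum.cong refl)
    fix \<phi> J' assume \<phi>: "\<phi> \<in> \<Phi>" and J': "J' \<in> Pow F - {{}}"
    have "(\<Sum>\<psi>\<in>\<Phi>. if \<forall>u\<in>\<Union>J'. \<psi> u = \<phi> u then p ^ (2 * f - card J') else 0)
      = real (card {\<psi> \<in> \<Phi>. \<forall>u\<in>\<Union>J'. \<psi> u = \<phi> u}) * p ^ (2 * f - card J')"
      using fin\<Phi> by (simp add: sum.inter_filter[symmetric] del: ball_simps)
    also have "card {\<psi> \<in> \<Phi>. \<forall>u\<in>\<Union>J'. \<psi> u = \<phi> u} = m ^ (card U - card (\<Union>J'))"
      unfolding \<Phi>_def by (rule card_pinned_PiE) (use finU J' \<phi> cV hU in \<open>auto simp: \<Phi>_def\<close>)
    finally show "(\<Sum>\<psi>\<in>\<Phi>. if \<forall>u\<in>\<Union>J'. \<psi> u = \<phi> u then p ^ (2 * f - card J') else 0)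
      = real m ^ (card U - card (\<Union>J')) * p ^ (2 * f - card J')" by simp
  qed
  also have "\<dots> = real m ^ card U * (\<Sum>J'\<in>Pow F - {{}}. real m ^ (card U - card (\<Union>J')) * p ^ (2 * f - card J'))"
    by (simp add: c\<Phi>)
  also have "\<dots> = E\<^sup>2 * ?R"
    unfolding sum_distrib_left
  proof (intro sum.cong refl)
    fix J' assume J': "J' \<in> Pow F - {{}}"
    have "card (\<Union>J') \<le> card U" using J' by (intro card_mono finU) (auto simp: U_def)
    then have m1: "real m ^ (card U - card (\<Union>J')) = real m ^ card U / real m ^ card (\<Union>J')"
      using m by (simp add: power_diff)
    have "card J' \<le> f" unfolding f_def using J' F by (intro card_mono) auto
    then have p1: "p ^ (2 * f - card J') = p ^ f * p ^ f / p ^ card J'"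
      using p by (simp add: power_diff mult_2 power_add)
    show "real m ^ card U * (real m ^ (card U - card (\<Union>J')) * p ^ (2 * f - card J')) =
      E\<^sup>2 * (1 / (real m ^ card (\<Union>J') * p ^ card J'))"
      unfolding m1 p1 by (simp add: E_def power2_eq_square)
  qed
  finally have second: "(\<Sum>\<phi>\<in>\<Phi>. \<Sum>\<psi>\<in>\<Phi>. p ^ card (A \<phi> \<union> A \<psi>)) - E\<^sup>2 \<le> E\<^sup>2 * ?R" by simp
  \<comment> \<open>Without a copy the count is 0 and deviates from its mean \<open>E\<close> by all
    of \<open>E\<close>.\<close>
  have "measure_pmf.prob ?M {H. \<not> has_copy F H}
    \<le> measure_pmf.prob ?M {H. E \<le> \<bar>real (card {\<phi> \<in> \<Phi>. A \<phi> \<subseteq> H}) - (\<Sum>\<phi>\<in>\<Phi>. p ^ card (A \<phi>))\<bar>}"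
  proof (rule measure_pmf.finite_measure_mono)
    show "{H. \<not> has_copy F H}
      \<subseteq> {H. E \<le> \<bar>real (card {\<phi> \<in> \<Phi>. A \<phi> \<subseteq> H}) - (\<Sum>\<phi>\<in>\<Phi>. p ^ card (A \<phi>))\<bar>}"
    proof
      fix H assume H: "H \<in> {H. \<not> has_copy F H}"
      have none: "{\<phi> \<in> \<Phi>. A \<phi> \<subseteq> H} = {}"
      proof (rule ccontr)
        assume "{\<phi> \<in> \<Phi>. A \<phi> \<subseteq> H} \<noteq> {}"
        then obtain \<phi> where "\<phi> \<in> \<Phi>" "A \<phi> \<subseteq> H" by blast
        then have "inj_on \<phi> (\<Union>F) \<and> (\<forall>h\<in>F. \<phi> ` h \<in> H)" using inj\<phi> by (auto simp: A_def U_def)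
        then show False using H by (auto simp: has_copy_def)
      qed
      show "H \<in> {H. E \<le> \<bar>real (card {\<phi> \<in> \<Phi>. A \<phi> \<subseteq> H}) - (\<Sum>\<phi>\<in>\<Phi>. p ^ card (A \<phi>))\<bar>}"
        unfolding mem_Collect_eq none EZ using E by simp
    qed
  qed simp
  also have "\<dots> \<le> ((\<Sum>\<phi>\<in>\<Phi>. \<Sum>\<psi>\<in>\<Phi>. p ^ card (A \<phi> \<union> A \<psi>)) - (\<Sum>\<phi>\<in>\<Phi>. p ^ card (A \<phi>))\<^sup>2) / E\<^sup>2"
    by (rule prob_count_deviation) (use p fin\<Phi> A_sub E in auto)
  also have "\<dots> \<le> E\<^sup>2 * ?R / E\<^sup>2"
    unfolding EZ by (rule divide_right_mono[OF second]) simp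
  also have "\<dots> = ?R" using E by simp
  finally show ?thesis .
qed

text \<open>The term of J in \<open>prob_no_copy_le\<close> is of order n^(a * |J| - |\<Union>J|),
  so balancedness of every nonempty subfamily, and not just of F, sends the sum to 0.\<close>

lemma copy_exists:
  fixes F :: "'v set set" and p :: "nat \<Rightarrow> real"
  assumes F: "finite F" "\<And>h. h \<in> F \<Longrightarrow> card h = d" and d: "0 < d" and Fne: "F \<noteq> {}"
    and balanced: "\<And>J. J \<subseteq> F \<Longrightarrow> J \<noteq> {} \<Longrightarrow> a * real (card J) < real (card (\<Union>J))"
    and c: "0 < c" and p: "\<forall>\<^sub>F n in sequentially. c * real n powr (- a) \<le> p n \<and> p n \<le> 1"
  shows "(\<lambda>n. measure_pmf.prob (random_hypergraph n d (p n)) {H. \<not> has_copy F H}) \<longlonglongrightarrow> 0"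
proof -
  define v where "v = card (\<Union>F)"
  have "card (\<Union>F) \<noteq> 0" using balanced[of F] balanced[of "{h}" for h] F Fne d
    by (metis Union_upper card_gt_0_iff card_seteq card_0_eq finite_Union ex_in_conv le_zero_eq neq0_conv subset_empty)
  then have v: "0 < v" by (simp add: v_def)
  define B where "B J n = (1 / (2 * real v)) ^ card (\<Union>J) * c ^ card J * real n powr (real (card (\<Union>J)) - a * real (card J))"
    for J :: "'v set set" and n :: nat
  have bound: "\<forall>\<^sub>F n in sequentially. measure_pmf.prob (random_hypergraph n d (p n)) {H. \<not> has_copy F H}
    \<le> (\<Sum>J\<in>Pow F - {{}}. 1 / B J n)"
    using p eventually_ge_at_top[of "2 * v"] eventually_ge_at_top[of 1]
  proof eventually_elim
    case (elim n)
    let ?m = "n div v"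
    \<comment> \<open>Despite the rounding, the parts have size at least n / (2v) once n >=
      2v.\<close>
    have "n < v * ?m + v" using v by (metis mult.commute dividend_less_div_times add.commute)
    then have "real n \<le> real v * real ?m + real v" by (metis less_imp_le of_nat_add of_nat_le_iff of_nat_mult)
    moreover have "2 * real v \<le> real n" using elim by (metis of_nat_le_iff of_nat_mult of_nat_numeral)
    ultimately have "real n \<le> 2 * (real v * real ?m)" by linarith
    then have m: "1 / (2 * real v) * real n \<le> real ?m" using v by (simp add: field_simps)
    have n: "0 < real n" using elim by simp
    have mpos: "0 < ?m" using elim v by (simp add: div_greater_zero_iff)
    have ppos: "0 < p n" using elim c n by (smt (verit) mult_pos_pos powr_gt_zero)
    have "measure_pmf.prob (random_hypergraph n d (p n)) {H. \<not> has_copy F H}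
      \<le> (\<Sum>J\<in>Pow F - {{}}. 1 / (real ?m ^ card (\<Union>J) * p n ^ card J))"
      by (rule prob_no_copy_le) (use elim ppos F d mpos in \<open>auto simp: v_def\<close>)
    also have "\<dots> \<le> (\<Sum>J\<in>Pow F - {{}}. 1 / B J n)"
    proof (intro sum_mono divide_left_mono)
      fix J
      have "B J n = (1 / (2 * real v) * real n) ^ card (\<Union>J) * (c * real n powr (- a)) ^ card J"
      proof -
        have "real n powr (real (card (\<Union>J)) - a * real (card J)) = real n powr real (card (\<Union>J)) * real n powr (- a * real (card J))"
          unfolding powr_add[symmetric] by simp
        also have "\<dots> = real n ^ card (\<Union>J) * (real n powr (- a)) ^ card J"
          using n by (simp add: powr_realpow powr_power mult.commute)
        finally show ?thesis unfolding B_def power_mult_distrib by simp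
      qed
      also have "\<dots> \<le> real ?m ^ card (\<Union>J) * p n ^ card J"
        using m elim c n v by (intro mult_mono power_mono) auto
      finally show "B J n \<le> real ?m ^ card (\<Union>J) * p n ^ card J" .
      have "0 < B J n" using c v n by (simp add: B_def)
      then show "0 < real ?m ^ card (\<Union>J) * p n ^ card J * B J n" using mpos ppos by simp
    qed simp
    finally show ?case .
  qed
  have "(\<lambda>n. \<Sum>J\<in>Pow F - {{}}. 1 / B J n) \<longlonglongrightarrow> (\<Sum>J\<in>Pow F - {{}}. 0)"
  proof (rule tendsto_sum)
    fix J assume J: "J \<in> Pow F - {{}}"
    define K where "K = (1 / (2 * real v)) ^ card (\<Union>J) * c ^ card J"
    define b where "b = real (card (\<Union>J)) - a * real (card J)"
    have K: "0 < K" and b: "0 < b" using c v balanced[of J] J by (auto simp: K_def b_def)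
    have "(\<lambda>n. 1 / (K * real n powr b)) \<longlonglongrightarrow> 0" using K b by real_asymp
    then show "(\<lambda>n. 1 / B J n) \<longlonglongrightarrow> 0" by (simp add: B_def K_def b_def)
  qed
  then have "(\<lambda>n. \<Sum>J\<in>Pow F - {{}}. 1 / B J n) \<longlonglongrightarrow> 0" by simp
  then show ?thesis by (intro tendsto_sandwich[OF _ bound tendsto_const]) auto
qed

section \<open>Exchangeable hyperedges\<close>

text \<open>For p <= 1/2 fewer hyperedges mean at least as much probability, so these preimages are
  all at least as likely as H.\<close>

definition alternatives :: "nat \<Rightarrow> nat \<Rightarrow> nat set set \<Rightarrow> nat set set set" where
  "alternatives n d H = {H' \<in> hypergraphs n d. Proj n H' = Proj n H \<and> card H' \<le> card H}"

lemma finite_alternatives: "finite (alternatives n d H)"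
  using finite_hypergraphs by (simp add: alternatives_def)

text \<open>Distinct recovered hypergraphs have distinct projections, so their families of
  alternatives are disjoint. Each family with at least M members has at least M times the mass of
  its recovered hypergraph; since all masses sum to at most 1, the recovered ones have at most 1 /
  M.\<close>

lemma recovery_prob_le_alternatives:
  assumes p: "0 \<le> p" "p \<le> 1 / 2" and M: "0 < M"
  shows "recovery_prob n d p A \<le> measure_pmf.prob (random_hypergraph n d p) {H. card (alternatives n d H) < M} + 1 / real M"
proof -
  let ?M = "random_hypergraph n d p" and ?N = "n choose d"
  define T where "T = {H \<in> hypergraphs n d. A (Proj n H) = H \<and> M \<le> card (alternatives n d H)}"
  have finT: "finite T" unfolding T_def using finite_hypergraphs by simp
  have "recovery_prob n d p A \<le> measure_pmf.prob ?M ({H. card (alternatives n d H) < M} \<union> T)"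
    unfolding recovery_prob_def
  proof (rule measure_pmf.finite_measure_mono_AE)
    show "AE H in ?M. H \<in> {H. A (Proj n H) = H} \<longrightarrow> H \<in> {H. card (alternatives n d H) < M} \<union> T"
      using set_pmf_random_hypergraph[of n d p] by (intro AE_pmfI) (auto simp: T_def)
  qed auto
  also have "\<dots> \<le> measure_pmf.prob ?M {H. card (alternatives n d H) < M} + measure_pmf.prob ?M T"
    by (rule measure_Un_le) auto
  also have "measure_pmf.prob ?M T \<le> 1 / real M"
  proof -
    have mono: "pmf ?M H \<le> pmf ?M H'" if H: "H \<in> T" "H' \<in> alternatives n d H" for H H'
    proof -
      have hyp: "H \<in> hypergraphs n d" "H' \<in> hypergraphs n d" and le: "card H' \<le> card H"
        using H by (auto simp: T_def alternatives_def)
      have "card H \<le> ?N"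
        using hyp card_mono[OF finite_d_subsets, of H n d] by (simp add: hypergraphs_def card_d_subsets)
      then have split: "?N - card H' = (card H - card H') + (?N - card H)" using le by simp
      have "p ^ card H * (1 - p) ^ (?N - card H) = p ^ card H' * p ^ (card H - card H') * (1 - p) ^ (?N - card H)"
        using le by (simp add: power_add[symmetric])
      also have "\<dots> \<le> p ^ card H' * (1 - p) ^ (card H - card H') * (1 - p) ^ (?N - card H)"
        using p by (intro mult_right_mono mult_left_mono power_mono) auto
      also have "\<dots> = p ^ card H' * (1 - p) ^ (?N - card H')" unfolding split power_add by simp
      finally show ?thesis using p by (simp add: pmf_random_hypergraph hyp)
    qed
    have disj: "alternatives n d H \<inter> alternatives n d H' = {}" if "H \<in> T" "H' \<in> T" "H \<noteq> H'" for H H'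
    proof (rule ccontr)
      assume "alternatives n d H \<inter> alternatives n d H' \<noteq> {}"
      then have "Proj n H = Proj n H'" by (auto simp: alternatives_def)
      moreover have "A (Proj n H) = H" "A (Proj n H') = H'" using that by (auto simp: T_def)
      ultimately show False using that(3) by simp
    qed
    have "real M * measure_pmf.prob ?M T = (\<Sum>H\<in>T. real M * pmf ?M H)"
      by (simp add: measure_measure_pmf_finite[OF finT] sum_distrib_left)
    also have "\<dots> \<le> (\<Sum>H\<in>T. measure_pmf.prob ?M (alternatives n d H))"
    proof (rule sum_mono)
      fix H assume H: "H \<in> T"
      then have "real M * pmf ?M H \<le> real (card (alternatives n d H)) * pmf ?M H"
        by (intro mult_right_mono) (auto simp: T_def)
      also have "\<dots> = (\<Sum>H'\<in>alternatives n d H. pmf ?M H)" by simp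
      also have "\<dots> \<le> (\<Sum>H'\<in>alternatives n d H. pmf ?M H')" by (intro sum_mono mono H)
      also have "\<dots> = measure_pmf.prob ?M (alternatives n d H)"
        by (simp add: measure_measure_pmf_finite[OF finite_alternatives])
      finally show "real M * pmf ?M H \<le> measure_pmf.prob ?M (alternatives n d H)" .
    qed
    also have "\<dots> = measure_pmf.prob ?M (\<Union>H\<in>T. alternatives n d H)"
      by (rule measure_pmf.finite_measure_finite_Union[symmetric])
        (use finT disj in \<open>auto simp: disjoint_family_on_def\<close>)
    also have "\<dots> \<le> 1" by simp
    finally show ?thesis using M by (simp add: field_simps)
  qed
  finally show ?thesis by simp
qed

text \<open>Pairs inside S lie in both h and g. Every other pair of h or g joins x or y to S and is
  covered by a hyperedge other than h.\<close>

lemma edges_swap: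
  assumes h: "h \<in> H" "h = insert x S" and g: "g = insert y S"
    and cov: "\<And>s. s \<in> S \<Longrightarrow> \<exists>k\<in>H - {h}. {x, s} \<subseteq> k" "\<And>s. s \<in> S \<Longrightarrow> \<exists>k\<in>H - {h}. {y, s} \<subseteq> k"
  shows "edges (insert g (H - {h})) = edges H"
proof -
  have two: "\<exists>s\<in>S. e = {z, s}" if e: "e \<subseteq> insert z S" "card e = 2" "\<not> e \<subseteq> S" for e z
  proof -
    obtain a b where ab: "e = {a, b}" "a \<noteq> b" using e by (auto simp: card_2_iff)
    then show ?thesis using e by auto
  qed
  have "e \<in> edges (insert g (H - {h})) \<longleftrightarrow> e \<in> edges H" if c: "card e = 2" for e
  proof
    assume "e \<in> edges (insert g (H - {h}))"
    then consider "e \<subseteq> g" | k where "k \<in> H - {h}" "e \<subseteq> k" by (auto simp: edges_def)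
    then show "e \<in> edges H"
    proof cases
      case 1
      show ?thesis
      proof (cases "e \<subseteq> S")
        case True
        then have "e \<subseteq> h" using h(2) by blast
        then show ?thesis using h(1) c unfolding edges_def by blast
      next
        case False
        then obtain s where s: "s \<in> S" "e = {y, s}" using two 1 c g by blast
        then obtain k where "k \<in> H - {h}" "{y, s} \<subseteq> k" using cov(2) by blast
        then show ?thesis using s c by (auto simp: edges_def)
      qed
    qed (use c in \<open>auto simp: edges_def\<close>)
  next
    assume "e \<in> edges H"
    then consider "e \<subseteq> h" | k where "k \<in> H - {h}" "e \<subseteq> k" by (auto simp: edges_def)
    then show "e \<in> edges (insert g (H - {h}))"
    proof cases
      case 1
      show ?thesis
      proof (cases "e \<subseteq> S")
        case True then show ?thesis using g c by (auto simp: edges_def)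
      next
        case False
        then obtain s where s: "s \<in> S" "e = {x, s}" using two 1 c h by blast
        then obtain k where "k \<in> H - {h}" "{x, s} \<subseteq> k" using cov(1) by blast
        then show ?thesis using s c by (auto simp: edges_def)
      qed
    qed (use c in \<open>auto simp: edges_def\<close>)
  qed
  then show ?thesis by (auto simp: edges_def)
qed

text \<open>
  The ambiguous pattern: the hyperedge consisting of \<open>Tip True\<close> and the \<open>d - 1\<close> base vertices can be
  exchanged for the one with \<open>Tip False\<close>, because every pair of a tip and a base vertex lies in a further
  hyperedge, whose other \<open>d - 2\<close> vertices are private.
\<close>

datatype role = Tip bool | Base nat | Private bool nat nat

definition top_edge :: "nat \<Rightarrow> bool \<Rightarrow> role set" where
  "top_edge d b = insert (Tip b) (Base ` {..<d - 1})"

definition cover_edge :: "nat \<Rightarrow> bool \<Rightarrow> nat \<Rightarrow> role set" where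
  "cover_edge d b i = {Tip b, Base i} \<union> Private b i ` {..<d - 2}"

definition swap_pattern :: "nat \<Rightarrow> role set set" where
  "swap_pattern d = insert (top_edge d True) {cover_edge d b i |b i. i < d - 1}"

lemma finite_swap_pattern: "finite (swap_pattern d)"
proof -
  have "{cover_edge d b i |b i. i < d - 1} = (\<lambda>(b, i). cover_edge d b i) ` (UNIV \<times> {..<d - 1})" by auto
  then show ?thesis by (simp add: swap_pattern_def)
qed

lemma card_top_edge: "1 \<le> d \<Longrightarrow> card (top_edge d b) = d"
proof -
  assume d: "1 \<le> d"
  have "card (Base ` {..<d - 1}) = d - 1" by (subst card_image) (auto simp: inj_on_def)
  then show ?thesis using d unfolding top_edge_def by (subst card_insert_disjoint) auto
qed

lemma card_cover_edge: "2 \<le> d \<Longrightarrow> card (cover_edge d b i) = d"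
proof -
  assume d: "2 \<le> d"
  have "card (Private b i ` {..<d - 2}) = d - 2" by (subst card_image) (auto simp: inj_on_def)
  then show ?thesis using d unfolding cover_edge_def by (subst card_Un_disjoint) auto
qed

lemma card_swap_pattern: "3 \<le> d \<Longrightarrow> h \<in> swap_pattern d \<Longrightarrow> card h = d"
  by (auto simp: swap_pattern_def card_top_edge card_cover_edge)

text \<open>With s = 1 - \<delta> each set of J is charged d - 2 + s vertices, and the d - 2 private
  vertices of a cover cancel against this. What remains compares s * |J| with the tips and base
  vertices, less d - 2 if the top set is present. For the whole pattern this is s * (2d - 1) < 3,
  which is the hypothesis on \<delta>, and the other J reduce to it.\<close>

lemma swap_pattern_balanced:
  assumes d: "3 \<le> d" and \<delta>: "(2 * real d - 4) / (2 * real d - 1) < \<delta>"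
    and J: "J \<subseteq> swap_pattern d" "J \<noteq> {}"
  shows "(real d - 1 - \<delta>) * real (card J) < real (card (\<Union>J))"
proof -
  define I where "I b = {i. i < d - 1 \<and> cover_edge d b i \<in> J}" for b
  define i1 where "i1 = card (I True)"
  define i2 where "i2 = card (I False)"
  define t where "t = (if top_edge d True \<in> J then 1 else 0 :: nat)"
  have finI: "finite (I b)" for b by (simp add: I_def)
  have finJ: "finite J" using J finite_swap_pattern finite_subset by blast
  have "I b \<subseteq> {..<d - 1}" for b by (auto simp: I_def)
  then have le: "i1 \<le> d - 1" "i2 \<le> d - 1" unfolding i1_def i2_def
    using card_mono[of "{..<d - 1}" "I True"] card_mono[of "{..<d - 1}" "I False"] by auto
  have J_eq: "J = (if top_edge d True \<in> J then {top_edge d True} else {}) \<union> (cover_edge d True ` I True \<union> cover_edge d False ` I False)"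
  proof
    show "J \<subseteq> (if top_edge d True \<in> J then {top_edge d True} else {}) \<union> (cover_edge d True ` I True \<union> cover_edge d False ` I False)"
    proof
      fix h assume h: "h \<in> J"
      then have "h \<in> swap_pattern d" using J by blast
      then consider "h = top_edge d True" | b i where "h = cover_edge d b i" "i < d - 1"
        unfolding swap_pattern_def by blast
      then show "h \<in> (if top_edge d True \<in> J then {top_edge d True} else {}) \<union> (cover_edge d True ` I True \<union> cover_edge d False ` I False)"
      proof cases
        case 1 then show ?thesis using h by simp
      next
        case 2
        then have "i \<in> I b" using h by (simp add: I_def)
        then show ?thesis using 2 by (cases b) auto
      qed
    qed
  qed (auto simp: I_def)
  have "card J \<le> card (if top_edge d True \<in> J then {top_edge d True} else {}) + card (cover_edge d True ` I True \<union> cover_edge d False ` I False)"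
    by (subst J_eq) (rule card_Un_le)
  also have "\<dots> \<le> t + (card (cover_edge d True ` I True) + card (cover_edge d False ` I False))"
    by (intro add_mono card_Un_le) (simp add: t_def)
  also have "\<dots> \<le> t + (i1 + i2)"
    unfolding i1_def i2_def by (intro add_mono card_image_le finI order_refl)
  finally have cJ: "card J \<le> t + (i1 + i2)" .
  have pos: "0 < t + i1 + i2"
  proof (rule ccontr)
    assume "\<not> 0 < t + i1 + i2"
    then have "card J = 0" using cJ by simp
    then show False using J finJ by simp
  qed
  define tips where "tips = (if 0 < i1 then {Tip True} else {}) \<union> (if 0 < i2 then {Tip False} else {})"
  define priv where "priv = (\<lambda>(b, i, j). Private b i j) ` (SIGMA b:UNIV. I b \<times> {..<d - 2})"
  have cover_sub: "cover_edge d b i \<subseteq> \<Union>J" if "i \<in> I b" for b i using that by (auto simp: I_def)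
  have I_ne: "0 < i1 \<Longrightarrow> I True \<noteq> {}" "0 < i2 \<Longrightarrow> I False \<noteq> {}" by (auto simp: i1_def i2_def)
  have tips_sub: "tips \<subseteq> \<Union>J"
  proof -
    have "Tip True \<in> \<Union>J" if pos: "0 < i1"
    proof -
      obtain i where "i \<in> I True" using I_ne(1)[OF pos] by blast
      from cover_sub[OF this] show ?thesis by (auto simp: cover_edge_def)
    qed
    moreover have "Tip False \<in> \<Union>J" if pos: "0 < i2"
    proof -
      obtain i where "i \<in> I False" using I_ne(2)[OF pos] by blast
      from cover_sub[OF this] show ?thesis by (auto simp: cover_edge_def)
    qed
    ultimately show ?thesis by (auto simp: tips_def)
  qed
  have priv_sub: "priv \<subseteq> \<Union>J"
    using cover_sub by (fastforce simp: priv_def cover_edge_def)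
  have base_sub: "Base ` (I True \<union> I False) \<subseteq> \<Union>J"
    using cover_sub by (fastforce simp: cover_edge_def)
  have finU: "finite (\<Union>J)"
  proof (rule finite_Union[OF finJ])
    fix h assume "h \<in> J"
    then have "card h = d" using J(1) card_swap_pattern[OF d] by blast
    then show "finite h" using d by (intro card_ge_0_finite) simp
  qed
  have fin: "finite priv" "finite tips" using priv_sub tips_sub finU finite_subset by blast+
  have cpriv: "card priv = (i1 + i2) * (d - 2)"
  proof -
    have "inj_on (\<lambda>(b, i, j). Private b i j) (SIGMA b:UNIV. I b \<times> {..<d - 2})" by (auto simp: inj_on_def)
    then have "card priv = card (SIGMA b:(UNIV :: bool set). I b \<times> {..<d - 2})" unfolding priv_def by (rule card_image)
    also have "\<dots> = (\<Sum>b\<in>(UNIV :: bool set). card (I b) * (d - 2))" using finI by (subst card_SigmaI) (auto simp: card_cartesian_product)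
    also have "\<dots> = (i1 + i2) * (d - 2)" by (simp add: UNIV_bool i1_def i2_def algebra_simps)
    finally show ?thesis .
  qed
  define s where "s = 1 - \<delta>"
  have s: "s * (2 * real d - 1) < 3"
  proof -
    have "2 * real d - 4 < \<delta> * (2 * real d - 1)" using \<delta> d by (simp add: pos_divide_less_eq)
    then show ?thesis by (simp add: s_def algebra_simps)
  qed
  \<comment> \<open>s is negative for \<delta> > 1; the maximum with 0 makes one estimate serve both
    signs.\<close>
  have sle: "s * x \<le> max 0 (s * (y :: real))" if "0 \<le> x" "x \<le> y" for x y
  proof (cases "0 \<le> s")
    case True
    then have "s * x \<le> s * y" using that by (intro mult_left_mono) auto
    then show ?thesis by simp
  next
    case False
    then have "s * x \<le> 0" using that by (simp add: mult_nonpos_nonneg)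
    then show ?thesis by simp
  qed
  have d2: "real (d - 2) = real d - 2" using d by (simp add: of_nat_diff)
  \<comment> \<open>Proved for the upper bound t + i1 + i2 of \<open>card J\<close>; passing to
    \<open>card J\<close> depends on the sign of d - 1 - \<delta> and is done at the end.\<close>
  have key: "(real d - 1 - \<delta>) * real (t + (i1 + i2)) < real (card (\<Union>J))"
  proof (cases "t = 1")
    case True
    then have "top_edge d True \<in> J" by (auto simp: t_def split: if_splits)
    then have top_sub: "top_edge d True \<subseteq> \<Union>J" by blast
    define q where "q = (if 0 < i2 then {Tip False} else {})"
    have "card (top_edge d True \<union> q \<union> priv) \<le> card (\<Union>J)"
      using top_sub tips_sub priv_sub by (intro card_mono finU) (auto simp: q_def tips_def)
    moreover have "card (top_edge d True \<union> q \<union> priv) = card (top_edge d True) + card q + card priv"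
      using fin by (subst card_Un_disjoint, simp add: top_edge_def q_def, simp, force simp: top_edge_def q_def priv_def,
        subst card_Un_disjoint) (auto simp: top_edge_def q_def)
    ultimately have "d + card q + (i1 + i2) * (d - 2) \<le> card (\<Union>J)" using cpriv card_top_edge[of d True] d by simp
    then have "real (d + card q + (i1 + i2) * (d - 2)) \<le> real (card (\<Union>J))" by (rule of_nat_mono)
    then have lower: "real d + real (card q) + real (i1 + i2) * (real d - 2) \<le> real (card (\<Union>J))" by (simp add: d2)
    have "s * (1 + real i1 + real i2) < 2 + real (card q)"
    proof (cases "0 < i2")
      case True
      have "s * (1 + real i1 + real i2) \<le> max 0 (s * (2 * real d - 1))" by (rule sle) (use le d in auto)
      then show ?thesis using s True by (auto simp: q_def)
    next
      case False
      have "s * (1 + real i1 + real i2) \<le> max 0 (s * real d)" by (rule sle) (use le d False in auto)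
      \<comment> \<open>For s > 0, s * (2d - 1) < 3 and s <= s * d / 3 even give s * d <
        9/5.\<close>
      moreover have "s * real d < 2"
      proof (cases "0 < s")
        case True
        have "s * 3 \<le> s * real d" using True d by simp
        then show ?thesis using s by (simp add: algebra_simps)
      next
        case False
        then have "s * real d \<le> 0" by (simp add: mult_nonpos_nonneg)
        then show ?thesis by simp
      qed
      ultimately show ?thesis by (auto simp: q_def)
    qed
    then show ?thesis using lower True by (simp add: s_def algebra_simps)
  next
    case False
    then have t0: "t = 0" by (auto simp: t_def split: if_splits)
    define b where "b = card (I True \<union> I False)"
    have b: "i1 \<le> b" "i2 \<le> b" unfolding b_def i1_def i2_def by (auto intro!: card_mono finI)
    have cb: "card (Base ` (I True \<union> I False)) = b" unfolding b_def by (intro card_image) (auto simp: inj_on_def)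
    have "card (tips \<union> Base ` (I True \<union> I False) \<union> priv) \<le> card (\<Union>J)"
      using tips_sub priv_sub base_sub by (intro card_mono finU) auto
    moreover have "card (tips \<union> Base ` (I True \<union> I False) \<union> priv) = card tips + card (Base ` (I True \<union> I False)) + card priv"
      using fin finI by (subst card_Un_disjoint, simp, simp, force simp: tips_def priv_def,
        subst card_Un_disjoint) (auto simp: tips_def)
    ultimately have "card tips + b + (i1 + i2) * (d - 2) \<le> card (\<Union>J)" using cpriv cb by simp
    then have "real (card tips + b + (i1 + i2) * (d - 2)) \<le> real (card (\<Union>J))" by (rule of_nat_mono)
    then have lower: "real (card tips) + real b + real (i1 + i2) * (real d - 2) \<le> real (card (\<Union>J))" by (simp add: d2)
    have "s * (real i1 + real i2) < real (card tips) + real b"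
    proof (cases "0 < i1 \<and> 0 < i2")
      case True
      then have tips2: "card tips = 2" by (simp add: tips_def)
      \<comment> \<open>A base vertex lies in at most two covers. For s above 1/2 the surplus s -
        1/2 per cover is largest in total for all 2d - 2 covers, and is still less than the two
        tips.\<close>
      have half: "(real i1 + real i2) / 2 \<le> real b" using b by simp
      show ?thesis
      proof (cases "s \<le> 1 / 2")
        case True
        have "s * (real i1 + real i2) \<le> 1 / 2 * (real i1 + real i2)" using True by (intro mult_right_mono) auto
        then show ?thesis using half tips2 by simp
      next
        case False
        have "(s - 1 / 2) * (real i1 + real i2) \<le> (s - 1 / 2) * (2 * real d - 2)"
          using False le d by (intro mult_left_mono) auto
        also have "\<dots> < 2" using s False d by (simp add: algebra_simps)
        finally have "s * (real i1 + real i2) < 2 + (real i1 + real i2) / 2" by (simp add: left_diff_distrib)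
        then show ?thesis using half tips2 by linarith
      qed
    next
      case False
      have tips1: "card tips = 1" using False pos t0 by (auto simp: tips_def)
      have "real i1 + real i2 \<le> real b" using False b by auto
      have "s \<le> 1"
      proof (rule ccontr)
        assume "\<not> s \<le> 1"
        then have "1 * (2 * real d - 1) \<le> s * (2 * real d - 1)" using d by (intro mult_right_mono) auto
        then have "1 * (2 * real d - 1) < 3" using s by (rule le_less_trans)
        then show False using d by simp
      qed
      then have "s * (real i1 + real i2) \<le> 1 * (real i1 + real i2)" by (intro mult_right_mono) auto
      then show ?thesis using tips1 \<open>real i1 + real i2 \<le> real b\<close> by simp
    qed
    then show ?thesis using lower t0 by (simp add: s_def algebra_simps)
  qed
  show ?thesis
  proof (cases "0 \<le> real d - 1 - \<delta>")
    case True
    have "(real d - 1 - \<delta>) * real (card J) \<le> (real d - 1 - \<delta>) * real (t + (i1 + i2))"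
      using True cJ by (intro mult_left_mono) auto
    then show ?thesis using key by linarith
  next
    case False
    then have "(real d - 1 - \<delta>) * real (card J) \<le> 0" by (simp add: mult_nonpos_nonneg)
    moreover have "0 < card (\<Union>J)"
    proof -
      obtain h where "h \<in> J" using J by auto
      then have "h \<subseteq> \<Union>J" "card h = d" using card_swap_pattern[OF d] J by auto
      then show ?thesis using card_mono[OF finU, of h] d by auto
    qed
    ultimately show ?thesis by linarith
  qed
qed

text \<open>M vertex-disjoint copies, told apart by the first component, so that one embedding
  yields M separate places for an exchange.\<close>

definition swap_patterns :: "nat \<Rightarrow> nat \<Rightarrow> (nat \<times> role) set set" where
  "swap_patterns d M = {Pair k ` h |k h. k < M \<and> h \<in> swap_pattern d}"

lemma swap_patterns_eq: "swap_patterns d M = (\<lambda>(k, h). Pair k ` h) ` ({..<M} \<times> swap_pattern d)"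
  by (auto simp: swap_patterns_def)

lemma swap_patterns_balanced:
  assumes d: "3 \<le> d" and \<delta>: "(2 * real d - 4) / (2 * real d - 1) < \<delta>" "\<delta> < real d - 1"
    and J: "J \<subseteq> swap_patterns d M" "J \<noteq> {}"
  shows "(real d - 1 - \<delta>) * real (card J) < real (card (\<Union>J))"
proof -
  define Jk where "Jk k = {h \<in> swap_pattern d. Pair k ` h \<in> J}" for k
  have finJk: "finite (Jk k)" for k using finite_swap_pattern by (simp add: Jk_def)
  have finUk: "finite (\<Union>(Jk k))" for k
  proof (rule finite_Union[OF finJk])
    fix h assume "h \<in> Jk k"
    then have "card h = d" using card_swap_pattern[OF d] by (simp add: Jk_def)
    then show "finite h" using d by (intro card_ge_0_finite) simp
  qed
  have "J = (\<lambda>(k, h). Pair k ` h) ` (SIGMA k:{..<M}. Jk k)"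
    using J(1) by (force simp: swap_patterns_def Jk_def)
  then have "card J \<le> card (SIGMA k:{..<M}. Jk k)" using finJk by (metis card_image_le finite_SigmaI finite_lessThan)
  then have c1: "card J \<le> (\<Sum>k<M. card (Jk k))" using finJk by simp
  have "\<Union>J = (SIGMA k:{..<M}. \<Union>(Jk k))"
    using J(1) by (force simp: swap_patterns_def Jk_def)
  then have c2: "card (\<Union>J) = (\<Sum>k<M. card (\<Union>(Jk k)))" using finUk by simp
  have bal: "(real d - 1 - \<delta>) * real (card (Jk k)) < real (card (\<Union>(Jk k)))" if "Jk k \<noteq> {}" for k
    by (rule swap_pattern_balanced[OF d \<delta>(1) _ that]) (auto simp: Jk_def)
  have bal': "(real d - 1 - \<delta>) * real (card (Jk k)) \<le> real (card (\<Union>(Jk k)))" for k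
    using bal[of k] by (cases "Jk k = {}") auto
  obtain k h where kh: "k < M" "h \<in> Jk k" using J by (force simp: swap_patterns_def Jk_def)
  have "(real d - 1 - \<delta>) * real (card J) \<le> (real d - 1 - \<delta>) * real (\<Sum>k<M. card (Jk k))"
    using \<delta>(2) by (intro mult_left_mono of_nat_mono[OF c1]) auto
  also have "\<dots> = (\<Sum>k<M. (real d - 1 - \<delta>) * real (card (Jk k)))" by (simp add: sum_distrib_left)
  also have "\<dots> < (\<Sum>k<M. real (card (\<Union>(Jk k))))"
    by (rule sum_strict_mono_ex1) (use bal bal' kh in auto)
  also have "\<dots> = real (card (\<Union>J))" by (simp add: c2)
  finally show ?thesis .
qed

text \<open>Exchanging in one copy k at a time gives M different preimages, distinguished by which
  \<open>h k\<close> they lack.\<close>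

lemma card_alternatives_ge:
  assumes d: "3 \<le> d" and H: "H \<in> hypergraphs n d" and copy: "has_copy (swap_patterns d M) H"
  shows "M \<le> card (alternatives n d H)"
proof -
  obtain \<phi> where inj: "inj_on \<phi> (\<Union>(swap_patterns d M))" and \<phi>: "\<And>h. h \<in> swap_patterns d M \<Longrightarrow> \<phi> ` h \<in> H"
    using copy by (auto simp: has_copy_def)
  have sub: "H \<subseteq> d_subsets n d" using H by (simp add: hypergraphs_def)
  have finH: "finite H" using sub finite_d_subsets finite_subset by blast
  have top: "Pair k ` top_edge d True \<in> swap_patterns d M" if "k < M" for k
    using that by (auto simp: swap_patterns_def swap_pattern_def)
  have cover: "Pair k ` cover_edge d b i \<in> swap_patterns d M" if "k < M" "i < d - 1" for k b i
    using that by (auto simp: swap_patterns_def swap_pattern_def)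
  define P where "P = \<Union>(swap_patterns d M)"
  have cover_P: "Pair k ` cover_edge d b i \<subseteq> P" if "k < M" "i < d - 1" for k b i
    using cover[OF that, of b] by (auto simp: P_def)
  have tipP: "(k, Tip b) \<in> P" if "k < M" for k b
    using cover_P[OF that, of 0 b] d by (auto simp: cover_edge_def)
  have baseP: "(k, Base i) \<in> P" if "k < M" "i < d - 1" for k i
    using cover_P[OF that, of True] by (auto simp: cover_edge_def)
  have privP: "(k, Private b i 0) \<in> P" if "k < M" "i < d - 1" for k b i
    using cover_P[OF that, of b] d by (auto simp: cover_edge_def)
  have topP: "Pair k ` top_edge d b \<subseteq> P" if "k < M" for k b
    using tipP baseP that by (auto simp: top_edge_def)
  have eq: "u = u'" if "\<phi> u = \<phi> u'" "u \<in> P" "u' \<in> P" for u u'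
    using inj that by (auto simp: P_def inj_on_def)
  have P_n: "\<phi> u \<in> {1..n}" if "u \<in> P" for u
    using that \<phi> sub by (fastforce simp: P_def d_subsets_def)
  define h where "h k = \<phi> ` Pair k ` top_edge d True" for k
  define g where "g k = \<phi> ` Pair k ` top_edge d False" for k
  have hH: "h k \<in> H" if "k < M" for k unfolding h_def by (rule \<phi>[OF top[OF that]])
  have tip_h: "\<phi> (k, Tip b) \<in> h k' \<Longrightarrow> k = k' \<and> b" if "k < M" "k' < M" for k k' b
  proof -
    assume "\<phi> (k, Tip b) \<in> h k'"
    then obtain u where "u \<in> top_edge d True" "\<phi> (k, Tip b) = \<phi> (k', u)" by (auto simp: h_def)
    then have "(k, Tip b) = (k', u)" using eq[of "(k, Tip b)" "(k', u)"] tipP topP that by blast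
    then show "k = k' \<and> b" using \<open>u \<in> top_edge d True\<close> by (auto simp: top_edge_def)
  qed
  have tip_in: "\<phi> (k, Tip True) \<in> h k" "\<phi> (k, Tip False) \<in> g k" for k by (auto simp: h_def g_def top_edge_def)
  have h_inj: "k = k'" if "k < M" "k' < M" "h k = h k'" for k k'
    using tip_h[of k k' True] tip_in(1)[of k] that by auto
  have gh: "g k \<noteq> h k" if "k < M" for k
    using tip_h[of k k False] tip_in(2)[of k] that by auto
  have g_sub: "g k \<in> d_subsets n d" if k: "k < M" for k
  proof -
    have "inj_on \<phi> (Pair k ` top_edge d False)" by (rule inj_on_subset[OF inj]) (use topP[OF k] in \<open>simp add: P_def\<close>)
    then have "card (g k) = card (Pair k ` top_edge d False)" unfolding g_def by (rule card_image)
    also have "\<dots> = d" using d by (subst card_image) (auto simp: inj_on_def card_top_edge)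
    finally have "card (g k) = d" .
    moreover have "g k \<subseteq> {1..n}" using P_n topP[OF k, of False] unfolding g_def by blast
    ultimately show ?thesis by (simp add: d_subsets_def)
  qed
  define H' where "H' k = insert (g k) (H - {h k})" for k
  have "H' k \<in> alternatives n d H" if k: "k < M" for k
  proof -
    have H'_sub: "H' k \<subseteq> d_subsets n d" using g_sub[OF k] sub by (auto simp: H'_def)
    define S where "S = \<phi> ` Pair k ` Base ` {..<d - 1}"
    have cov: "\<exists>e\<in>H - {h k}. {\<phi> (k, Tip b), s} \<subseteq> e" if s: "s \<in> S" for s b
    proof -
      obtain i where i: "i < d - 1" "s = \<phi> (k, Base i)" using s by (auto simp: S_def)
      define e where "e = \<phi> ` Pair k ` cover_edge d b i"
      have "e \<in> H" unfolding e_def by (rule \<phi>[OF cover[OF k i(1)]])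
      moreover have "{\<phi> (k, Tip b), s} \<subseteq> e" using i by (auto simp: e_def cover_edge_def)
      \<comment> \<open>For d >= 3 a cover has a private vertex, which is not in the top
        set.\<close>
      moreover have "e \<noteq> h k"
      proof
        assume "e = h k"
        moreover have "\<phi> (k, Private b i 0) \<in> e" using d by (auto simp: e_def cover_edge_def)
        ultimately obtain u where "u \<in> top_edge d True" "\<phi> (k, Private b i 0) = \<phi> (k, u)" by (auto simp: h_def)
        then have "(k, Private b i 0) = (k, u)"
          using eq[of "(k, Private b i 0)" "(k, u)"] privP[OF k i(1)] topP[OF k] by blast
        then show False using \<open>u \<in> top_edge d True\<close> by (auto simp: top_edge_def)
      qed
      ultimately show ?thesis by blast
    qed
    have "edges (H' k) = edges H"
      unfolding H'_def
    proof (rule edges_swap)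
      show "h k \<in> H" by (rule hH[OF k])
      show "h k = insert (\<phi> (k, Tip True)) S" "g k = insert (\<phi> (k, Tip False)) S"
        by (simp_all add: h_def g_def S_def top_edge_def)
    qed (use cov in auto)
    then have "Proj n (H' k) = Proj n H" using Proj_eq_edges[OF H'_sub] Proj_eq_edges[OF sub] by simp
    \<comment> \<open>Should \<open>g k\<close> already belong to H, the exchange loses a hyperedge,
      hence only an inequality.\<close>
    moreover have "card (H' k) \<le> card H"
    proof -
      have "card (H' k) \<le> Suc (card (H - {h k}))" unfolding H'_def using finH by (simp add: card_insert_if)
      also have "\<dots> = card H" by (rule card_Suc_Diff1[OF finH hH[OF k]])
      finally show ?thesis .
    qed
    ultimately show ?thesis using H'_sub by (simp add: alternatives_def hypergraphs_def)
  qed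
  moreover have "inj_on H' {..<M}"
  proof (rule inj_onI, rule ccontr)
    fix k k' assume k: "k \<in> {..<M}" "k' \<in> {..<M}" "H' k = H' k'" "k \<noteq> k'"
    then have "h k \<in> H' k'" using hH h_inj by (auto simp: H'_def)
    then have "h k \<in> H' k" using k by simp
    then show False using gh[of k] k by (auto simp: H'_def)
  qed
  ultimately have "card {..<M} \<le> card (alternatives n d H)"
    by (intro card_inj_on_le[of H']) (auto simp: finite_alternatives)
  then show ?thesis by simp
qed

text \<open>A fixed number M of copies leaves a success probability of up to 1 / M, so M is chosen
  in terms of the target error r before n grows.\<close>

theorem exact_recovery_impossible_by_swaps:
  fixes p :: "nat \<Rightarrow> real"
  assumes d: "3 \<le> d" and \<delta>: "(2 * real d - 4) / (2 * real d - 1) < \<delta>" "\<delta> < real d - 1"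
    and c: "0 < c" 
    and p: "\<forall>\<^sub>F n in sequentially. c * real n powr (- (real d - 1 - \<delta>)) \<le> p n \<and> p n \<le> 1 / 2"
  shows "(\<lambda>n. exact_recovery_prob n d (p n)) \<longlonglongrightarrow> 0"
proof (rule LIMSEQ_I)
  fix r :: real assume r: "0 < r"
  obtain M :: nat where M: "0 < M" "1 / real M < r / 2"
    using r by (metis half_gt_zero nat_approx_posE zero_less_Suc)
  let ?F = "swap_patterns d M"
  have "(\<lambda>n. measure_pmf.prob (random_hypergraph n d (p n)) {H. \<not> has_copy ?F H}) \<longlonglongrightarrow> 0"
  proof (rule copy_exists[where a = "real d - 1 - \<delta>" and c = c])
    show "finite ?F" unfolding swap_patterns_eq using finite_swap_pattern by simp
    show "card h = d" if h: "h \<in> ?F" for h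
    proof -
      obtain k h' where "h = Pair k ` h'" "h' \<in> swap_pattern d" using h by (auto simp: swap_patterns_def)
      then show ?thesis using card_swap_pattern[OF d] by (simp add: card_image inj_on_def)
    qed
    show "?F \<noteq> {}" using M by (auto simp: swap_patterns_def swap_pattern_def)
    show "(real d - 1 - \<delta>) * real (card J) < real (card (\<Union>J))" if "J \<subseteq> ?F" "J \<noteq> {}" for J
      by (rule swap_patterns_balanced[OF d \<delta> that])
    show "\<forall>\<^sub>F n in sequentially. c * real n powr (- (real d - 1 - \<delta>)) \<le> p n \<and> p n \<le> 1"
      using p by eventually_elim auto
  qed (use d c in auto)
  then have "\<forall>\<^sub>F n in sequentially. measure_pmf.prob (random_hypergraph n d (p n)) {H. \<not> has_copy ?F H} < r / 2"
    by (rule order_tendstoD) (use r in simp)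
  then have "\<forall>\<^sub>F n in sequentially. norm (exact_recovery_prob n d (p n) - 0) < r"
    using p eventually_ge_at_top[of 1]
  proof eventually_elim
    case (elim n)
    have "0 < c * real n powr (- (real d - 1 - \<delta>))" using c elim by simp
    then have p0: "0 \<le> p n" using elim by linarith
    obtain A where A: "exact_recovery_prob n d (p n) = recovery_prob n d (p n) A"
      using exact_recovery_prob_attained by blast
    have "recovery_prob n d (p n) A \<le> measure_pmf.prob (random_hypergraph n d (p n)) {H. card (alternatives n d H) < M} + 1 / real M"
      by (rule recovery_prob_le_alternatives) (use p0 elim M in auto)
    also have "measure_pmf.prob (random_hypergraph n d (p n)) {H. card (alternatives n d H) < M}
      \<le> measure_pmf.prob (random_hypergraph n d (p n)) {H. \<not> has_copy ?F H}"
    proof (rule measure_pmf.finite_measure_mono_AE)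
      show "AE H in random_hypergraph n d (p n). H \<in> {H. card (alternatives n d H) < M} \<longrightarrow> H \<in> {H. \<not> has_copy ?F H}"
        using card_alternatives_ge[OF d, of _ n M] set_pmf_random_hypergraph[of n d "p n"]
        by (intro AE_pmfI) (auto simp: not_less[symmetric])
    qed auto
    finally have "exact_recovery_prob n d (p n) < r" using A elim M by linarith
    moreover have "0 \<le> exact_recovery_prob n d (p n)" by (simp add: A recovery_prob_def)
    ultimately show ?case by simp
  qed
  then show "\<exists>no. \<forall>n\<ge>no. norm (exact_recovery_prob n d (p n) - 0) < r"
    by (simp add: eventually_sequentially)
qed

section \<open>The thresholds\<close>

theorem theorem3:
  fixes d :: nat and \<delta> c :: real and p \<epsilon> :: "nat \<Rightarrow> real"
  assumes "\<delta> < real d - 1"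
    and "c > 0"
    and "\<epsilon> \<longlonglongrightarrow> 0"
    and "\<forall>\<^sub>F n in sequentially. p n = (c + \<epsilon> n) * real n powr (- real d + 1 + \<delta>)"
  shows
    "(3 \<le> d \<and> d \<le> 5 \<longrightarrow>
        (\<delta> < (2 * real d - 4) / (2 * real d - 1) \<longrightarrow>
           (\<lambda>n. exact_recovery_prob n d (p n)) \<longlonglongrightarrow> 1) \<and>
        (\<delta> > (2 * real d - 4) / (2 * real d - 1) \<longrightarrow>
           (\<lambda>n. exact_recovery_prob n d (p n)) \<longlonglongrightarrow> 0)) \<and>
     (5 \<le> d \<longrightarrow>
        (\<delta> < (real d - 1) / (real d + 1) \<longrightarrow>
           (\<lambda>n. exact_recovery_prob n d (p n)) \<longlonglongrightarrow> 1) \<and>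
        (\<delta> > (real d - 1) / (real d + 1) \<longrightarrow>
           (\<lambda>n. exact_recovery_prob n d (p n)) \<longlonglongrightarrow> 0))"
proof -
  define a where "a = real d - 1 - \<delta>"
  have a: "0 < a" using assms(1) by (simp add: a_def)
  have "\<forall>\<^sub>F n in sequentially. \<bar>\<epsilon> n\<bar> < c / 2"
    using tendsto_rabs_zero[OF assms(3)] by (rule order_tendstoD) (use assms(2) in simp)
  \<comment> \<open>Only the order of magnitude of p is used from here on, with c + \<epsilon> n
    between c / 2 and 2c.\<close>
  then have p: "\<forall>\<^sub>F n in sequentially. c / 2 * real n powr (- a) \<le> p n \<and> p n \<le> 2 * c * real n powr (- a)"
    using assms(4)
  proof eventually_elim
    case (elim n)
    have exponent: "- real d + 1 + \<delta> = - a" by (simp add: a_def)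
    show ?case unfolding elim(2) exponent using elim(1) assms(2)
      by (intro conjI mult_right_mono) auto
  qed
  have "(\<lambda>n. 2 * c * real n powr (- a)) \<longlonglongrightarrow> 0" using a by real_asymp
  then have small: "\<forall>\<^sub>F n in sequentially. 2 * c * real n powr (- a) < 1 / 2"
    by (rule order_tendstoD) simp
  have p1: "\<forall>\<^sub>F n in sequentially. 0 \<le> p n \<and> p n \<le> 1 \<and> p n \<le> 2 * c * real n powr (- a)"
    using p small
  proof eventually_elim
    case (elim n)
    have "0 \<le> c / 2 * real n powr (- a)" using assms(2) by simp
    then show ?case using elim by linarith
  qed
  have p2: "\<forall>\<^sub>F n in sequentially. c / 2 * real n powr (- (real d - 1 - \<delta>)) \<le> p n \<and> p n \<le> 1 / 2"
    using p small by eventually_elim (simp add: a_def)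
  have p3: "\<forall>\<^sub>F n in sequentially. c / 2 * real n powr (- (real d - 1 - \<delta>)) \<le> p n
      \<and> p n \<le> max 1 (2 * c) * real n powr (- (real d - 1 - \<delta>)) \<and> p n \<le> 1"
    using p small
  proof eventually_elim
    case (elim n)
    have "2 * c * real n powr (- a) \<le> max 1 (2 * c) * real n powr (- a)" by (rule mult_right_mono) auto
    then show ?case using elim by (simp add: a_def)
  qed
  have possible: "(\<lambda>n. exact_recovery_prob n d (p n)) \<longlonglongrightarrow> 1"
    if "discharge_weights d \<theta> \<kappa> \<omega> \<rho> \<gamma>" "\<theta> < a" for \<theta> \<kappa> \<omega> \<rho> \<gamma>
    using exact_recovery_possible[OF that p1] .
  have swaps: "(\<lambda>n. exact_recovery_prob n d (p n)) \<longlonglongrightarrow> 0"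
    if "3 \<le> d" "\<delta> > (2 * real d - 4) / (2 * real d - 1)"
    by (rule exact_recovery_impossible_by_swaps[OF that assms(1) _ p2]) (use assms(2) in simp)
  have counting: "(\<lambda>n. exact_recovery_prob n d (p n)) \<longlonglongrightarrow> 0"
    if "3 \<le> d" "\<delta> > (real d - 1) / (real d + 1)"
    by (rule exact_recovery_impossible_by_counting[OF that assms(1) _ _ p3]) (use assms(2) in auto)
  have large: "(\<lambda>n. exact_recovery_prob n d (p n)) \<longlonglongrightarrow> 1"
    if "5 \<le> d" "\<delta> < (real d - 1) / (real d + 1)"
  proof (rule possible[OF discharge_weights_ge_5[OF that(1)]])
    have "real d * (real d - 1) / (real d + 1) = real d - 1 - (real d - 1) / (real d + 1)"
      by (simp add: field_simps)
    then show "real d * (real d - 1) / (real d + 1) < a" using that(2) by (simp add: a_def)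
  qed
  have low: "(\<lambda>n. exact_recovery_prob n d (p n)) \<longlonglongrightarrow> 1"
    if dd: "3 \<le> d" "d \<le> 5" and \<delta>: "\<delta> < (2 * real d - 4) / (2 * real d - 1)"
  proof -
    consider "d = 3" | "d = 4" | "d = 5" using dd by linarith
    then show ?thesis
    proof cases
      case 1
      have w: "discharge_weights d (8/5) (4/30) (3/5) (8/15) (8/30)" unfolding 1 by (rule discharge_weights_3)
      show ?thesis by (rule possible[OF w]) (use \<delta> 1 in \<open>simp add: a_def\<close>)
    next
      case 2
      have w: "discharge_weights d (17/7) (9/168) (3/7) (17/42) (17/56)" unfolding 2 by (rule discharge_weights_4)
      show ?thesis by (rule possible[OF w]) (use \<delta> 2 in \<open>simp add: a_def\<close>)
    next
      \<comment> \<open>At d = 5 the two thresholds coincide: 6/9 = 4/6.\<close>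
      case 3
      then show ?thesis using \<delta> by (intro large) simp_all
    qed
  qed
  show ?thesis using low large swaps counting by auto
qed

end
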